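(* Let $(M,\rho)$ be a perfect Polish metric space, let $X=\prod_{-\infty}^{+\infty}M$ with the metric $d$ given in the context, and let $T:X\to X$ be the full-shift. Let $\mathcal{M}(T)$ be the space of $T$-invariant Borel probability measures on $X$ with the weak topology. Then: I. The set $\mathcal{M}_e$ of ergodic measures is residual in $\mathcal{M}(T)$. II. The set $C_X=\{\mu\in\mathcal{M}(T)\mid \operatorname{supp}(\mu)=X\}$ of invariant measures with full support is a dense $G_\delta$ subset of $\mathcal{M}(T)$. III. The set $HD=\{\mu\in\mathcal{M}(T)\mid \dim_H(\mu)=0\}$ is a dense $G_\delta$ subset of $\mathcal{M}(T)$. IV. The set $PD=\{\mu\in\mathcal{M}(T)\mid \dim_P(\mu)=+\infty\}$ is a dense $G_\delta$ subset of $\mathcal{M}(T)$. V. The set $\underline{\mathcal{R}}=\{\mu\in\mathcal{M}(T)\mid \underline{R}(x)=0 \text{ for } \mu\text{-a.e. } x\}$ is a dense $G_\delta$ subset of $\mathcal{M}(T)$. VI. The set $\overline{\mathcal{R}}=\{\mu\in\mathcal{M}(T)\mid \overline{R}(x)=+\infty \text{ for } \mu\text{-a.e. } x\}$ is a dense $G_\delta$ subset of $\mathcal{M}(T)$. VII. The set $\{\mu\in\mathcal{M}(T)\mid \underline{R}(x,y)=0 \text{ for } (\mu\times\mu)\text{-a.e. } (x,y)\in X\times X\}$ is a dense $G_\delta$ subset of $\mathcal{M}(T)$. VIII. The set $\{\mu\in\mathcal{M}(T)\mid \overline{R}(x,y)=+\infty \text{ for } (\mu\times\mu)\text{-a.e.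 } (x,y)\in X\times X\}$ is residual in $\mathcal{M}(T)$.
   Context: A Polish metric space is a complete separable metric space; it is perfect if it has no isolated points. A subset of a topological space is residual if it contains the intersection of a countable family of open dense subsets. Full-shift: $X=\prod_{-\infty}^{+\infty}M$ is the set of bilateral sequences $x=(x_n)_{n\in\mathbb{Z}}$ in $M$, with the metric $d(x,y)=\sum_{n\in\mathbb{Z}}\frac{1}{2^{|n|}}\frac{\rho(x_n,y_n)}{1+\rho(x_n,y_n)}$, which induces the product topology, and $T:X\to X$ is the homeomorphism $(Tx)_i=x_{i-1}$ for all $i\in\mathbb{Z}$. The weak topology is the coarsest one for which $\mu_\alpha\to\mu$ if and only if $\int f\,d\mu_\alpha\to\int f\,d\mu$ for every bounded continuous $f$. Dimensions of sets. Let $E\subset X$, $\alpha>0$. $H^\alpha(E)=\lim_{\delta\to0}\inf\{\sum_k(\operatorname{diam}E_k)^\alpha\}$, the infimum being over countable collections $\{E_k\}$ with $E\subset\bigcup_kE_k$ and $\operatorname{diam}(E_k)\le\delta$ ($\inf\emptyset=\infty$). For $0<\delta<1$, a $\delta$-packing of $E\neq\emptyset$ is a countable collection of disjoint closed balls $B(x_k,r_k)$ with specified centers $x_k\in E$ and radii $0<r_k\le\delta/2$; $P^\alpha_\delta(E)=\sup\sum_k(2r_k)^\alpha$ over all $\delta$-packings of $E$, $P_\delta^\alpha(\emptyset)=0$, $P^\alpha_0(E)=\lim_{\delta\to0}P^\alpha_\delta(E)$, and $P^\alpha(E)=\inf\{\sum_kP^\alpha_0(E_k)\mid E\subset\bigcup_kE_k\}$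 over countable coverings. Then $\dim_H(E)=\inf\{\alpha>0\mid H^\alpha(E)=0\}$ and $\dim_P(E)=\inf\{\alpha>0\mid P^\alpha(E)=0\}$ (with $\inf\emptyset=+\infty$). Dimensions of measures. For $K\in\{H,P\}$ and a Borel measure $\mu$: $\dim_K^-(\mu)=\inf\{\dim_K(E)\mid \mu(E)>0,\ E \text{ Borel}\}$ and $\dim_K^+(\mu)=\inf\{\dim_K(E)\mid \mu(X\setminus E)=0,\ E\text{ Borel}\}$. If these are equal, the common value is $\dim_K(\mu)$; thus $\dim_K(\mu)=c$ means $\dim_K^-(\mu)=\dim_K^+(\mu)=c$. Recurrence. For $x,y\in X$, $r>0$, with $\overline{B}(y,r)$ the closed ball and $\mathbb{N}=\{1,2,\dots\}$: $\tau_r(x,y)=\inf\{n\in\mathbb{N}\mid T^nx\in\overline{B}(y,r)\}$ ($\inf\emptyset=\infty$, $\log\infty=\infty$), $\tau_r(x)=\tau_r(x,x)$, $\underline{R}(x,y)=\liminf_{r\to0}\frac{\log\tau_r(x,y)}{-\log r}$, $\overline{R}(x,y)=\limsup_{r\to0}\frac{\log\tau_r(x,y)}{-\log r}$, $\underline{R}(x)=\underline{R}(x,x)$, $\overline{R}(x)=\overline{R}(x,x)$. *)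

theory Defs
  imports "HOL-Probability.Probability"
begin

section \<open>The space of bilateral sequences\<close>

text \<open>
  The metric of the full shift is not the one of the library instance
  \<open>fun :: (countable, metric_space) metric_space\<close>, and dimensions depend on the metric,
  so the sequence space is a type of its own.
\<close>

typedef 'a biseq = "UNIV :: (int \<Rightarrow> 'a) set"
  morphisms coord Biseq
  by simp

lemma biseq_weight_summable: "(\<lambda>n::int. 1 / 2 ^ nat \<bar>n\<bar> :: real) summable_on UNIV"
proof -
  have s: "(\<lambda>n::nat. 1 / 2 ^ n :: real) summable_on UNIV"
    using summable_geometric[of "1/2 :: real"]
    by (intro norm_summable_imp_summable_on) (simp add: power_divide)
  have 1: "(\<lambda>n::int. 1 / 2 ^ nat \<bar>n\<bar> :: real) summable_on range int"
    using s by (subst summable_on_reindex) (auto simp: o_def)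
  have 2: "(\<lambda>n::int. 1 / 2 ^ nat \<bar>n\<bar> :: real) summable_on range (\<lambda>n. - int n)"
    using s by (subst summable_on_reindex) (auto simp: o_def inj_on_def)
  have "n \<in> range int \<union> range (\<lambda>n. - int n)" for n
    by (cases n rule: int_cases2) auto
  then have "(UNIV :: int set) = range int \<union> (range (\<lambda>n. - int n) - range int)"
    by blast
  moreover have "(\<lambda>n::int. 1 / 2 ^ nat \<bar>n\<bar> :: real) summable_on
      (range int \<union> (range (\<lambda>n. - int n) - range int))"
    by (rule summable_on_Un_disjoint[OF 1 summable_on_subset[OF 2]]) auto
  ultimately show ?thesis by simp
qed

instantiation biseq :: (metric_space) metric_space
begin

definition dist_biseq_def:
  "dist x y = (\<Sum>\<^sub>\<infinity>n::int. 1 / 2 ^ nat \<bar>n\<bar> *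
     (dist (coord x n) (coord y n) / (1 + dist (coord x n) (coord y n))))"

definition uniformity_biseq_def:
  "(uniformity :: ('a biseq \<times> 'a biseq) filter) =
     (INF e\<in>{0<..}. principal {(x, y). dist x y < e})"

definition open_biseq_def:
  "open (U :: 'a biseq set) \<longleftrightarrow>
     (\<forall>x\<in>U. eventually (\<lambda>(x', y). x' = x \<longrightarrow> y \<in> U) uniformity)"

lemma biseq_dist_summable:
  fixes x y :: "'a biseq"
  shows "(\<lambda>n::int. 1 / 2 ^ nat \<bar>n\<bar> *
     (dist (coord x n) (coord y n) / (1 + dist (coord x n) (coord y n)))) summable_on UNIV"
  using biseq_weight_summable
proof (rule summable_on_comparison_test)
  fix n :: int
  have "dist (coord x n) (coord y n) / (1 + dist (coord x n) (coord y n)) \<le> 1"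
    by (simp add: divide_le_eq add_pos_nonneg)
  then show "1 / 2 ^ nat \<bar>n\<bar> * (dist (coord x n) (coord y n) / (1 + dist (coord x n) (coord y n)))
      \<le> 1 / 2 ^ nat \<bar>n\<bar>"
    by (simp add: divide_simps)
  show "0 \<le> 1 / 2 ^ nat \<bar>n\<bar> * (dist (coord x n) (coord y n) / (1 + dist (coord x n) (coord y n)))"
    by simp
qed

instance
proof
  show "(uniformity :: ('a biseq \<times> 'a biseq) filter) =
      (INF e\<in>{0<..}. principal {(x, y). dist x y < e})"
    by (rule uniformity_biseq_def)
  show "open U \<longleftrightarrow> (\<forall>x\<in>U. eventually (\<lambda>(x', y). x' = x \<longrightarrow> y \<in> U) uniformity)"
    for U :: "'a biseq set"
    by (rule open_biseq_def)
  fix x y z :: "'a biseq"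
  show "dist x y = 0 \<longleftrightarrow> x = y"
  proof
    assume "dist x y = 0"
    have "coord x n = coord y n" for n
    proof -
      have "1 / 2 ^ nat \<bar>n\<bar> * (dist (coord x n) (coord y n) / (1 + dist (coord x n) (coord y n))) = 0"
        by (rule nonneg_infsum_le_0D[OF _ biseq_dist_summable])
          (use \<open>dist x y = 0\<close> in \<open>auto simp: dist_biseq_def\<close>)
      then show ?thesis
        using zero_le_dist[of "coord x n" "coord y n"] by (auto simp: add_eq_0_iff)
    qed
    then show "x = y"
      by (metis coord_inverse ext)
  next
    assume "x = y"
    then show "dist x y = 0" by (simp add: dist_biseq_def)
  qed
  have frac_mono: "c / (1 + c) \<le> e / (1 + e)" if "0 \<le> c" "c \<le> e" for c e :: real
  proof -
    have "c * (1 + e) \<le> e * (1 + c)" using that by (simp add: distrib_left mult.commute)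
    then show ?thesis using that by (simp add: frac_le_eq pos_divide_le_eq pos_le_divide_eq)
  qed
  have frac: "c / (1 + c) \<le> a / (1 + a) + b / (1 + b)"
    if "0 \<le> a" "0 \<le> b" "0 \<le> c" "c \<le> a + b" for a b c :: real
  proof -
    have "c / (1 + c) \<le> (a + b) / (1 + (a + b))"
      using that by (intro frac_mono)
    also have "\<dots> = a / (1 + (a + b)) + b / (1 + (a + b))"
      by (rule add_divide_distrib)
    also have "\<dots> \<le> a / (1 + a) + b / (1 + b)"
      using that by (intro add_mono divide_left_mono) (auto intro!: mult_pos_pos add_pos_nonneg)
    finally show ?thesis .
  qed
  have "dist x y \<le> (\<Sum>\<^sub>\<infinity>n::int.
      1 / 2 ^ nat \<bar>n\<bar> * (dist (coord x n) (coord z n) / (1 + dist (coord x n) (coord z n))) +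
      1 / 2 ^ nat \<bar>n\<bar> * (dist (coord y n) (coord z n) / (1 + dist (coord y n) (coord z n))))"
    unfolding dist_biseq_def
  proof (rule infsum_mono)
    fix n :: int
    show "1 / 2 ^ nat \<bar>n\<bar> * (dist (coord x n) (coord y n) / (1 + dist (coord x n) (coord y n))) \<le>
      1 / 2 ^ nat \<bar>n\<bar> * (dist (coord x n) (coord z n) / (1 + dist (coord x n) (coord z n))) +
      1 / 2 ^ nat \<bar>n\<bar> * (dist (coord y n) (coord z n) / (1 + dist (coord y n) (coord z n)))"
      unfolding distrib_left[symmetric]
      by (intro mult_left_mono frac) (auto simp: dist_triangle2)
  qed (rule biseq_dist_summable summable_on_add[OF biseq_dist_summable biseq_dist_summable])+
  also have "\<dots> = dist x z + dist y z"
    unfolding dist_biseq_def by (rule infsum_add[OF biseq_dist_summable biseq_dist_summable])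
  finally show "dist x y \<le> dist x z + dist y z" .
qed

end

definition full_shift :: "'a biseq \<Rightarrow> 'a biseq" where
  "full_shift x = Biseq (\<lambda>i. coord x (i - 1))"


section \<open>Invariant measures and the weak topology\<close>

definition invariant_measures :: "('x::topological_space \<Rightarrow> 'x) \<Rightarrow> 'x measure set" where
  "invariant_measures T = {\<mu>. prob_space \<mu> \<and> sets \<mu> = sets borel \<and>
     (\<forall>A\<in>sets borel. emeasure \<mu> (T -` A) = emeasure \<mu> A)}"

definition ergodic_measures :: "('x::topological_space \<Rightarrow> 'x) \<Rightarrow> 'x measure set" where
  "ergodic_measures T = {\<mu> \<in> invariant_measures T.
     \<forall>A\<in>sets borel. T -` A = A \<longrightarrow> emeasure \<mu> A = 0 \<or> emeasure \<mu> A = 1}"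

definition msupp :: "'x::topological_space measure \<Rightarrow> 'x set" where
  "msupp \<mu> = {x. \<forall>U. open U \<and> x \<in> U \<longrightarrow> emeasure \<mu> U > 0}"

text \<open>
  The initial topology on \<open>S\<close> of the maps \<open>\<mu> \<mapsto> \<integral>f d\<mu>\<close>, \<open>f\<close> bounded and continuous; the lemma
  below is the usual characterisation of convergence (of nets, i.e. along filters).
\<close>

definition weak_topology :: "'x::topological_space measure set \<Rightarrow> 'x measure topology" where
  "weak_topology S = topology_generated_by
     {{\<mu> \<in> S. (\<integral>x. f x \<partial>\<mu>) \<in> V} | (f :: 'x \<Rightarrow> real) V.
        continuous_on UNIV f \<and> bounded (range f) \<and> open V}"

lemma topspace_weak_topology: "topspace (weak_topology S) = S"
proof -
  have "{\<mu> \<in> S. (\<integral>x. (0::real) \<partial>\<mu>) \<in> UNIV} \<in> {{\<mu> \<in> S. (\<integral>x. f x \<partial>\<mu>) \<in> V} | (f :: 'a \<Rightarrow> real) V.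
        continuous_on UNIV f \<and> bounded (range f) \<and> open V}"
    by (intro CollectI exI[of _ "\<lambda>_. 0"] exI[of _ UNIV]) auto
  then show ?thesis
    unfolding weak_topology_def topology_generated_by_topspace by auto
qed

lemma limitin_weak_topology:
  "limitin (weak_topology S) m \<mu> F \<longleftrightarrow>
     \<mu> \<in> S \<and> (\<forall>\<^sub>F i in F. m i \<in> S) \<and>
     (\<forall>f :: 'x::topological_space \<Rightarrow> real. continuous_on UNIV f \<and> bounded (range f) \<longrightarrow>
        ((\<lambda>i. \<integral>x. f x \<partial>(m i)) \<longlongrightarrow> (\<integral>x. f x \<partial>\<mu>)) F)"
proof safe
  assume L: "limitin (weak_topology S) m \<mu> F"
  show "\<mu> \<in> S" using L by (simp add: limitin_def topspace_weak_topology)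
  show "\<forall>\<^sub>F i in F. m i \<in> S"
    using L openin_topspace[of "weak_topology S"] by (auto simp: limitin_def topspace_weak_topology)
  fix f :: "'x \<Rightarrow> real" assume f: "continuous_on UNIV f" "bounded (range f)"
  show "((\<lambda>i. \<integral>x. f x \<partial>(m i)) \<longlongrightarrow> (\<integral>x. f x \<partial>\<mu>)) F"
  proof (rule topological_tendstoI)
    fix V :: "real set" assume V: "open V" "(\<integral>x. f x \<partial>\<mu>) \<in> V"
    have "openin (weak_topology S) {\<mu> \<in> S. (\<integral>x. f x \<partial>\<mu>) \<in> V}"
      unfolding weak_topology_def by (rule topology_generated_by_Basis) (use f V in blast)
    then have "\<forall>\<^sub>F i in F. m i \<in> {\<mu> \<in> S. (\<integral>x. f x \<partial>\<mu>) \<in> V}"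
      using L V \<open>\<mu> \<in> S\<close> by (auto simp: limitin_def)
    then show "\<forall>\<^sub>F i in F. (\<integral>x. f x \<partial>(m i)) \<in> V"
      by (rule eventually_mono) auto
  qed
next
  assume \<mu>: "\<mu> \<in> S" and m: "\<forall>\<^sub>F i in F. m i \<in> S"
    and f: "\<forall>f :: 'x \<Rightarrow> real. continuous_on UNIV f \<and> bounded (range f) \<longrightarrow>
        ((\<lambda>i. \<integral>x. f x \<partial>(m i)) \<longlongrightarrow> (\<integral>x. f x \<partial>\<mu>)) F"
  have "\<mu> \<in> U \<longrightarrow> (\<forall>\<^sub>F i in F. m i \<in> U)" if "openin (weak_topology S) U" for U
    using openin_topology_generated_by[OF that[unfolded weak_topology_def]]
  proof induction
    case (Int a b)
    then show ?case by (auto intro: eventually_conj)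
  next
    case (UN K)
    show ?case
    proof
      assume "\<mu> \<in> \<Union>K"
      then obtain k where "k \<in> K" "\<mu> \<in> k" by auto
      with UN have "\<forall>\<^sub>F i in F. m i \<in> k" by auto
      then show "\<forall>\<^sub>F i in F. m i \<in> \<Union>K" by (rule eventually_mono) (use \<open>k \<in> K\<close> in auto)
    qed
  next
    case (Basis s)
    then obtain g :: "'x \<Rightarrow> real" and V where g: "s = {\<mu> \<in> S. (\<integral>x. g x \<partial>\<mu>) \<in> V}"
      "continuous_on UNIV g" "bounded (range g)" "open V" by auto
    show ?case
    proof
      assume "\<mu> \<in> s"
      then have "\<forall>\<^sub>F i in F. (\<integral>x. g x \<partial>(m i)) \<in> V"
        using f g by (auto intro: topological_tendstoD)
      with m show "\<forall>\<^sub>F i in F. m i \<in> s" by eventually_elim (use g in auto)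
    qed
  qed auto
  then show "limitin (weak_topology S) m \<mu> F"
    by (auto simp: limitin_def topspace_weak_topology \<mu>)
qed

definition dense_in :: "'b topology \<Rightarrow> 'b set \<Rightarrow> bool" where
  "dense_in Y S \<longleftrightarrow> S \<subseteq> topspace Y \<and> Y closure_of S = topspace Y"

definition dense_gdelta_in :: "'b topology \<Rightarrow> 'b set \<Rightarrow> bool" where
  "dense_gdelta_in Y S \<longleftrightarrow> dense_in Y S \<and> gdelta_in Y S"

definition residual_in :: "'b topology \<Rightarrow> 'b set \<Rightarrow> bool" where
  "residual_in Y S \<longleftrightarrow> S \<subseteq> topspace Y \<and>
     (\<exists>\<U>. countable \<U> \<and> (\<forall>U\<in>\<U>. openin Y U \<and> dense_in Y U) \<and> topspace Y \<inter> \<Inter>\<U> \<subseteq> S)"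


section \<open>Hausdorff and packing dimension\<close>

text \<open>
  Covers are sequences; finite covers are padded with empty sets, which contribute
  \<open>0 powr \<alpha> = 0\<close>.  Boundedness is required explicitly because the library's \<open>diameter\<close>
  is meaningful for bounded sets only.
\<close>

definition hausdorff_premeasure :: "real \<Rightarrow> real \<Rightarrow> 'x::metric_space set \<Rightarrow> ennreal" where
  "hausdorff_premeasure \<delta> \<alpha> E =
     Inf {(\<Sum>k. ennreal (diameter (C k) powr \<alpha>)) | C :: nat \<Rightarrow> 'x set.
       E \<subseteq> (\<Union>k. C k) \<and> (\<forall>k. bounded (C k) \<and> diameter (C k) \<le> \<delta>)}"

definition hausdorff_measure :: "real \<Rightarrow> 'x::metric_space set \<Rightarrow> ennreal" where
  "hausdorff_measure \<alpha> E = Lim (at_right 0) (\<lambda>\<delta>. hausdorff_premeasure \<delta> \<alpha> E)"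

definition hausdorff_dim :: "'x::metric_space set \<Rightarrow> ereal" where
  "hausdorff_dim E = Inf {ereal \<alpha> | \<alpha>. \<alpha> > 0 \<and> hausdorff_measure \<alpha> E = 0}"

text \<open>
  A packing is a countable set of pairs (centre, radius).  The only packing of the empty set
  is the empty one, so its packing premeasure is 0.
\<close>

definition is_packing :: "real \<Rightarrow> 'x::metric_space set \<Rightarrow> ('x \<times> real) set \<Rightarrow> bool" where
  "is_packing \<delta> E C \<longleftrightarrow> countable C \<and> (\<forall>(x, r)\<in>C. x \<in> E \<and> 0 < r \<and> r \<le> \<delta> / 2) \<and>
     disjoint_family_on (\<lambda>(x, r). cball x r) C"

definition packing_premeasure :: "real \<Rightarrow> real \<Rightarrow> 'x::metric_space set \<Rightarrow> ennreal" where
  "packing_premeasure \<delta> \<alpha> E =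
     Sup {(\<Sum>\<^sub>\<infinity>(x, r)\<in>C. ennreal ((2 * r) powr \<alpha>)) | C. is_packing \<delta> E C}"

definition packing_premeasure_0 :: "real \<Rightarrow> 'x::metric_space set \<Rightarrow> ennreal" where
  "packing_premeasure_0 \<alpha> E = Lim (at_right 0) (\<lambda>\<delta>. packing_premeasure \<delta> \<alpha> E)"

definition packing_measure :: "real \<Rightarrow> 'x::metric_space set \<Rightarrow> ennreal" where
  "packing_measure \<alpha> E =
     Inf {(\<Sum>k. packing_premeasure_0 \<alpha> (C k)) | C :: nat \<Rightarrow> 'x set. E \<subseteq> (\<Union>k. C k)}"

definition packing_dim :: "'x::metric_space set \<Rightarrow> ereal" where
  "packing_dim E = Inf {ereal \<alpha> | \<alpha>. \<alpha> > 0 \<and> packing_measure \<alpha> E = 0}"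

text \<open>Both limits exist, by monotonicity in \<open>\<delta>\<close>.\<close>

lemma hausdorff_measure_eq_SUP:
  "hausdorff_measure \<alpha> E = (SUP \<delta>\<in>{0<..}. hausdorff_premeasure \<delta> \<alpha> E)"
  unfolding hausdorff_measure_def
proof (rule tendsto_Lim)
  have anti: "hausdorff_premeasure \<delta>' \<alpha> E \<le> hausdorff_premeasure \<delta> \<alpha> E" if "\<delta> \<le> \<delta>'" for \<delta> \<delta>'
    unfolding hausdorff_premeasure_def by (rule Inf_superset_mono) (use order_trans[OF _ that] in blast)
  show "((\<lambda>\<delta>. hausdorff_premeasure \<delta> \<alpha> E) \<longlongrightarrow> (SUP \<delta>\<in>{0<..}. hausdorff_premeasure \<delta> \<alpha> E))
      (at_right 0)"
  proof (rule order_tendstoI)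
    fix a assume "a < (SUP \<delta>\<in>{0<..}. hausdorff_premeasure \<delta> \<alpha> E)"
    then obtain d where d: "d > 0" "a < hausdorff_premeasure d \<alpha> E" by (auto simp: less_SUP_iff)
    have "\<forall>\<^sub>F \<delta> in at_right 0. \<delta> < d" using eventually_at_right_real[OF d(1)] by (rule eventually_mono) simp
    then show "\<forall>\<^sub>F \<delta> in at_right 0. a < hausdorff_premeasure \<delta> \<alpha> E"
      by (rule eventually_mono) (rule less_le_trans[OF d(2) anti], simp)
  next
    fix a assume a: "(SUP \<delta>\<in>{0<..}. hausdorff_premeasure \<delta> \<alpha> E) < a"
    show "\<forall>\<^sub>F \<delta> in at_right 0. hausdorff_premeasure \<delta> \<alpha> E < a"
      using eventually_at_right_less
      by (rule eventually_mono) (rule le_less_trans[OF SUP_upper a], simp)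
  qed
qed simp

lemma packing_premeasure_0_eq_INF:
  "packing_premeasure_0 \<alpha> E = (INF \<delta>\<in>{0<..<1}. packing_premeasure \<delta> \<alpha> E)"
  unfolding packing_premeasure_0_def
proof (rule tendsto_Lim)
  have mono: "packing_premeasure \<delta> \<alpha> E \<le> packing_premeasure \<delta>' \<alpha> E" if "\<delta> \<le> \<delta>'" for \<delta> \<delta>'
  proof -
    have "is_packing \<delta>' E C" if "is_packing \<delta> E C" for C
      using that \<open>\<delta> \<le> \<delta>'\<close> by (fastforce simp: is_packing_def)
    then show ?thesis
      unfolding packing_premeasure_def by (intro Sup_subset_mono) blast
  qed
  show "((\<lambda>\<delta>. packing_premeasure \<delta> \<alpha> E) \<longlongrightarrow> (INF \<delta>\<in>{0<..<1}. packing_premeasure \<delta> \<alpha> E))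
      (at_right 0)"
  proof (rule order_tendstoI)
    fix a assume "(INF \<delta>\<in>{0<..<1}. packing_premeasure \<delta> \<alpha> E) < a"
    then obtain d where d: "d > 0" "packing_premeasure d \<alpha> E < a" by (auto simp: INF_less_iff)
    have "\<forall>\<^sub>F \<delta> in at_right 0. \<delta> < d" using eventually_at_right_real[OF d(1)] by (rule eventually_mono) simp
    then show "\<forall>\<^sub>F \<delta> in at_right 0. packing_premeasure \<delta> \<alpha> E < a"
      by (rule eventually_mono) (rule le_less_trans[OF mono d(2)], simp)
  next
    fix a assume a: "a < (INF \<delta>\<in>{0<..<1}. packing_premeasure \<delta> \<alpha> E)"
    have "\<forall>\<^sub>F \<delta> in at_right (0::real). \<delta> \<in> {0<..<1}"
      by (rule eventually_at_right_real) simp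
    then show "\<forall>\<^sub>F \<delta> in at_right 0. a < packing_premeasure \<delta> \<alpha> E"
      by (rule eventually_mono) (rule less_le_trans[OF a INF_lower])
  qed
qed simp

definition lower_dim :: "('x::metric_space set \<Rightarrow> ereal) \<Rightarrow> 'x measure \<Rightarrow> ereal" where
  "lower_dim D \<mu> = Inf {D E | E. E \<in> sets borel \<and> emeasure \<mu> E > 0}"

definition upper_dim :: "('x::metric_space set \<Rightarrow> ereal) \<Rightarrow> 'x measure \<Rightarrow> ereal" where
  "upper_dim D \<mu> = Inf {D E | E. E \<in> sets borel \<and> emeasure \<mu> (- E) = 0}"

definition has_dim :: "('x::metric_space set \<Rightarrow> ereal) \<Rightarrow> 'x measure \<Rightarrow> ereal \<Rightarrow> bool" where
  "has_dim D \<mu> c \<longleftrightarrow> lower_dim D \<mu> = c \<and> upper_dim D \<mu> = c"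


section \<open>Recurrence rates\<close>

definition return_time :: "('x::metric_space \<Rightarrow> 'x) \<Rightarrow> real \<Rightarrow> 'x \<Rightarrow> 'x \<Rightarrow> enat" where
  "return_time T r x y = Inf {enat n | n. n \<ge> 1 \<and> (T ^^ n) x \<in> cball y r}"

fun log_enat :: "enat \<Rightarrow> ereal" where
  "log_enat (enat n) = ereal (ln (real n))"
| "log_enat \<infinity> = \<infinity>"

definition lower_rec :: "('x::metric_space \<Rightarrow> 'x) \<Rightarrow> 'x \<Rightarrow> 'x \<Rightarrow> ereal" where
  "lower_rec T x y =
     Liminf (at_right 0) (\<lambda>r. log_enat (return_time T r x y) / ereal (- ln r))"

definition upper_rec :: "('x::metric_space \<Rightarrow> 'x) \<Rightarrow> 'x \<Rightarrow> 'x \<Rightarrow> ereal" where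
  "upper_rec T x y =
     Limsup (at_right 0) (\<lambda>r. log_enat (return_time T r x y) / ereal (- ln r))"

end

theory Submission
  imports Defs
begin

text \<open>
  The weak topology is determined by finitely many bounded Lipschitz functions at a time, which see
  only finitely many coordinates up to a small error.  Given an invariant measure, choose points whose
  empirical measure mimics it, and concatenate long blocks of their coordinates to one periodic word:
  the orbit measures of periodic points are dense.  These measures are ergodic, have dimension 0 and
  have bounded return times.  Replacing each letter of the word by an independent choice from a
  diffuse measure on a Cantor set near it (here perfectness and completeness of \<open>M\<close> are used)
  gives another dense set of invariant measures: the mass of a ball of radius \<open>r\<close>, as well as the
  probability of an \<open>r\<close>-close return at a given time, decays faster than every power of \<open>r\<close>, because
  about \<open>log (1 / r)\<close> coordinates have to be matched, each with arbitrarily small probability.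

  On the other side, by the Lindelof property \<open>{\<mu>. AE x in \<mu>. Q x \<mu>}\<close> is a \<open>G\<delta>\<close> set as soon as \<open>Q\<close> is
  jointly open, and each property is a countable conjunction of such conditions.  For the packing
  dimension, infinite dimension of \<open>\<mu>\<close> is equivalent to
  \<open>\<mu> (cball x (1 / 2 ^ j)) < 1 / 2 ^ (j * a)\<close> for infinitely many \<open>j\<close>, for every \<open>a\<close> and almost every \<open>x\<close>.
\<close>

section \<open>Topology of the sequence space\<close>

text \<open>An invariant measure need not be ergodic, so a single orbit need not represent it. The
  periodic approximation therefore samples finitely many points by a second-moment argument in place
  of an ergodic theorem, and gives each of them an orbit segment of length \<open>n\<close>.
  Invariance gives segment averages the right mean, and only the \<open>2 * k\<close> positions near
  the ends of a segment are spoilt. Dimensions and recurrence rates involve limits over all radii,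
  closed balls and arbitrary Borel sets, none of which is visibly open in the measure. Each is
  reduced to strict inequalities of the favourable sign at one radius: closed balls of mass below a
  bound, finite open unions of mass above a bound. For pairs, Fubini turns the condition into one on
  sections, which avoids the map from \<mu> to its square. The random words have to defeat two
  things at once: the \<open>2 ^ (j * a)\<close> times at which a return could occur, and return
  times so short that the windows of \<open>x\<close> and of its shift overlap. The first asks for
  the rate \<open>1 / 2 ^ q\<close> with every \<open>q\<close>, the second for bounds that reveal
  one coordinate after another.\<close>

lemma biseq_coord_dist_le:
  fixes x y :: "'a::metric_space biseq"
  shows "1 / 2 ^ nat \<bar>n\<bar> * (dist (coord x n) (coord y n) / (1 + dist (coord x n) (coord y n))) \<le> dist x y"
proof -
  let ?f = "\<lambda>n::int. 1 / 2 ^ nat \<bar>n\<bar> * (dist (coord x n) (coord y n) / (1 + dist (coord x n) (coord y n)))"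
  have "sum ?f {n} \<le> infsum ?f UNIV"
    by (rule finite_sum_le_infsum[OF biseq_dist_summable]) auto
  then show ?thesis by (simp add: dist_biseq_def)
qed

text \<open>Since t / (1 + t) is strictly increasing, the bound on one weighted term can be
  inverted. The weight costs one binary digit per step away from 0; this is where the number of
  controlled coordinates in the decay estimates comes from.\<close>

lemma biseq_coord_dist_le_of_dist_le:
  fixes x y :: "'a::metric_space biseq"
  assumes "s > 0" "dist x y \<le> s / (1 + s) / 2 ^ nat \<bar>n\<bar>"
  shows "dist (coord x n) (coord y n) \<le> s"
proof (rule ccontr)
  let ?d = "dist (coord x n) (coord y n)"
  assume "\<not> ?d \<le> s"
  then have "s * (1 + ?d) < ?d * (1 + s)" by (simp add: algebra_simps)
  then have "s / (1 + s) < ?d / (1 + ?d)"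
    using assms(1) by (simp add: field_simps add_pos_nonneg)
  then have "s / (1 + s) / 2 ^ nat \<bar>n\<bar> < ?d / (1 + ?d) / 2 ^ nat \<bar>n\<bar>"
    by (intro divide_strict_right_mono) auto
  also have "\<dots> = 1 / 2 ^ nat \<bar>n\<bar> * (?d / (1 + ?d))" by simp
  also have "\<dots> \<le> dist x y" by (rule biseq_coord_dist_le)
  finally show False using assms(2) by linarith
qed

text \<open>The fraction t / (1 + t) is at most t, which is used inside the window, and at most 1,
  which is used outside, where the remaining weights sum to at most \<open>e\<close>.\<close>

lemma biseq_dist_le_window:
  assumes "e > 0"
  shows "\<exists>k::nat. \<forall>x y :: 'a::metric_space biseq.
    dist x y \<le> (\<Sum>n\<in>{-int k..int k}. dist (coord x n) (coord y n)) + e"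
proof -
  let ?w = "\<lambda>n::int. 1 / 2 ^ nat \<bar>n\<bar> :: real"
  have "(?w has_sum infsum ?w UNIV) UNIV" using biseq_weight_summable by simp
  then obtain F where F: "finite F" "dist (sum ?w F) (infsum ?w UNIV) < e"
    using assms unfolding has_sum_def tendsto_iff eventually_finite_subsets_at_top by blast
  \<comment> \<open>The 0 inserted into \<open>F\<close> keeps the maximum defined when
    \<open>F\<close> is empty.\<close>
  define k where "k = nat (Max ((\<lambda>n. \<bar>n\<bar>) ` insert 0 F))"
  let ?I = "{-int k..int k}"
  have F_sub: "F \<subseteq> ?I"
  proof
    fix n assume "n \<in> F"
    then have "\<bar>n\<bar> \<le> Max ((\<lambda>n. \<bar>n\<bar>) ` insert 0 F)" using F(1) by (intro Max_ge) auto
    then show "n \<in> ?I" by (auto simp: k_def)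
  qed
  have split: "infsum f UNIV = sum f ?I + infsum f (-?I)" if "f summable_on UNIV" for f :: "int \<Rightarrow> real"
  proof -
    have "infsum f (?I \<union> -?I) = infsum f ?I + infsum f (-?I)"
      by (rule infsum_Un_disjoint) (use that in \<open>auto intro: summable_on_subset\<close>)
    moreover have "?I \<union> -?I = UNIV" by blast
    ultimately show ?thesis by simp
  qed
  have "sum ?w F \<le> sum ?w ?I" by (rule sum_mono2) (use F_sub in auto)
  then have tail: "infsum ?w (-?I) \<le> e"
    using F(2) split[OF biseq_weight_summable] by (simp add: dist_real_def abs_less_iff)
  show ?thesis
  proof (intro exI allI)
    fix x y :: "'a biseq"
    let ?f = "\<lambda>n::int. 1 / 2 ^ nat \<bar>n\<bar> * (dist (coord x n) (coord y n) / (1 + dist (coord x n) (coord y n)))"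
    have "infsum ?f (-?I) \<le> infsum ?w (-?I)"
    proof (rule infsum_mono)
      fix n :: int
      have "dist (coord x n) (coord y n) / (1 + dist (coord x n) (coord y n)) \<le> 1"
        by (simp add: divide_le_eq add_pos_nonneg)
      then show "?f n \<le> ?w n" by (simp add: divide_simps)
    qed (rule summable_on_subset[OF biseq_dist_summable] summable_on_subset[OF biseq_weight_summable], simp)+
    moreover have "sum ?f ?I \<le> (\<Sum>n\<in>?I. dist (coord x n) (coord y n))"
    proof (rule sum_mono)
      fix n :: int
      let ?d = "dist (coord x n) (coord y n)"
      have "?d / (1 + ?d) \<le> ?d"
        by (simp add: divide_le_eq add_pos_nonneg mult_left_le algebra_simps)
      moreover have "1 / 2 ^ nat \<bar>n\<bar> \<le> (1::real)" by simp
      ultimately have "1 / 2 ^ nat \<bar>n\<bar> * (?d / (1 + ?d)) \<le> 1 * ?d"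
        by (intro mult_mono) auto
      then show "?f n \<le> ?d" by simp
    qed
    ultimately show "dist x y \<le> (\<Sum>n\<in>?I. dist (coord x n) (coord y n)) + e"
      using tail split[OF biseq_dist_summable[of x y]] by (simp add: dist_biseq_def)
  qed
qed

lemma biseq_dist_uniform:
  assumes "e > 0"
  shows "\<exists>k::nat. \<exists>d>0. \<forall>x y :: 'a::metric_space biseq.
    (\<forall>n\<in>{-int k..int k}. dist (coord x n) (coord y n) \<le> d) \<longrightarrow> dist x y < e"
proof -
  obtain k :: nat where k: "\<And>x y :: 'a biseq.
      dist x y \<le> (\<Sum>n\<in>{-int k..int k}. dist (coord x n) (coord y n)) + e / 2"
    using biseq_dist_le_window[of "e/2"] assms by auto
  \<comment> \<open>The window has 2 k + 1 coordinates, so together they contribute at most e / 4,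
    next to e / 2 from the tail.\<close>
  define d where "d = e / (4 * (2 * real k + 1))"
  have card: "real (card {-int k..int k}) = 2 * real k + 1" by simp
  have "dist x y < e" if "\<forall>n\<in>{-int k..int k}. dist (coord x n) (coord y n) \<le> d" for x y :: "'a biseq"
  proof -
    have "(\<Sum>n\<in>{-int k..int k}. dist (coord x n) (coord y n)) \<le> real (card {-int k..int k}) * d"
      by (rule sum_bounded_above) (use that in auto)
    also have "\<dots> = e / 4" unfolding card d_def by (simp add: field_simps)
    finally show ?thesis using k[of x y] assms by linarith
  qed
  moreover have "d > 0" using assms by (simp add: d_def)
  ultimately show ?thesis by blast
qed

section \<open>Coordinatewise convergence and continuity\<close>

lemma continuous_on_coord: "continuous_on UNIV (\<lambda>x :: 'a::metric_space biseq. coord x n)"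
  unfolding continuous_on_iff
proof (intro ballI allI impI)
  fix x :: "'a biseq" and e :: real assume "e > 0"
  have "dist (coord x' n) (coord x n) < e" if "dist x' x < e / 2 / (1 + e / 2) / 2 ^ nat \<bar>n\<bar>" for x' :: "'a biseq"
    using biseq_coord_dist_le_of_dist_le[of "e/2" x' x n] that \<open>e > 0\<close> by simp
  then show "\<exists>d>0. \<forall>x'\<in>UNIV. dist x' x < d \<longrightarrow> dist (coord x' n) (coord x n) < e"
    using \<open>e > 0\<close> by (intro exI[of _ "e / 2 / (1 + e / 2) / 2 ^ nat \<bar>n\<bar>"]) (simp add: add_pos_pos)
qed

lemma tendsto_biseqI:
  fixes X :: "'b \<Rightarrow> 'a::metric_space biseq"
  assumes "\<And>n. ((\<lambda>i. coord (X i) n) \<longlongrightarrow> coord x n) F"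
  shows "(X \<longlongrightarrow> x) F"
  unfolding tendsto_iff
proof (intro allI impI)
  fix e :: real assume "e > 0"
  then obtain k d where kd: "d > 0" "\<And>x y :: 'a biseq.
      (\<forall>n\<in>{-int k..int k}. dist (coord x n) (coord y n) \<le> d) \<Longrightarrow> dist x y < e"
    using biseq_dist_uniform by blast
  have "\<forall>\<^sub>F i in F. \<forall>n\<in>{-int k..int k}. dist (coord (X i) n) (coord x n) < d"
    using assms kd(1) by (intro eventually_ball_finite) (auto simp: tendsto_iff)
  then show "\<forall>\<^sub>F i in F. dist (X i) x < e"
    by (rule eventually_mono) (rule kd(2), auto intro: less_imp_le)
qed

lemma continuous_on_biseqI:
  fixes f :: "'b::topological_space \<Rightarrow> 'a::metric_space biseq"
  assumes "\<And>n. continuous_on A (\<lambda>x. coord (f x) n)"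
  shows "continuous_on A f"
  using assms unfolding continuous_on_def by (auto intro: tendsto_biseqI)

lemma continuous_on_Biseq: "continuous_on UNIV (Biseq :: (int \<Rightarrow> 'a::metric_space) \<Rightarrow> 'a biseq)"
  by (rule continuous_on_biseqI) (auto simp: Biseq_inverse)

lemma continuous_on_coord_fun: "continuous_on UNIV (coord :: 'a::metric_space biseq \<Rightarrow> _)"
  by (rule continuous_on_coordinatewise_then_product[OF continuous_on_coord])

lemma continuous_on_full_shift: "continuous_on UNIV (full_shift :: 'a::metric_space biseq \<Rightarrow> _)"
  by (rule continuous_on_biseqI) (auto simp: Biseq_inverse full_shift_def continuous_on_coord)

lemma coord_full_shift_funpow: "coord ((full_shift ^^ n) x) i = coord x (i - int n)"
  by (induction n arbitrary: i) (auto simp: full_shift_def Biseq_inverse algebra_simps)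

section \<open>Polish structure, carried over from the countable product\<close>

instance biseq :: ("{metric_space, second_countable_topology}") second_countable_topology
proof
  obtain B :: "(int \<Rightarrow> 'a) set set" where B: "countable B" "topological_basis B"
    using ex_countable_basis by blast
  have "topological_basis ((\<lambda>U. coord -` U) ` B)"
  proof (rule topological_basisI)
    fix O' assume "O' \<in> (\<lambda>U. coord -` U) ` B"
    then obtain U where "O' = coord -` U" "open U" using B(2) topological_basis_open by blast
    then show "open O'" using continuous_on_coord_fun by (auto intro: open_vimage)
  next
    fix O' :: "'a biseq set" and x assume "open O'" "x \<in> O'"
    then have "open (Biseq -` O')" "coord x \<in> Biseq -` O'"
      using continuous_on_Biseq by (auto intro: open_vimage simp: coord_inverse)
    then obtain U where "U \<in> B" "coord x \<in> U" "U \<subseteq> Biseq -` O'"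
      using topological_basisE[OF B(2)] by metis
    then show "\<exists>B'\<in>(\<lambda>U. coord -` U) ` B. x \<in> B' \<and> B' \<subseteq> O'"
      by (intro bexI[of _ "coord -` U"]) (auto simp: subset_eq, metis coord_inverse)
  qed
  then have "topological_basis ((\<lambda>U. coord -` U) ` B)" "countable ((\<lambda>U. coord -` U) ` B)"
    using B(1) by auto
  then show "\<exists>B::'a biseq set set. countable B \<and> open = generate_topology B"
    using topological_basis_imp_subbasis by blast
qed

instance biseq :: (complete_space) complete_space
proof
  fix X :: "nat \<Rightarrow> 'a biseq" assume X: "Cauchy X"
  have "Cauchy (\<lambda>i. coord (X i) n)" for n
    unfolding Cauchy_def
  proof (intro allI impI)
    fix e :: real assume "e > 0"
    then have "e / 2 / (1 + e / 2) / 2 ^ nat \<bar>n\<bar> > 0" by (simp add: add_pos_pos)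
    then obtain M where M: "\<And>i j. i \<ge> M \<Longrightarrow> j \<ge> M \<Longrightarrow> dist (X i) (X j) < e / 2 / (1 + e / 2) / 2 ^ nat \<bar>n\<bar>"
      using X unfolding Cauchy_def by blast
    have "dist (coord (X i) n) (coord (X j) n) < e" if "i \<ge> M" "j \<ge> M" for i j
      using biseq_coord_dist_le_of_dist_le[of "e/2" "X i" "X j" n] M[OF that] \<open>e > 0\<close> by simp
    then show "\<exists>M. \<forall>m\<ge>M. \<forall>k\<ge>M. dist (coord (X m) n) (coord (X k) n) < e" by blast
  qed
  then have "\<exists>l. (\<lambda>i. coord (X i) n) \<longlonglongrightarrow> l" for n
    using convergent_eq_Cauchy by blast
  then obtain l where "\<And>n. (\<lambda>i. coord (X i) n) \<longlonglongrightarrow> l n" by metis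
  then have "X \<longlonglongrightarrow> Biseq l" by (intro tendsto_biseqI) (simp add: Biseq_inverse)
  then show "convergent X" by (auto simp: convergent_def)
qed

instance biseq :: (polish_space) polish_space ..

lemma measurable_Biseq:
  "Biseq \<in> PiM UNIV (\<lambda>_::int. borel :: 'a::polish_space measure) \<rightarrow>\<^sub>M borel"
proof -
  \<comment> \<open>Continuity yields measurability for the Borel sets of the product topology; over
    a countable index set and a second countable space these are the sets of the product
    \<sigma>-algebra.\<close>
  have "Biseq \<in> borel_measurable (borel :: (int \<Rightarrow> 'a) measure)"
    by (rule borel_measurable_continuous_onI[OF continuous_on_Biseq])
  then show ?thesis
    using sets_PiM_equal_borel measurable_cong_sets by blast
qed

lemma measurable_full_shift [measurable]:
  "full_shift \<in> borel \<rightarrow>\<^sub>M (borel :: 'a::polish_space biseq measure)"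
  by (rule borel_measurable_continuous_onI[OF continuous_on_full_shift])

section \<open>The weak topology\<close>

text \<open>\<open>UNIV\<close> is treated apart because \<open>infdist\<close> to the empty set is
  0, which would turn the bump function of the whole space into 0.\<close>

definition inner_bump :: "'x::metric_space set \<Rightarrow> nat \<Rightarrow> 'x \<Rightarrow> real" where
  "inner_bump U n x = (if U = UNIV then 1 else min 1 (real n * infdist x (- U)))"

lemma inner_bump_bounds: "0 \<le> inner_bump U n x" "inner_bump U n x \<le> 1" "inner_bump U n x \<le> indicator U x"
  by (auto simp: inner_bump_def infdist_nonneg indicator_def)

lemma continuous_on_inner_bump: "continuous_on UNIV (inner_bump U n)"
proof (cases "U = UNIV")
  case True
  then have "inner_bump U n = (\<lambda>_. 1)" unfolding inner_bump_def by simp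
  then show ?thesis by simp
next
  case False
  then have "inner_bump U n = (\<lambda>x. min 1 (real n * infdist x (- U)))" unfolding inner_bump_def by simp
  then show ?thesis by (auto intro!: continuous_intros)
qed

lemma bounded_inner_bump: "bounded (range (inner_bump U n))"
  by (intro boundedI[of _ 1]) (auto simp: inner_bump_bounds)

lemma inner_bump_tendsto:
  assumes "open U"
  shows "(\<lambda>n. inner_bump U n x) \<longlonglongrightarrow> indicator U x"
proof (cases "U = UNIV \<or> x \<notin> U")
  case True
  then have "inner_bump U n x = indicator U x" for n
    using infdist_zero[of x "-U"] by (auto simp: inner_bump_def)
  then show ?thesis by simp
next
  case False
  then have pos: "infdist x (- U) > 0"
    using assms by (intro infdist_pos_not_in_closed) auto
  then obtain N :: nat where N: "1 < real N * infdist x (- U)" using reals_Archimedean3 by blast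
  have "inner_bump U n x = 1" if "n \<ge> N" for n
  proof -
    have "real N * infdist x (- U) \<le> real n * infdist x (- U)" using that pos by (intro mult_right_mono) auto
    then show ?thesis using N False by (simp add: inner_bump_def)
  qed
  then have "\<forall>\<^sub>F n in sequentially. inner_bump U n x = indicator U x"
    using False by (auto simp: eventually_sequentially)
  then show ?thesis by (rule tendsto_eventually)
qed

lemma integrable_bounded_borel:
  fixes f :: "'x::topological_space \<Rightarrow> real"
  assumes "prob_space \<mu>" "sets \<mu> = sets borel" "f \<in> borel_measurable borel" "bounded (range f)"
  shows "integrable \<mu> f"
proof -
  interpret prob_space \<mu> by fact
  obtain B where "\<And>x. \<bar>f x\<bar> \<le> B" using assms(4) unfolding bounded_iff by auto
  moreover have "f \<in> borel_measurable \<mu>" using assms(2,3) measurable_cong_sets by blast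
  ultimately show ?thesis by (intro integrable_const_bound[of _ B]) auto
qed

lemma integrable_bounded_continuous:
  fixes f :: "'x::topological_space \<Rightarrow> real"
  assumes "prob_space \<mu>" "sets \<mu> = sets borel" "continuous_on UNIV f" "bounded (range f)"
  shows "integrable \<mu> f"
  using assms by (intro integrable_bounded_borel borel_measurable_continuous_onI)

lemma integral_inner_bump_tendsto:
  assumes "prob_space \<mu>" "sets \<mu> = sets borel" "open U"
  shows "(\<lambda>n. \<integral>x. inner_bump U n x \<partial>\<mu>) \<longlonglongrightarrow> measure \<mu> U"
proof -
  interpret prob_space \<mu> by fact
  have "(\<lambda>n. \<integral>x. inner_bump U n x \<partial>\<mu>) \<longlonglongrightarrow> (\<integral>x. indicator U x \<partial>\<mu>)"
  proof (rule integral_dominated_convergence[where w="\<lambda>_. 1"])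
    show "(\<lambda>x. indicator U x :: real) \<in> borel_measurable \<mu>"
      using assms by (intro borel_measurable_indicator) simp
    show "inner_bump U n \<in> borel_measurable \<mu>" for n
      using borel_measurable_continuous_onI[OF continuous_on_inner_bump] assms(2) measurable_cong_sets by blast
  qed (auto intro!: AE_I2 inner_bump_tendsto assms simp: inner_bump_bounds)
  then show ?thesis using assms(2) sets_eq_imp_space_eq[OF assms(2)] by simp
qed

section \<open>Bounded Lipschitz test functions\<close>

definition bounded_lipschitz :: "('x::metric_space \<Rightarrow> real) \<Rightarrow> bool" where
  "bounded_lipschitz f \<longleftrightarrow> bounded (range f) \<and> (\<exists>L. L-lipschitz_on UNIV f)"

text \<open>The infimal convolution of \<open>f\<close> with k times the distance is k-Lipschitz,
  lies below \<open>f\<close>, and tends to \<open>f\<close> pointwise as k grows; dominated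
  convergence does the rest. The matching bound from above comes from applying this to -f.\<close>

lemma bounded_lipschitz_minorant:
  fixes f :: "'x::metric_space \<Rightarrow> real"
  assumes \<mu>: "prob_space \<mu>" "sets \<mu> = sets borel" and f: "continuous_on UNIV f" "bounded (range f)" and "e > 0"
  shows "\<exists>g. bounded_lipschitz g \<and> (\<forall>x. g x \<le> f x) \<and> (\<integral>x. f x \<partial>\<mu>) - e < (\<integral>x. g x \<partial>\<mu>)"
proof -
  interpret prob_space \<mu> by fact
  obtain B where B: "\<And>x. \<bar>f x\<bar> \<le> B" using f(2) unfolding bounded_iff by auto
  define g where "g k x = (INF y. f y + real k * dist x y)" for k x
  have low: "- B \<le> f y + real k * dist x y" for k x y
    using B[of y] mult_nonneg_nonneg[of "real k" "dist x y"] unfolding abs_le_iff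
    by (smt (verit) of_nat_0_le_iff zero_le_dist)
  have bdd: "bdd_below (range (\<lambda>y. f y + real k * dist x y))" for k x
    using low by (intro bdd_belowI[of _ "-B"]) auto
  have g_le: "g k x \<le> f y + real k * dist x y" for k x y
    unfolding g_def by (rule cINF_lower[OF bdd]) simp
  have g_ge: "c \<le> g k x" if "\<And>y. c \<le> f y + real k * dist x y" for c k x
    unfolding g_def using that by (intro cINF_greatest) auto
  have g_le_f: "g k x \<le> f x" for k x using g_le[of k x x] by simp
  have g_abs: "\<bar>g k x\<bar> \<le> B" for k x
  proof -
    have "- B \<le> g k x" using g_ge low by blast
    moreover have "g k x \<le> B" using g_le_f[of k x] B[of x] by simp
    ultimately show ?thesis by simp
  qed
  have g_lip1: "g k x - g k x' \<le> real k * dist x x'" for k x x'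
  proof -
    have "g k x - real k * dist x x' \<le> g k x'"
    proof (rule g_ge)
      fix y
      have "real k * dist x y \<le> real k * (dist x x' + dist x' y)"
        by (intro mult_left_mono dist_triangle) auto
      then show "g k x - real k * dist x x' \<le> f y + real k * dist x' y"
        using g_le[of k x y] by (simp add: algebra_simps)
    qed
    then show ?thesis by simp
  qed
  have g_lip: "(real k)-lipschitz_on UNIV (g k)" for k
  proof (rule lipschitz_onI)
    show "dist (g k x) (g k y) \<le> real k * dist x y" for x y
      using g_lip1[of k x y] g_lip1[of k y x] by (simp add: dist_real_def abs_le_iff dist_commute)
  qed simp
  have lim: "(\<lambda>k. g k x) \<longlonglongrightarrow> f x" for x
    unfolding LIMSEQ_def
  proof (intro allI impI)
    fix r :: real assume "r > 0"
    then obtain d where d: "d > 0" "\<And>y. dist y x < d \<Longrightarrow> dist (f y) (f x) < r / 2"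
      using f(1) unfolding continuous_on_iff by (metis UNIV_I half_gt_zero)
    \<comment> \<open>At distance at least \<open>d\<close> the penalty exceeds 2 B, the largest
      possible oscillation of \<open>f\<close>; closer points are handled by continuity at
      \<open>x\<close>.\<close>
    obtain N :: nat where N: "2 * B < real N * d" using reals_Archimedean3[OF d(1)] by blast
    have "dist (g k x) (f x) < r" if "k \<ge> N" for k
    proof -
      have "f x - r / 2 \<le> g k x"
      proof (rule g_ge)
        fix y
        show "f x - r / 2 \<le> f y + real k * dist x y"
        proof (cases "dist x y < d")
          case True
          then have "f x - r / 2 \<le> f y"
            using d(2)[of y] unfolding dist_commute[of y] dist_real_def by linarith
          then show ?thesis by (simp add: add_increasing2)
        next
          case False
          have "real N * d \<le> real k * dist x y" using that False d(1) by (intro mult_mono) auto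
          then show ?thesis using N B[of y] B[of x] \<open>r > 0\<close> unfolding abs_le_iff by linarith
        qed
      qed
      then show ?thesis using g_le_f[of k x] \<open>r > 0\<close> by (simp add: dist_real_def abs_less_iff)
    qed
    then show "\<exists>no. \<forall>n\<ge>no. dist (g n x) (f x) < r" by blast
  qed
  have meas: "h \<in> borel_measurable \<mu>" if "continuous_on UNIV h" for h :: "'x \<Rightarrow> real"
    using borel_measurable_continuous_onI[OF that] \<mu>(2) measurable_cong_sets by blast
  have "(\<lambda>k. \<integral>x. g k x \<partial>\<mu>) \<longlonglongrightarrow> (\<integral>x. f x \<partial>\<mu>)"
    by (rule integral_dominated_convergence[where w="\<lambda>_. B"])
      (use lim g_abs meas f lipschitz_on_continuous_on[OF g_lip] in auto)
  then have "\<forall>\<^sub>F k in sequentially. (\<integral>x. f x \<partial>\<mu>) - e < (\<integral>x. g k x \<partial>\<mu>)"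
    using \<open>e > 0\<close> by (intro order_tendstoD) auto
  then obtain k where "(\<integral>x. f x \<partial>\<mu>) - e < (\<integral>x. g k x \<partial>\<mu>)"
    unfolding eventually_sequentially by blast
  moreover have "bounded_lipschitz (g k)"
    unfolding bounded_lipschitz_def using g_lip g_abs by (auto intro!: boundedI[of _ B])
  ultimately show ?thesis using g_le_f by blast
qed

lemma bounded_lipschitz_continuous: "bounded_lipschitz f \<Longrightarrow> continuous_on UNIV f"
  unfolding bounded_lipschitz_def using lipschitz_on_continuous_on by blast

lemma openin_weak_integral:
  fixes f :: "'x::topological_space \<Rightarrow> real"
  assumes "continuous_on UNIV f" "bounded (range f)" "open V"
  shows "openin (weak_topology S) {\<mu> \<in> S. (\<integral>x. f x \<partial>\<mu>) \<in> V}"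
  unfolding weak_topology_def by (rule topology_generated_by_Basis) (use assms in blast)

section \<open>G_delta sets, residual sets and approximation by finite unions\<close>

lemma gdelta_in_INT_nat:
  assumes "\<And>n::nat. gdelta_in X (A n)"
  shows "gdelta_in X (\<Inter>n. A n)"
  by (rule gdelta_in_Inter) (use assms in auto)

text \<open>A single dense set \<open>D\<close> inside every \<open>G i\<close> makes all of them
  dense at once. For ergodicity \<open>D\<close> consists of the periodic orbit measures.\<close>

lemma residual_inI:
  assumes "dense_in X D" "countable I" "\<And>i. i \<in> I \<Longrightarrow> openin X (G i)" "\<And>i. i \<in> I \<Longrightarrow> D \<subseteq> G i"
    and "topspace X \<inter> (\<Inter>i\<in>I. G i) \<subseteq> A" "A \<subseteq> topspace X"
  shows "residual_in X A"
  unfolding residual_in_def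
proof (intro conjI exI[of _ "G ` I"] ballI)
  fix U assume "U \<in> G ` I"
  then obtain i where i: "U = G i" "i \<in> I" by auto
  then show "openin X U" using assms by simp
  have "X closure_of D \<subseteq> X closure_of U" using i assms by (intro closure_of_mono) auto
  then show "dense_in X U"
    using assms(1) openin_subset[OF \<open>openin X U\<close>] closure_of_subset_topspace[of X U]
    unfolding dense_in_def by auto
qed (use assms in auto)

lemma dense_gdelta_imp_residual:
  assumes "dense_gdelta_in X A"
  shows "residual_in X A"
proof -
  have "dense_in X A" "gdelta_in X A" using assms by (auto simp: dense_gdelta_in_def)
  then obtain \<U> where "countable \<U>" "\<U> \<subseteq> Collect (openin X)" "A = topspace X \<inter> \<Inter>\<U>"
    unfolding gdelta_in_def relative_to_def intersection_of_def by auto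
  then show ?thesis
    using residual_inI[OF \<open>dense_in X A\<close>, of \<U> "\<lambda>U. U" A] by auto
qed

lemma eq_1_iff_gt:
  assumes "(t::real) \<le> 1"
  shows "t = 1 \<longleftrightarrow> (\<forall>n. t > 1 - 1 / real (Suc n))"
proof
  assume *: "\<forall>n. t > 1 - 1 / real (Suc n)"
  show "t = 1"
  proof (rule ccontr)
    assume "t \<noteq> 1"
    then obtain n where "inverse (real (Suc n)) < 1 - t"
      using reals_Archimedean[of "1 - t"] assms by auto
    then show False using *[rule_format, of n] by (simp add: inverse_eq_divide)
  qed
qed simp

lemma measure_finite_Union_gt:
  fixes \<mu> :: "'x::topological_space measure"
  assumes "prob_space \<mu>" and \<mu>: "sets \<mu> = sets borel"
    and \<G>: "countable \<G>" "\<And>U. U \<in> \<G> \<Longrightarrow> open U" and gt: "a < measure \<mu> (\<Union>\<G>)"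
  shows "\<exists>\<H>. finite \<H> \<and> \<H> \<subseteq> \<G> \<and> a < measure \<mu> (\<Union>\<H>)"
proof (cases "\<G> = {}")
  case True
  then show ?thesis using gt by (intro exI[of _ "{}"]) auto
next
  case False
  interpret prob_space \<mu> by fact
  define A where "A n = (\<Union>i\<le>n. from_nat_into \<G> i)" for n :: nat
  have in_G: "from_nat_into \<G> i \<in> \<G>" for i using False by (rule from_nat_into)
  have "open (A n)" for n unfolding A_def using in_G \<G>(2) by (intro open_UN) blast
  then have "range A \<subseteq> sets \<mu>" by (intro image_subsetI) (simp add: \<mu>)
  moreover have "incseq A" unfolding A_def incseq_def by (intro allI impI UN_mono) auto
  ultimately have "(\<lambda>n. measure \<mu> (A n)) \<longlonglongrightarrow> measure \<mu> (\<Union>n. A n)"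
    by (rule finite_Lim_measure_incseq)
  also have "(\<Union>n. A n) = \<Union>(range (from_nat_into \<G>))" unfolding A_def by blast
  also have "\<dots> = \<Union>\<G>" using range_from_nat_into[OF False \<G>(1)] by simp
  finally have "\<forall>\<^sub>F n in sequentially. a < measure \<mu> (A n)" using gt by (rule order_tendstoD)
  then obtain n where "a < measure \<mu> (A n)" unfolding eventually_sequentially by blast
  then show ?thesis using in_G by (intro exI[of _ "from_nat_into \<G> ` {..n}"]) (auto simp: A_def)
qed

section \<open>Open and G_delta sets in a family of Borel probability measures\<close>

locale borel_prob_family =
  fixes S :: "'x::{metric_space, second_countable_topology} measure set"
  assumes prob: "\<mu> \<in> S \<Longrightarrow> prob_space \<mu>" and sets_borel: "\<mu> \<in> S \<Longrightarrow> sets \<mu> = sets borel"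
begin

abbreviation W where "W \<equiv> weak_topology S"

lemma space_UNIV: "\<mu> \<in> S \<Longrightarrow> space \<mu> = UNIV"
  using sets_eq_imp_space_eq[OF sets_borel] by simp

text \<open>The mass of an open set is the supremum of the integrals of its bump functions, hence
  lower semicontinuous in \<mu>: the set is a union of subbasic ones.\<close>

lemma openin_measure_gt:
  assumes "open U"
  shows "openin W {\<mu> \<in> S. measure \<mu> U > a}"
proof -
  have eq: "{\<mu> \<in> S. measure \<mu> U > a} = (\<Union>n. {\<mu> \<in> S. (\<integral>x. inner_bump U n x \<partial>\<mu>) \<in> {a<..}})"
  proof (intro set_eqI iffI)
    fix \<mu> assume "\<mu> \<in> {\<mu> \<in> S. measure \<mu> U > a}"
    then have \<mu>: "\<mu> \<in> S" "measure \<mu> U > a" by auto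
    then have "\<forall>\<^sub>F n in sequentially. (\<integral>x. inner_bump U n x \<partial>\<mu>) > a"
      by (intro order_tendstoD[OF integral_inner_bump_tendsto] prob sets_borel assms)
    then show "\<mu> \<in> (\<Union>n. {\<mu> \<in> S. (\<integral>x. inner_bump U n x \<partial>\<mu>) \<in> {a<..}})"
      using \<mu> unfolding eventually_sequentially by auto
  next
    fix \<mu> assume "\<mu> \<in> (\<Union>n. {\<mu> \<in> S. (\<integral>x. inner_bump U n x \<partial>\<mu>) \<in> {a<..}})"
    then obtain n where \<mu>: "\<mu> \<in> S" "a < (\<integral>x. inner_bump U n x \<partial>\<mu>)" by auto
    interpret prob_space \<mu> using \<mu> prob by blast
    have "(\<integral>x. inner_bump U n x \<partial>\<mu>) \<le> (\<integral>x. indicator U x \<partial>\<mu>)"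
    proof (rule integral_mono)
      show "integrable \<mu> (inner_bump U n)"
        using \<mu> by (intro integrable_bounded_continuous continuous_on_inner_bump bounded_inner_bump prob sets_borel)
      show "integrable \<mu> (\<lambda>x. indicator U x :: real)"
        using \<mu> assms sets_borel by (intro integrable_real_indicator) (auto simp: emeasure_eq_measure)
    qed (rule inner_bump_bounds)
    also have "\<dots> = measure \<mu> U" using space_UNIV[OF \<mu>(1)] by simp
    finally show "\<mu> \<in> {\<mu> \<in> S. measure \<mu> U > a}" using \<mu> by simp
  qed
  show ?thesis
    unfolding eq
    by (intro openin_Union)
      (auto intro!: openin_weak_integral[of _ "{a<..}", simplified] continuous_on_inner_bump bounded_inner_bump)
qed

lemma openin_measure_lt:
  assumes "closed C"
  shows "openin W {\<mu> \<in> S. measure \<mu> C < a}"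
proof -
  have "measure \<mu> C = 1 - measure \<mu> (- C)" if "\<mu> \<in> S" for \<mu>
    using prob_space.prob_compl[OF prob[OF that], of C] assms that
    by (simp add: sets_borel space_UNIV Compl_eq_Diff_UNIV)
  then have "{\<mu> \<in> S. measure \<mu> C < a} = {\<mu> \<in> S. measure \<mu> (- C) > 1 - a}" by auto
  then show ?thesis using openin_measure_gt[of "-C"] assms by auto
qed

text \<open>Joint openness of \<open>Q\<close> is expressed by rectangles, because points carry the
  topology of their type and measures the explicit topology \<open>W\<close>. The section may vary
  with the measure, as it does for conditions on the mass of a ball about the point.\<close>

context
  fixes Q :: "'x \<Rightarrow> 'x measure \<Rightarrow> bool"
  assumes Q: "\<And>x \<mu>. \<mu> \<in> S \<Longrightarrow> Q x \<mu> \<Longrightarrow>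
    \<exists>U V. open U \<and> x \<in> U \<and> openin W V \<and> \<mu> \<in> V \<and> (\<forall>y\<in>U. \<forall>\<nu>\<in>V. Q y \<nu>)"
begin

lemma open_section: "\<mu> \<in> S \<Longrightarrow> open {x. Q x \<mu>}"
proof (subst open_subopen, intro ballI)
  fix x assume "\<mu> \<in> S" "x \<in> {x. Q x \<mu>}"
  then obtain U V where "open U" "x \<in> U" "\<mu> \<in> V" "\<forall>y\<in>U. \<forall>\<nu>\<in>V. Q y \<nu>"
    using Q[of \<mu> x] by auto
  then show "\<exists>T. open T \<and> x \<in> T \<and> T \<subseteq> {x. Q x \<mu>}"
    by (intro exI[of _ U]) auto
qed

text \<open>By Lindelof, finitely many of the rectangles provided by the joint openness of \<open>Q\<close>
  already carry mass greater than \<open>a\<close>.\<close>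

lemma openin_measure_section_gt: "openin W {\<mu> \<in> S. measure \<mu> {x. Q x \<mu>} > a}"
proof (subst openin_subopen, intro ballI)
  fix \<mu> assume "\<mu> \<in> {\<mu> \<in> S. measure \<mu> {x. Q x \<mu>} > a}"
  then have \<mu>: "\<mu> \<in> S" "measure \<mu> {x. Q x \<mu>} > a" by auto
  interpret prob_space \<mu> using \<mu> prob by blast
  define \<F> where "\<F> = {U. open U \<and> (\<exists>V. openin W V \<and> \<mu> \<in> V \<and> (\<forall>y\<in>U. \<forall>\<nu>\<in>V. Q y \<nu>))}"
  obtain \<G> where \<G>: "\<G> \<subseteq> \<F>" "countable \<G>" "\<Union>\<G> = \<Union>\<F>"
  proof (rule Lindelof)
    show "open U" if "U \<in> \<F>" for U using that by (simp add: \<F>_def)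
  qed
  have "\<Union>\<F> = {x. Q x \<mu>}"
  proof (intro set_eqI iffI)
    fix x assume "x \<in> {x. Q x \<mu>}"
    then obtain U V where "open U" "x \<in> U" "openin W V" "\<mu> \<in> V" "\<forall>y\<in>U. \<forall>\<nu>\<in>V. Q y \<nu>"
      using Q[OF \<mu>(1), of x] by auto
    then show "x \<in> \<Union>\<F>" unfolding \<F>_def by (intro UnionI[of U]) auto
  qed (auto simp: \<F>_def)
  have "open U" if "U \<in> \<G>" for U using that \<G>(1) by (auto simp: \<F>_def)
  moreover have "a < measure \<mu> (\<Union>\<G>)" using \<mu>(2) \<G>(3) \<open>\<Union>\<F> = _\<close> by simp
  ultimately have "\<exists>\<H>. finite \<H> \<and> \<H> \<subseteq> \<G> \<and> a < measure \<mu> (\<Union>\<H>)"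
    by (intro measure_finite_Union_gt prob sets_borel \<mu>(1) \<G>(2))
  then obtain \<H> where \<H>: "finite \<H>" "\<H> \<subseteq> \<G>" "a < measure \<mu> (\<Union>\<H>)" by blast
  obtain V where V: "\<And>U. U \<in> \<H> \<Longrightarrow> openin W (V U) \<and> \<mu> \<in> V U \<and> (\<forall>y\<in>U. \<forall>\<nu>\<in>V U. Q y \<nu>)"
  proof -
    have "\<forall>U\<in>\<H>. \<exists>V. openin W V \<and> \<mu> \<in> V \<and> (\<forall>y\<in>U. \<forall>\<nu>\<in>V. Q y \<nu>)"
      using \<H>(2) \<G>(1) by (auto simp: \<F>_def)
    from bchoice[OF this] show ?thesis using that by blast
  qed
  have opH: "open (\<Union>\<H>)" using \<H>(2) \<G>(1) by (auto simp: \<F>_def)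
  \<comment> \<open>The intersection with \<open>topspace W\<close> covers the case of an empty
    \<H>.\<close>
  define T where "T = {\<nu> \<in> S. a < measure \<nu> (\<Union>\<H>)} \<inter> (topspace W \<inter> \<Inter>(V ` \<H>))"
  have "openin W (topspace W \<inter> \<Inter>(V ` \<H>))"
    using \<H>(1) V by (cases "\<H> = {}") (auto intro!: openin_Int openin_Inter)
  then have "openin W T" unfolding T_def using openin_measure_gt[OF opH] by (rule openin_Int[rotated])
  moreover have "\<mu> \<in> T" using \<mu> \<H> V by (auto simp: T_def topspace_weak_topology)
  moreover have "T \<subseteq> {\<mu> \<in> S. measure \<mu> {x. Q x \<mu>} > a}"
  proof
    fix \<nu> assume \<nu>: "\<nu> \<in> T"
    then have "\<nu> \<in> S" by (auto simp: T_def)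
    interpret \<nu>: prob_space \<nu> using \<open>\<nu> \<in> S\<close> prob by blast
    have "\<Union>\<H> \<subseteq> {x. Q x \<nu>}" using \<nu> V by (auto simp: T_def)
    then have "measure \<nu> (\<Union>\<H>) \<le> measure \<nu> {x. Q x \<nu>}"
      using open_section[OF \<open>\<nu> \<in> S\<close>] sets_borel[OF \<open>\<nu> \<in> S\<close>] by (intro \<nu>.finite_measure_mono) auto
    then show "\<nu> \<in> {\<mu> \<in> S. measure \<mu> {x. Q x \<mu>} > a}" using \<nu> by (auto simp: T_def)
  qed
  ultimately show "\<exists>T. openin W T \<and> \<mu> \<in> T \<and> T \<subseteq> {\<mu> \<in> S. measure \<mu> {x. Q x \<mu>} > a}" by blast
qed

lemma gdelta_in_AE_section: "gdelta_in W {\<mu> \<in> S. AE x in \<mu>. Q x \<mu>}"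
proof -
  have "(AE x in \<mu>. Q x \<mu>) \<longleftrightarrow> (\<forall>n. measure \<mu> {x. Q x \<mu>} > 1 - 1 / real (Suc n))" if "\<mu> \<in> S" for \<mu>
  proof -
    interpret prob_space \<mu> using that prob by blast
    have "{x. Q x \<mu>} \<in> sets \<mu>" using open_section[OF that] sets_borel[OF that] by simp
    then have "(AE x in \<mu>. Q x \<mu>) \<longleftrightarrow> measure \<mu> {x. Q x \<mu>} = 1"
      using prob_eq_1[of "{x. Q x \<mu>}"] by simp
    also have "\<dots> \<longleftrightarrow> (\<forall>n. measure \<mu> {x. Q x \<mu>} > 1 - 1 / real (Suc n))"
      by (rule eq_1_iff_gt[OF prob_le_1])
    finally show ?thesis .
  qed
  then have "{\<mu> \<in> S. AE x in \<mu>. Q x \<mu>} = (\<Inter>n. {\<mu> \<in> S. measure \<mu> {x. Q x \<mu>} > 1 - 1 / real (Suc n)})"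
    by auto
  also have "gdelta_in W \<dots>"
    by (intro gdelta_in_INT_nat open_imp_gdelta_in openin_measure_section_gt)
  finally show ?thesis .
qed

end

text \<open>A basic condition on the integral of a continuous \<open>f\<close> is bracketed by a
  Lipschitz minorant \<open>g\<close> of f and a Lipschitz minorant \<open>h\<close> of -f, whose
  integrals control that of \<open>f\<close> from below and from above.\<close>

lemma weak_nbhd_bounded_lipschitz:
  assumes "openin W U" "\<mu> \<in> U"
  shows "\<exists>F e. finite F \<and> (\<forall>f\<in>F. bounded_lipschitz f) \<and> e > 0 \<and>
    {\<nu> \<in> S. \<forall>f\<in>F. \<bar>(\<integral>x. f x \<partial>\<nu>) - (\<integral>x. f x \<partial>\<mu>)\<bar> < e} \<subseteq> U"
proof -
  define N where "N F e = {\<nu> \<in> S. \<forall>f\<in>F. \<bar>(\<integral>x. f x \<partial>\<nu>) - (\<integral>x. f x \<partial>\<mu>)\<bar> < (e::real)}" for F e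
  have "\<mu> \<in> U \<longrightarrow> (\<exists>F e. finite F \<and> (\<forall>f\<in>F. bounded_lipschitz f) \<and> e > 0 \<and> N F e \<subseteq> U)"
    using openin_topology_generated_by[OF assms(1)[unfolded weak_topology_def]]
  proof induction
    case (Int a b)
    show ?case
    proof
      assume "\<mu> \<in> a \<inter> b"
      then obtain F e F' e' where *: "finite F" "\<forall>f\<in>F. bounded_lipschitz f" "e > 0" "N F e \<subseteq> a"
        "finite F'" "\<forall>f\<in>F'. bounded_lipschitz f" "e' > 0" "N F' e' \<subseteq> b" using Int by auto
      have "N (F \<union> F') (min e e') \<subseteq> N F e \<inter> N F' e'" by (auto simp: N_def)
      then show "\<exists>F e. finite F \<and> (\<forall>f\<in>F. bounded_lipschitz f) \<and> e > 0 \<and> N F e \<subseteq> a \<inter> b"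
        using * by (intro exI[of _ "F \<union> F'"] exI[of _ "min e e'"]) auto
    qed
  next
    case (UN K)
    show ?case
    proof
      assume "\<mu> \<in> \<Union>K"
      then obtain k where "k \<in> K" "\<mu> \<in> k" by auto
      then obtain F e where *: "finite F" "\<forall>f\<in>F. bounded_lipschitz f" "e > 0" "N F e \<subseteq> k"
        using UN.IH[OF \<open>k \<in> K\<close>] by auto
      then have "N F e \<subseteq> \<Union>K" using \<open>k \<in> K\<close> by auto
      with * show "\<exists>F e. finite F \<and> (\<forall>f\<in>F. bounded_lipschitz f) \<and> e > 0 \<and> N F e \<subseteq> \<Union>K"
        by (intro exI[of _ F] exI[of _ e]) simp
    qed
  next
    case (Basis s)
    then obtain f :: "'x \<Rightarrow> real" and V where f: "s = {\<mu> \<in> S. (\<integral>x. f x \<partial>\<mu>) \<in> V}"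
      "continuous_on UNIV f" "bounded (range f)" "open V" by auto
    show ?case
    proof
      assume "\<mu> \<in> s"
      then have "\<mu> \<in> S" "(\<integral>x. f x \<partial>\<mu>) \<in> V" using f by auto
      then obtain e where e: "e > 0" "\<And>t. \<bar>t - (\<integral>x. f x \<partial>\<mu>)\<bar> < e \<Longrightarrow> t \<in> V"
        using f(4) unfolding open_dist dist_real_def by metis
      note \<mu> = prob[OF \<open>\<mu> \<in> S\<close>] sets_borel[OF \<open>\<mu> \<in> S\<close>]
      obtain g where g: "bounded_lipschitz g" "\<And>x. g x \<le> f x" "(\<integral>x. f x \<partial>\<mu>) - e/2 < (\<integral>x. g x \<partial>\<mu>)"
        using bounded_lipschitz_minorant[OF \<mu> f(2,3), of "e/2"] e(1) by auto
      have neg: "continuous_on UNIV (\<lambda>x. - f x)" "bounded (range (\<lambda>x. - f x))"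
        using f(2,3) by (auto intro: continuous_intros simp: bounded_iff)
      obtain h where h: "bounded_lipschitz h" "\<And>x. h x \<le> - f x" "(\<integral>x. - f x \<partial>\<mu>) - e/2 < (\<integral>x. h x \<partial>\<mu>)"
        using bounded_lipschitz_minorant[OF \<mu> neg, of "e/2"] e(1) by auto
      have "N {g, h} (e/2) \<subseteq> s"
      proof
        fix \<nu> assume \<nu>: "\<nu> \<in> N {g, h} (e/2)"
        then have "\<nu> \<in> S" by (simp add: N_def)
        note int = integrable_bounded_continuous[OF prob[OF \<open>\<nu> \<in> S\<close>] sets_borel[OF \<open>\<nu> \<in> S\<close>]]
        have "(\<integral>x. g x \<partial>\<nu>) \<le> (\<integral>x. f x \<partial>\<nu>)"
          using g bounded_lipschitz_continuous[OF g(1)] f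
          by (intro integral_mono int) (auto simp: bounded_lipschitz_def)
        moreover have "(\<integral>x. h x \<partial>\<nu>) \<le> (\<integral>x. - f x \<partial>\<nu>)"
          using h bounded_lipschitz_continuous[OF h(1)] neg
          by (intro integral_mono int) (auto simp: bounded_lipschitz_def)
        moreover have "\<bar>(\<integral>x. g x \<partial>\<nu>) - (\<integral>x. g x \<partial>\<mu>)\<bar> < e/2"
            "\<bar>(\<integral>x. h x \<partial>\<nu>) - (\<integral>x. h x \<partial>\<mu>)\<bar> < e/2"
          using \<nu> unfolding N_def by blast+
        moreover have "(\<integral>x. - f x \<partial>\<nu>) = - (\<integral>x. f x \<partial>\<nu>)" "(\<integral>x. - f x \<partial>\<mu>) = - (\<integral>x. f x \<partial>\<mu>)" by simp_all
        ultimately have "\<bar>(\<integral>x. f x \<partial>\<nu>) - (\<integral>x. f x \<partial>\<mu>)\<bar> < e"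
          using g(3) h(3) by linarith
        then show "\<nu> \<in> s" using e(2) \<open>\<nu> \<in> S\<close> f(1) by simp
      qed
      then show "\<exists>F e. finite F \<and> (\<forall>f\<in>F. bounded_lipschitz f) \<and> e > 0 \<and> N F e \<subseteq> s"
        using g(1) h(1) e(1) by (intro exI[of _ "{g, h}"] exI[of _ "e/2"]) auto
    qed
  qed simp
  then show ?thesis using assms(2) by (simp add: N_def)
qed

lemma dense_in_weakI:
  assumes "A \<subseteq> S"
    and "\<And>\<mu> F e. \<mu> \<in> S \<Longrightarrow> finite F \<Longrightarrow> (\<And>f. f \<in> F \<Longrightarrow> bounded_lipschitz f) \<Longrightarrow> e > 0 \<Longrightarrow>
      \<exists>\<nu>\<in>A. \<forall>f\<in>F. \<bar>(\<integral>x. f x \<partial>\<nu>) - (\<integral>x. f x \<partial>\<mu>)\<bar> < e"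
  shows "dense_in W A"
proof -
  have "\<mu> \<in> W closure_of A" if "\<mu> \<in> S" for \<mu>
    unfolding in_closure_of
  proof (intro conjI allI impI)
    show "\<mu> \<in> topspace W" using \<open>\<mu> \<in> S\<close> by (simp add: topspace_weak_topology)
    fix U assume "\<mu> \<in> U \<and> openin W U"
    then obtain F e where F: "finite F" "\<forall>f\<in>F. bounded_lipschitz f" "e > 0"
      "{\<nu> \<in> S. \<forall>f\<in>F. \<bar>(\<integral>x. f x \<partial>\<nu>) - (\<integral>x. f x \<partial>\<mu>)\<bar> < e} \<subseteq> U"
      using weak_nbhd_bounded_lipschitz[of U \<mu>] by auto
    then obtain \<nu> where "\<nu> \<in> A" "\<forall>f\<in>F. \<bar>(\<integral>x. f x \<partial>\<nu>) - (\<integral>x. f x \<partial>\<mu>)\<bar> < e"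
      using assms(2)[of \<mu> F e] \<open>\<mu> \<in> S\<close> F(1-3) by blast
    moreover from this have "\<nu> \<in> U" using F(4) assms(1) by auto
    ultimately show "\<exists>\<nu>. \<nu> \<in> A \<and> \<nu> \<in> U" by auto
  qed
  then show ?thesis
    using assms(1) closure_of_subset_topspace[of W A]
    by (auto simp: dense_in_def topspace_weak_topology)
qed

end

section \<open>Integrals against invariant measures\<close>

lemma invariant_measuresD:
  assumes "\<mu> \<in> invariant_measures T"
  shows "prob_space \<mu>" "sets \<mu> = sets borel"
    "A \<in> sets borel \<Longrightarrow> emeasure \<mu> (T -` A) = emeasure \<mu> A"
  using assms by (auto simp: invariant_measures_def)

lemma distr_invariant_measure:
  assumes "\<mu> \<in> invariant_measures T" "T \<in> borel \<rightarrow>\<^sub>M borel"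
  shows "distr \<mu> borel T = \<mu>"
proof (rule measure_eqI)
  note \<mu> = invariant_measuresD[OF assms(1)]
  have T: "T \<in> \<mu> \<rightarrow>\<^sub>M borel" using assms(2) \<mu>(2) measurable_cong_sets by blast
  fix A assume "A \<in> sets (distr \<mu> borel T)"
  then show "emeasure (distr \<mu> borel T) A = emeasure \<mu> A"
    using \<mu> T sets_eq_imp_space_eq[OF \<mu>(2)] by (simp add: emeasure_distr)
qed (simp add: invariant_measuresD[OF assms(1)])

lemma integral_invariant_measure_funpow:
  fixes f :: "'x::topological_space \<Rightarrow> real"
  assumes "\<mu> \<in> invariant_measures T" "T \<in> borel \<rightarrow>\<^sub>M borel" "f \<in> borel_measurable borel"
  shows "(\<integral>x. f ((T ^^ n) x) \<partial>\<mu>) = (\<integral>x. f x \<partial>\<mu>)"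
proof (induction n)
  case (Suc n)
  have T: "T \<in> \<mu> \<rightarrow>\<^sub>M borel" using assms(2) measurable_cong_sets[OF invariant_measuresD(2)[OF assms(1)] refl] by blast
  have "(T ^^ n) \<in> borel \<rightarrow>\<^sub>M borel"
    by (rule measurable_compose_n[OF assms(2)])
  then have "(\<lambda>x. f ((T ^^ n) x)) \<in> borel_measurable borel"
    by (rule measurable_compose[OF _ assms(3)])
  then have "(\<integral>x. f ((T ^^ n) x) \<partial>distr \<mu> borel T) = (\<integral>x. f ((T ^^ n) (T x)) \<partial>\<mu>)"
    by (rule integral_distr[OF T])
  then show ?case
    using Suc distr_invariant_measure[OF assms(1,2)] by (simp add: funpow_swap1)
qed simp

section \<open>Mixtures of measures\<close>

text \<open>With a \<open>pmf\<close> as mixing law every family of measures is a measurable kernel.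
  Phase averages, geometric mixtures over a base of the topology and small Bernoulli perturbations
  are all of this form.\<close>

definition mixture :: "'i pmf \<Rightarrow> ('i \<Rightarrow> 'x::topological_space measure) \<Rightarrow> 'x measure" where
  "mixture p K = measure_pmf p \<bind> K"

context
  fixes K :: "'i \<Rightarrow> 'x::topological_space measure"
  assumes prob_K: "\<And>i. prob_space (K i)" and sets_K: "\<And>i. sets (K i) = sets borel"
begin

lemma measurable_kernel: "K \<in> measure_pmf p \<rightarrow>\<^sub>M subprob_algebra borel"
  using prob_K sets_K by (auto simp: space_subprob_algebra prob_space_imp_subprob_space)

lemma sets_mixture: "sets (mixture p K) = sets borel"
  unfolding mixture_def using sets_K by (intro sets_bind) auto

lemma prob_space_mixture: "prob_space (mixture p K)"
  unfolding mixture_def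
  by (rule measure_pmf.prob_space_bind[OF _ measurable_kernel]) (simp add: prob_K)

lemma emeasure_mixture:
  "A \<in> sets borel \<Longrightarrow> emeasure (mixture p K) A = (\<integral>\<^sup>+i. emeasure (K i) A \<partial>p)"
  unfolding mixture_def by (rule emeasure_bind[OF _ measurable_kernel]) auto

lemma integral_mixture:
  fixes f :: "'x \<Rightarrow> real"
  assumes "f \<in> borel_measurable borel" "bounded (range f)"
  shows "(\<integral>x. f x \<partial>mixture p K) = (\<integral>i. (\<integral>x. f x \<partial>K i) \<partial>p)"
proof -
  obtain B where "\<And>x. \<bar>f x\<bar> \<le> B" using assms(2) unfolding bounded_iff by auto
  moreover have "emeasure (K i) (space (K i)) \<le> ennreal 1" for i
    using prob_space.emeasure_space_1[OF prob_K[of i]] by simp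
  ultimately show ?thesis
    unfolding mixture_def
    by (intro integral_bind[where B=B and B'=1, OF assms(1) _ measurable_kernel])
      (auto intro: measure_pmf.finite_measure_axioms)
qed

lemma AE_mixture:
  assumes "Measurable.pred borel P"
  shows "(AE x in mixture p K. P x) \<longleftrightarrow> (\<forall>i\<in>set_pmf p. AE x in K i. P x)"
  unfolding mixture_def using AE_bind[OF measurable_kernel assms] by (simp add: AE_measure_pmf_iff)

end

lemma mixture_invariant:
  assumes "\<And>i. K i \<in> invariant_measures T" "T \<in> borel \<rightarrow>\<^sub>M borel"
  shows "mixture p K \<in> invariant_measures T"
proof -
  note K = invariant_measuresD[OF assms(1)]
  have "T -` A \<in> sets borel" if "A \<in> sets borel" for A
    using measurable_sets[OF assms(2) that] by simp
  then show ?thesis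
    using K by (simp add: invariant_measures_def prob_space_mixture sets_mixture emeasure_mixture)
qed

text \<open>The map pushes each component to the next one, and the last to the first, so the uniform
  average over one cycle is only reindexed.\<close>

lemma cyclic_mixture_invariant:
  fixes K :: "nat \<Rightarrow> 'x::topological_space measure"
  assumes "\<And>i. prob_space (K i)" "\<And>i. sets (K i) = sets borel" "T \<in> borel \<rightarrow>\<^sub>M borel"
    and "\<And>i. distr (K i) borel T = K (Suc i)" "K P = K 0" "P > 0"
  shows "mixture (pmf_of_set {..<P}) K \<in> invariant_measures T"
proof -
  have "emeasure (mixture (pmf_of_set {..<P}) K) (T -` A) = emeasure (mixture (pmf_of_set {..<P}) K) A"
    if A: "A \<in> sets borel" for A
  proof -
    have TA: "T -` A \<in> sets borel" using measurable_sets[OF assms(3) A] by simp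
    have "emeasure (K i) (T -` A) = emeasure (K (Suc i)) A" for i
    proof -
      have "T \<in> K i \<rightarrow>\<^sub>M borel" using assms(3) measurable_cong_sets[OF assms(2) refl] by blast
      then have "emeasure (distr (K i) borel T) A = emeasure (K i) (T -` A)"
        using A sets_eq_imp_space_eq[OF assms(2)[of i]] by (simp add: emeasure_distr)
      then show ?thesis using assms(4) by simp
    qed
    moreover have "(\<Sum>i<P. emeasure (K (Suc i)) A) = (\<Sum>i<P. emeasure (K i) A)"
    proof -
      obtain Q where "P = Suc Q" using assms(6) gr0_implies_Suc by blast
      then show ?thesis
        using assms(5) sum.lessThan_Suc_shift[of "\<lambda>i. emeasure (K i) A" Q]
          sum.lessThan_Suc[of "\<lambda>i. emeasure (K (Suc i)) A" Q] by (simp add: add.commute)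
    qed
    ultimately show ?thesis
      using assms(1,2,6) A TA by (simp add: emeasure_mixture nn_integral_pmf_of_set lessThan_empty_iff)
  qed
  then show ?thesis
    using assms(1,2) by (simp add: invariant_measures_def prob_space_mixture sets_mixture)
qed

section \<open>Periodic orbit measures\<close>

text \<open>The letters are read backwards in \<open>t\<close>, so that the shift \<open>(T x) i = x (i - 1)\<close> advances the
  phase \<open>j\<close> by one.\<close>

definition cyclic_seq :: "nat \<Rightarrow> (nat \<Rightarrow> 'a) \<Rightarrow> nat \<Rightarrow> 'a biseq" where
  "cyclic_seq P b j = Biseq (\<lambda>t. b (nat ((int j - t) mod int P)))"

text \<open>The uniform law on the phases. \<open>P\<close> need not be the least period: a point
  may then be reached by several phases, with the corresponding weight.\<close>

definition cyclic_measure :: "nat \<Rightarrow> (nat \<Rightarrow> 'a::metric_space) \<Rightarrow> 'a biseq measure" where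
  "cyclic_measure P b = mixture (pmf_of_set {..<P}) (\<lambda>j. return borel (cyclic_seq P b j))"

lemma coord_cyclic_seq: "coord (cyclic_seq P b j) t = b (nat ((int j - t) mod int P))"
  by (simp add: cyclic_seq_def Biseq_inverse)

lemma full_shift_cyclic_seq: "full_shift (cyclic_seq P b j) = cyclic_seq P b (Suc j)"
  unfolding full_shift_def coord_cyclic_seq by (simp add: cyclic_seq_def algebra_simps)

lemma full_shift_funpow_cyclic_seq: "(full_shift ^^ n) (cyclic_seq P b j) = cyclic_seq P b (j + n)"
  by (induction n) (auto simp: full_shift_cyclic_seq)

lemma cyclic_seq_add_period: "cyclic_seq P b (j + P) = cyclic_seq P b j"
proof -
  have "(int (j + P) - t) mod int P = (int j - t) mod int P" for t
    using mod_add_self2[of "int j - t" "int P"] by (simp add: algebra_simps)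
  then show ?thesis by (simp add: cyclic_seq_def)
qed

lemma cyclic_measure_invariant:
  "P > 0 \<Longrightarrow> cyclic_measure P (b :: nat \<Rightarrow> 'a::polish_space) \<in> invariant_measures full_shift"
  unfolding cyclic_measure_def
  using cyclic_seq_add_period[of P b 0]
  by (intro cyclic_mixture_invariant) (auto simp: prob_space_return distr_return full_shift_cyclic_seq)

lemma integral_cyclic_measure:
  fixes f :: "'a::metric_space biseq \<Rightarrow> real"
  assumes "P > 0" "f \<in> borel_measurable borel" "bounded (range f)"
  shows "(\<integral>x. f x \<partial>cyclic_measure P b) = (\<Sum>j<P. f (cyclic_seq P b j)) / P"
  unfolding cyclic_measure_def using assms
  by (subst integral_mixture) (auto simp: prob_space_return integral_return integral_pmf_of_set lessThan_empty_iff)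

lemma AE_cyclic_measure:
  assumes "P > 0"
  shows "AE x in cyclic_measure P b. x \<in> cyclic_seq P b ` {..<P}"
proof -
  have "closed (cyclic_seq P b ` {..<P})" by (intro finite_imp_closed) auto
  then have "Measurable.pred borel (\<lambda>x. x \<in> cyclic_seq P b ` {..<P})"
    by (intro pred_sets2[OF borel_closed]) auto
  then show ?thesis
    unfolding cyclic_measure_def using assms
    by (subst AE_mixture) (auto simp: prob_space_return AE_return lessThan_empty_iff)
qed

text \<open>The points are chosen greedily: since the deviations have mean zero, the mean over the next
  point of the squared length of the partial sum grows by at most \<open>card I * C\<^sup>2\<close>.\<close>

lemma empirical_sum_bound:
  fixes g :: "'i \<Rightarrow> 'x \<Rightarrow> real"
  assumes \<mu>: "prob_space \<mu>" and "finite I" and int: "\<And>i. i \<in> I \<Longrightarrow> integrable \<mu> (g i)"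
    and mean: "\<And>i. i \<in> I \<Longrightarrow> (\<integral>x. g i x \<partial>\<mu>) = 0"
    and bound: "\<And>i x. i \<in> I \<Longrightarrow> \<bar>g i x\<bar> \<le> C"
  shows "\<exists>xs :: nat \<Rightarrow> 'x. (\<Sum>i\<in>I. (\<Sum>q<N. g i (xs q))\<^sup>2) \<le> real N * (real (card I) * C\<^sup>2)"
proof (induction N)
  case (Suc N)
  interpret prob_space \<mu> by fact
  let ?D = "real (card I) * C\<^sup>2"
  from Suc obtain xs :: "nat \<Rightarrow> 'x" where xs: "(\<Sum>i\<in>I. (\<Sum>q<N. g i (xs q))\<^sup>2) \<le> real N * ?D" by blast
  define s where "s i = (\<Sum>q<N. g i (xs q))" for i
  define h where "h x = (\<Sum>i\<in>I. (s i)\<^sup>2 + 2 * s i * g i x)" for x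
  have h_int: "integrable \<mu> h" unfolding h_def using int by auto
  have "(\<integral>x. h x \<partial>\<mu>) = (\<Sum>i\<in>I. (s i)\<^sup>2)"
    unfolding h_def using int mean by (subst Bochner_Integration.integral_sum) (auto simp: prob_space)
  moreover have "\<exists>x. h x \<le> (\<integral>x. h x \<partial>\<mu>)"
  proof (rule ccontr)
    assume "\<not> (\<exists>x. h x \<le> (\<integral>x. h x \<partial>\<mu>))"
    then have "AE x in \<mu>. (\<integral>x. h x \<partial>\<mu>) < h x" by (auto simp: not_le)
    from expectation_greater[OF h_int this] show False by simp
  qed
  ultimately obtain x where x: "h x \<le> (\<Sum>i\<in>I. (s i)\<^sup>2)" by auto
  have "(\<Sum>i\<in>I. (\<Sum>q<Suc N. g i ((xs(N := x)) q))\<^sup>2) = (\<Sum>i\<in>I. (s i + g i x)\<^sup>2)"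
    by (simp add: s_def)
  also have "\<dots> = h x + (\<Sum>i\<in>I. (g i x)\<^sup>2)"
    unfolding h_def by (simp add: power2_sum sum.distrib algebra_simps)
  also have "(\<Sum>i\<in>I. (g i x)\<^sup>2) \<le> (\<Sum>i\<in>I. C\<^sup>2)"
    using bound by (intro sum_mono) (metis abs_le_square_iff abs_of_nonneg abs_ge_zero order_trans)
  also have "h x + (\<Sum>i\<in>I. C\<^sup>2) \<le> real (Suc N) * ?D"
    using x xs by (simp add: s_def algebra_simps)
  finally show ?case by (intro exI[of _ "xs(N := x)"]) simp
qed simp

text \<open>After centring, the squared length of the vector of sums grows only linearly in
  \<open>N\<close>, so the averages deviate by an amount of order 1 / sqrt N, simultaneously for all
  functions in the family.\<close>

lemma empirical_approx:
  fixes g :: "'i \<Rightarrow> 'x \<Rightarrow> real"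
  assumes \<mu>: "prob_space \<mu>" and "finite I" and int: "\<And>i. i \<in> I \<Longrightarrow> integrable \<mu> (g i)"
    and bound: "\<And>i x. i \<in> I \<Longrightarrow> \<bar>g i x\<bar> \<le> C" and "e > 0"
  shows "\<exists>N>0. \<exists>xs :: nat \<Rightarrow> 'x. \<forall>i\<in>I. \<bar>(\<Sum>q<N. g i (xs q)) / real N - (\<integral>x. g i x \<partial>\<mu>)\<bar> < e"
proof -
  interpret prob_space \<mu> by fact
  define g' where "g' i x = g i x - (\<integral>x. g i x \<partial>\<mu>)" for i x
  define D where "D = real (card I) * (2 * C)\<^sup>2"
  \<comment> \<open>The squared deviation of an average is at most D / N, which is less than e^2 for
    this \<open>N\<close>.\<close>
  obtain N :: nat where N: "D / e\<^sup>2 < real N" using reals_Archimedean2 by blast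
  have "0 \<le> D / e\<^sup>2" by (simp add: D_def)
  then have "N > 0" using N by (cases N) auto
  have "\<bar>\<integral>x. g i x \<partial>\<mu>\<bar> \<le> C" if "i \<in> I" for i
  proof -
    have "- C \<le> g i x" "g i x \<le> C" for x using bound[OF that, of x] by linarith+
    then have "- C \<le> (\<integral>x. g i x \<partial>\<mu>)" "(\<integral>x. g i x \<partial>\<mu>) \<le> C"
      by (auto intro!: integral_ge_const integral_le_const int that)
    then show ?thesis by linarith
  qed
  then have "\<bar>g' i x\<bar> \<le> 2 * C" if "i \<in> I" for i x
    using bound[OF that, of x] that unfolding g'_def by fastforce
  moreover have "integrable \<mu> (g' i)" "(\<integral>x. g' i x \<partial>\<mu>) = 0" if "i \<in> I" for i
    unfolding g'_def using int[OF that] by (auto simp: prob_space)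
  ultimately obtain xs :: "nat \<Rightarrow> 'x" where xs: "(\<Sum>i\<in>I. (\<Sum>q<N. g' i (xs q))\<^sup>2) \<le> real N * D"
    using empirical_sum_bound[OF \<mu> \<open>finite I\<close>, of g' "2 * C" N] unfolding D_def by blast
  have "\<bar>(\<Sum>q<N. g i (xs q)) / real N - (\<integral>x. g i x \<partial>\<mu>)\<bar> < e" if "i \<in> I" for i
  proof -
    have "(\<Sum>q<N. g' i (xs q))\<^sup>2 \<le> (\<Sum>i\<in>I. (\<Sum>q<N. g' i (xs q))\<^sup>2)"
      using \<open>finite I\<close> that by (intro member_le_sum) auto
    also note xs
    also have "real N * D < real N * (e\<^sup>2 * real N)"
      using N \<open>N > 0\<close> \<open>e > 0\<close> by (simp add: field_simps)
    also have "\<dots> = (e * real N)\<^sup>2" by (simp add: power2_eq_square)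
    finally have "\<bar>\<Sum>q<N. g' i (xs q)\<bar> < e * real N"
      using \<open>e > 0\<close> by (intro power2_less_imp_less[of "\<bar>\<Sum>q<N. g' i (xs q)\<bar>"]) auto
    moreover have "(\<Sum>q<N. g' i (xs q)) = ((\<Sum>q<N. g i (xs q)) / real N - (\<integral>x. g i x \<partial>\<mu>)) * real N"
      using \<open>N > 0\<close> by (simp add: g'_def sum_subtractf field_simps)
    ultimately show ?thesis using \<open>N > 0\<close> by (simp add: abs_mult)
  qed
  then show ?thesis using \<open>N > 0\<close> by blast
qed

lemma bounded_lipschitz_uniform:
  fixes F :: "('x::metric_space \<Rightarrow> real) set"
  assumes "finite F" "\<And>f. f \<in> F \<Longrightarrow> bounded_lipschitz f"
  shows "\<exists>C>0. \<forall>f\<in>F. (\<forall>x. \<bar>f x\<bar> \<le> C) \<and> (\<forall>x y. \<bar>f x - f y\<bar> \<le> C * dist x y)"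
proof -
  have "\<forall>\<^sub>F C in at_top. \<forall>f\<in>F. (\<forall>x. \<bar>f x\<bar> \<le> C) \<and> (\<forall>x y. \<bar>f x - f y\<bar> \<le> C * dist x y)"
  proof (intro eventually_ball_finite ballI assms)
    fix f assume "f \<in> F"
    then obtain B L where B: "\<And>x. \<bar>f x\<bar> \<le> B" and L: "L-lipschitz_on UNIV f"
      using assms(2) unfolding bounded_lipschitz_def bounded_iff by fastforce
    have "\<bar>f x - f y\<bar> \<le> C * dist x y" if "C \<ge> L" for C x y
      using lipschitz_onD[OF L, of x y] mult_right_mono[OF that zero_le_dist[of x y]]
      by (simp add: dist_real_def)
    then have "(\<forall>x. \<bar>f x\<bar> \<le> C) \<and> (\<forall>x y. \<bar>f x - f y\<bar> \<le> C * dist x y)" if "C \<ge> max B L" for C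
      using B that by (meson max.boundedE order_trans)
    then show "\<forall>\<^sub>F C in at_top. (\<forall>x. \<bar>f x\<bar> \<le> C) \<and> (\<forall>x y. \<bar>f x - f y\<bar> \<le> C * dist x y)"
      unfolding eventually_at_top_linorder by blast
  qed
  then have "\<forall>\<^sub>F C in at_top. C > 0 \<and> (\<forall>f\<in>F. (\<forall>x. \<bar>f x\<bar> \<le> C) \<and> (\<forall>x y. \<bar>f x - f y\<bar> \<le> C * dist x y))"
    using eventually_gt_at_top[of 0] by (rule eventually_conj[rotated])
  then show ?thesis by (auto dest: eventually_happens)
qed

text \<open>Block q stores the coordinates 0, -1, ..., -(n - 1) of \<open>xs q\<close>, which are
  the letters that the first n iterates of the shift show at position 0.\<close>

definition block_word :: "nat \<Rightarrow> (nat \<Rightarrow> 'a biseq) \<Rightarrow> nat \<Rightarrow> 'a" where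
  "block_word n xs m = coord (xs (m div n)) (- int (m mod n))"

text \<open>As long as the window of radius \<open>k\<close> about phase \<open>l\<close> stays
  inside block \<open>q\<close>, coordinate \<open>i\<close> reads the letter number l - i of that
  block, that is coordinate i - l of \<open>xs q\<close>.\<close>

lemma coord_cyclic_block_word:
  assumes "q < N" "l < n" "\<bar>i\<bar> \<le> int k" "k \<le> l" "l + k < n"
  shows "coord (cyclic_seq (N * n) (block_word n xs) (q * n + l)) i = coord ((full_shift ^^ l) (xs q)) i"
proof -
  define m where "m = nat (int l - i)"
  have m: "int m = int l - i" "m < n" using assms by (auto simp: m_def)
  have "q * n + m < Suc q * n" using m(2) by simp
  also have "Suc q * n \<le> N * n" using assms(1) by (intro mult_right_mono) auto
  finally have lt: "q * n + m < N * n" .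
  have "int (q * n + l) - i = int (q * n + m)" using m(1) by simp
  then have "nat ((int (q * n + l) - i) mod int (N * n)) = q * n + m"
    using lt by (metis mod_less nat_int zmod_int)
  then show ?thesis
    using m by (simp add: coord_cyclic_seq block_word_def coord_full_shift_funpow)
qed

text \<open>In each block at most 2 k phases are within \<open>k\<close> of an end; each of them
  costs at most 2 C. All other phases see the right coordinates in the window and cost at most
  \<open>r\<close>.\<close>

lemma cyclic_block_sum_diff:
  fixes f :: "'a::metric_space biseq \<Rightarrow> real"
  assumes "\<And>x. \<bar>f x\<bar> \<le> C" "\<And>x y. (\<And>i. \<bar>i\<bar> \<le> int k \<Longrightarrow> coord x i = coord y i) \<Longrightarrow> \<bar>f x - f y\<bar> \<le> r" "r \<ge> 0"
  shows "\<bar>(\<Sum>j<N * n. f (cyclic_seq (N * n) (block_word n xs) j)) - (\<Sum>q<N. \<Sum>l<n. f ((full_shift ^^ l) (xs q)))\<bar>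
    \<le> real N * (real n * r + 4 * real k * C)"
proof -
  let ?y = "cyclic_seq (N * n) (block_word n xs)"
  have "C \<ge> 0" using assms(1) abs_ge_zero order_trans by blast
  have "(\<Sum>j<N * n. f (?y j)) = (\<Sum>q<N. sum (\<lambda>j. f (?y j)) {q * n..<q * n + n})"
    by (rule sum.nat_group[symmetric])
  also have "\<dots> = (\<Sum>q<N. \<Sum>l<n. f (?y (q * n + l)))"
    by (subst sum.atLeastLessThan_shift_0) (simp add: lessThan_atLeast0)
  finally have "(\<Sum>j<N * n. f (?y j)) - (\<Sum>q<N. \<Sum>l<n. f ((full_shift ^^ l) (xs q))) =
      (\<Sum>q<N. \<Sum>l<n. f (?y (q * n + l)) - f ((full_shift ^^ l) (xs q)))"
    by (simp add: sum_subtractf)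
  also have "\<bar>\<dots>\<bar> \<le> (\<Sum>q<N. real n * r + 4 * real k * C)"
  proof (rule order_trans[OF sum_abs], rule sum_mono)
    fix q assume q: "q \<in> {..<N}"
    let ?bad = "{l. l < n \<and> (l < k \<or> n \<le> l + k)}"
    have "\<bar>\<Sum>l<n. f (?y (q * n + l)) - f ((full_shift ^^ l) (xs q))\<bar> \<le>
        (\<Sum>l<n. r + (if l < k \<or> n \<le> l + k then 2 * C else 0))"
    proof (rule order_trans[OF sum_abs], rule sum_mono)
      fix l assume l: "l \<in> {..<n}"
      show "\<bar>f (?y (q * n + l)) - f ((full_shift ^^ l) (xs q))\<bar> \<le> r + (if l < k \<or> n \<le> l + k then 2 * C else 0)"
      proof (cases "l < k \<or> n \<le> l + k")
        case True
        then show ?thesis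
          using assms(1)[of "?y (q * n + l)"] assms(1)[of "(full_shift ^^ l) (xs q)"] \<open>r \<ge> 0\<close>
          by (simp add: abs_le_iff)
      next
        case False
        then show ?thesis using q l
          by (auto intro!: assms(2) coord_cyclic_block_word)
      qed
    qed
    also have "\<dots> = real n * r + 2 * C * real (card ?bad)"
      by (simp add: sum.distrib sum.If_cases Int_def conj_commute)
    also have "card ?bad \<le> card ({..<k} \<union> {n - k..<n})" by (intro card_mono) auto
    also have "card ({..<k} \<union> {n - k..<n}) \<le> k + k"
      by (rule order_trans[OF card_Un_le]) auto
    finally show "\<bar>\<Sum>l<n. f (?y (q * n + l)) - f ((full_shift ^^ l) (xs q))\<bar> \<le> real n * r + 4 * real k * C"
      using \<open>C \<ge> 0\<close> by (auto simp: mult_left_mono algebra_simps elim!: order_trans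
        intro!: mult_left_mono[of "real (card ?bad)" "2 * real k" "2 * C", simplified])
  qed
  also have "\<dots> = real N * (real n * r + 4 * real k * C)" by simp
  finally show ?thesis .
qed

text \<open>Three errors of e / 4 are added: replacing a function by its values on a finite window,
  the junctions between blocks, and the empirical average.\<close>

theorem cyclic_measure_approx:
  fixes \<mu> :: "'a::polish_space biseq measure"
  assumes \<mu>: "\<mu> \<in> invariant_measures full_shift"
    and F: "finite F" "\<And>f. f \<in> F \<Longrightarrow> bounded_lipschitz f" and "e > 0"
  shows "\<exists>P>0. \<exists>b. \<forall>f\<in>F. \<bar>(\<integral>x. f x \<partial>cyclic_measure P b) - (\<integral>x. f x \<partial>\<mu>)\<bar> < e"
proof -
  note \<mu>' = invariant_measuresD[OF \<mu>]
  interpret prob_space \<mu> by (rule \<mu>')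
  obtain C where C: "C > 0" "\<And>f x. f \<in> F \<Longrightarrow> \<bar>f x\<bar> \<le> C"
      "\<And>f x y. f \<in> F \<Longrightarrow> \<bar>f x - f y\<bar> \<le> C * dist x y"
    using bounded_lipschitz_uniform[OF F] by metis
  have meas: "f \<in> borel_measurable borel" and bdd: "bounded (range f)" if "f \<in> F" for f
    using F(2)[OF that] bounded_lipschitz_continuous by (auto simp: bounded_lipschitz_def intro: borel_measurable_continuous_onI)
  have "e / (4 * C) > 0" using C(1) \<open>e > 0\<close> by simp
  then obtain k d where k: "d > 0" "\<And>x y :: 'a biseq.
      (\<forall>n\<in>{-int k..int k}. dist (coord x n) (coord y n) \<le> d) \<Longrightarrow> dist x y < e / (4 * C)"
    using biseq_dist_uniform by metis
  have agree: "\<bar>f x - f y\<bar> \<le> e / 4" if "f \<in> F" "\<And>i. \<bar>i\<bar> \<le> int k \<Longrightarrow> coord x i = coord y i" for f x y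
  proof -
    have "dist x y < e / (4 * C)" using that(2) k by (intro k(2)) auto
    then have "C * dist x y \<le> C * (e / (4 * C))" using C(1) by (intro mult_left_mono) auto
    also have "\<dots> = e / 4" using C(1) by simp
    finally show ?thesis using C(3)[OF that(1), of x y] by linarith
  qed
  \<comment> \<open>This \<open>n\<close> makes the junction cost 4 k C of a block at most n e /
    4.\<close>
  obtain n :: nat where n: "16 * real k * C / e < real n" using reals_Archimedean2 by blast
  have "0 \<le> 16 * real k * C / e" using C(1) \<open>e > 0\<close> by simp
  then have "n > 0" using n by (cases n) auto
  \<comment> \<open>By invariance \<open>g f\<close> has the same mean as \<open>f\<close>. Sampling
    points for \<open>g f\<close> instead of \<open>f\<close> gives every sampled point an orbit
    segment of length \<open>n\<close>, which is what a block reproduces.\<close>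
  define g where "g f x = (\<Sum>l<n. f ((full_shift ^^ l) x)) / real n" for f :: "'a biseq \<Rightarrow> real" and x
  have meas_l: "(\<lambda>x. f ((full_shift ^^ l) x)) \<in> borel_measurable borel" if "f \<in> F" for f l
    by (rule measurable_compose[OF measurable_compose_n[OF measurable_full_shift] meas[OF that]])
  have int_l: "integrable \<mu> (\<lambda>x. f ((full_shift ^^ l) x))" if "f \<in> F" for f l
    using meas_l[OF that] C(2)[OF that]
    by (intro integrable_bounded_borel \<mu>') (auto intro!: boundedI[of _ C])
  have g_int: "integrable \<mu> (g f)" if "f \<in> F" for f
    unfolding g_def using int_l[OF that] by auto
  have g_mean: "(\<integral>x. g f x \<partial>\<mu>) = (\<integral>x. f x \<partial>\<mu>)" if "f \<in> F" for f
    unfolding g_def using int_l[OF that] \<open>n > 0\<close>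
      integral_invariant_measure_funpow[OF \<mu> measurable_full_shift meas[OF that]] by simp
  have g_bound: "\<bar>g f x\<bar> \<le> C" if "f \<in> F" for f x
  proof -
    have "\<bar>\<Sum>l<n. f ((full_shift ^^ l) x)\<bar> \<le> (\<Sum>l<n. C)"
      by (rule order_trans[OF sum_abs]) (intro sum_mono C(2) that)
    then show ?thesis using \<open>n > 0\<close> by (simp add: g_def abs_div field_simps)
  qed
  obtain N xs where N: "N > 0" "\<And>f. f \<in> F \<Longrightarrow> \<bar>(\<Sum>q<N. g f (xs q)) / real N - (\<integral>x. g f x \<partial>\<mu>)\<bar> < e / 4"
    using empirical_approx[where e="e / 4" and g=g, OF \<mu>'(1) F(1) g_int g_bound] \<open>e > 0\<close> by auto
  have "N * n > 0" using \<open>N > 0\<close> \<open>n > 0\<close> by simp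
  have "\<bar>(\<integral>x. f x \<partial>cyclic_measure (N * n) (block_word n xs)) - (\<integral>x. f x \<partial>\<mu>)\<bar> < e" if "f \<in> F" for f
  proof -
    define Y where "Y = (\<Sum>j<N * n. f (cyclic_seq (N * n) (block_word n xs) j))"
    define Z where "Z = (\<Sum>q<N. \<Sum>l<n. f ((full_shift ^^ l) (xs q)))"
    have "\<bar>Y - Z\<bar> \<le> real N * (real n * (e / 4) + 4 * real k * C)"
      unfolding Y_def Z_def using C(2) agree that \<open>e > 0\<close> by (intro cyclic_block_sum_diff) auto
    also have "\<dots> \<le> real N * (real n * (e / 4) + real n * (e / 4))"
      using n \<open>e > 0\<close> by (intro mult_left_mono add_left_mono) (simp_all add: field_simps)
    finally have "\<bar>Y - Z\<bar> \<le> real (N * n) * (e / 2)" by (simp add: algebra_simps)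
    then have "\<bar>(Y - Z) / real (N * n)\<bar> \<le> e / 2"
      using \<open>N * n > 0\<close> by (simp add: abs_div pos_divide_le_eq mult.commute)
    moreover have "Z / real (N * n) = (\<Sum>q<N. g f (xs q)) / real N"
      by (simp add: Z_def g_def sum_divide_distrib mult.commute)
    moreover have "(\<integral>x. f x \<partial>cyclic_measure (N * n) (block_word n xs)) = Y / real (N * n)"
      unfolding Y_def using integral_cyclic_measure[OF \<open>N * n > 0\<close> meas[OF that] bdd[OF that]] by simp
    ultimately show ?thesis
      using N(2)[OF that] \<open>e > 0\<close> unfolding g_mean[OF that] diff_divide_distrib by linarith
  qed
  then show ?thesis using \<open>N * n > 0\<close> by blast
qed

section \<open>An invariant measure of full support\<close>

text \<open>A neighbourhood restricts a window of 2 k + 1 coordinates only. With this number as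
  period the window meets every residue exactly once, so its letters can be prescribed
  freely.\<close>

lemma cyclic_seq_in_open:
  fixes U :: "'a::metric_space biseq set"
  assumes "open U" "U \<noteq> {}"
  shows "\<exists>P>0. \<exists>b. cyclic_seq P b 0 \<in> U"
proof -
  obtain x e where x: "e > 0" "\<And>y. dist y x < e \<Longrightarrow> y \<in> U"
    using assms unfolding open_dist by blast
  obtain k d where k: "d > 0" "\<And>x y :: 'a biseq.
      (\<forall>n\<in>{-int k..int k}. dist (coord x n) (coord y n) \<le> d) \<Longrightarrow> dist x y < e"
    using biseq_dist_uniform[OF x(1)] by metis
  define P where "P = 2 * k + 1"
  define b where "b m = coord x (if m \<le> k then - int m else int P - int m)" for m
  have "coord (cyclic_seq P b 0) t = coord x t" if "t \<in> {-int k..int k}" for t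
  proof (cases "t \<le> 0")
    case True
    then have "(- t) mod int P = - t" using that by (intro mod_pos_pos_trivial) (auto simp: P_def)
    moreover have "nat (- t) \<le> k" using that by auto
    ultimately show ?thesis using True by (simp add: coord_cyclic_seq b_def)
  next
    case False
    have "(- t) mod int P = (int P - t) mod int P" by simp
    also have "\<dots> = int P - t" using that False by (intro mod_pos_pos_trivial) (auto simp: P_def)
    finally show ?thesis using False that by (auto simp: coord_cyclic_seq b_def P_def)
  qed
  then have "dist (cyclic_seq P b 0) x < e" using k by auto
  then show ?thesis using x(2) by (intro exI[of _ P] conjI exI[of _ b]) (auto simp: P_def)
qed

text \<open>Every basic open set contains a periodic point; a mixture of the countably many orbit
  measures with positive weights charges all of them.\<close>

lemma exists_full_support:
  "\<exists>\<nu> \<in> invariant_measures (full_shift :: 'a::polish_space biseq \<Rightarrow> _). \<forall>U. open U \<longrightarrow> U \<noteq> {} \<longrightarrow> emeasure \<nu> U > 0"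
proof -
  obtain B :: "'a biseq set set" where B: "countable B" "topological_basis B"
    using ex_countable_basis by blast
  \<comment> \<open>\<open>from_nat_into\<close> enumerates non-empty families, hence
    \<open>UNIV\<close>; the empty set contains no periodic point and is removed.\<close>
  define B' where "B' = insert UNIV (B - {{}})"
  have B': "countable B'" "B' \<noteq> {}" "\<And>U. U \<in> B' \<Longrightarrow> open U \<and> U \<noteq> {}"
    using B topological_basis_open by (auto simp: B'_def)
  have "\<forall>i. \<exists>P b. P > 0 \<and> cyclic_seq P b 0 \<in> from_nat_into B' i"
    using cyclic_seq_in_open B'(2,3) from_nat_into by metis
  then obtain P b where Pb: "\<And>i. P i > 0" "\<And>i. cyclic_seq (P i) (b i) 0 \<in> from_nat_into B' i" by metis
  \<comment> \<open>The geometric law gives every index positive mass.\<close>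
  define \<nu> where "\<nu> = mixture (geometric_pmf (1/2)) (\<lambda>i. cyclic_measure (P i) (b i))"
  have inv: "cyclic_measure (P i) (b i) \<in> invariant_measures full_shift" for i
    using Pb cyclic_measure_invariant by blast
  note inv' = invariant_measuresD(1,2)[OF inv]
  have "\<nu> \<in> invariant_measures full_shift"
    unfolding \<nu>_def by (rule mixture_invariant[OF inv measurable_full_shift])
  moreover have "emeasure \<nu> U > 0" if U: "open U" "U \<noteq> {}" for U
  proof (rule ccontr)
    assume "\<not> emeasure \<nu> U > 0"
    then have "emeasure \<nu> U = 0" by simp
    moreover have "U \<in> sets \<nu>" using sets_mixture[where K="\<lambda>i. cyclic_measure (P i) (b i)", OF inv'] U by (simp add: \<nu>_def)
    ultimately have "AE x in \<nu>. x \<notin> U" by (intro AE_not_in) (auto simp: null_sets_def)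
    moreover have pred: "Measurable.pred borel (\<lambda>x. x \<notin> U)"
      using U by (auto simp: pred_def Collect_neg_eq intro: borel_comp)
    ultimately have *: "AE x in cyclic_measure (P i) (b i). x \<notin> U" for i
      unfolding \<nu>_def using AE_mixture[where K="\<lambda>i. cyclic_measure (P i) (b i)", OF inv'] set_pmf_geometric[of "1/2"] by auto
    obtain x where "x \<in> U" using U by auto
    then obtain V where V: "V \<in> B" "x \<in> V" "V \<subseteq> U" using topological_basisE[OF B(2) U(1)] by metis
    then have "V \<in> B'" by (auto simp: B'_def)
    then obtain i where i: "from_nat_into B' i = V" using from_nat_into_surj[OF B'(1)] by blast
    have "AE x in return borel (cyclic_seq (P i) (b i) 0). x \<notin> U"
      using *[of i] Pb(1)[of i] pred unfolding cyclic_measure_def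
      by (subst (asm) AE_mixture) (auto simp: prob_space_return lessThan_empty_iff)
    then have "cyclic_seq (P i) (b i) 0 \<notin> U" using pred by (subst (asm) AE_return) auto
    then show False using Pb(2)[of i] i V by auto
  qed
  ultimately show ?thesis by blast
qed

section \<open>Diffuse measures on perfect Polish spaces\<close>

text \<open>Let d be the distance from \<open>c\<close> to the new point. Balls of radius d / 4
  about both are at least d / 2 apart, and the bound d < r / 2 keeps them in the ball of radius
  \<open>r\<close> about \<open>c\<close>. Perfectness provides the point.\<close>

definition nearby :: "'a::{metric_space, perfect_space} \<Rightarrow> real \<Rightarrow> 'a" where
  "nearby c r = (SOME y. y \<noteq> c \<and> dist y c < r / 2)"

lemma nearby:
  assumes "r > 0"
  shows "nearby c r \<noteq> c" "dist (nearby c r) c < r / 2"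
proof -
  have "\<exists>y. y \<noteq> c \<and> dist y c < r / 2"
    using islimpt_UNIV[of c] assms unfolding islimpt_approachable by (metis UNIV_I half_gt_zero)
  from someI_ex[OF this] show "nearby c r \<noteq> c" "dist (nearby c r) c < r / 2"
    unfolding nearby_def by auto
qed

text \<open>A Cantor scheme of closed balls; the two children of the ball with index \<open>i\<close> at level \<open>n\<close>
  have the indices \<open>2 * i\<close> and \<open>2 * i + 1\<close> at level \<open>Suc n\<close>.\<close>

primrec cantor_scheme :: "'a::{metric_space, perfect_space} \<times> real \<Rightarrow> nat \<Rightarrow> int \<Rightarrow> 'a \<times> real" where
  "cantor_scheme B 0 i = B"
| "cantor_scheme B (Suc n) i = (case cantor_scheme B n (i div 2) of (c, r) \<Rightarrow>
     (if odd i then nearby c r else c, dist (nearby c r) c / 4))"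

definition cantor_ball :: "'a::{metric_space, perfect_space} \<times> real \<Rightarrow> nat \<Rightarrow> int \<Rightarrow> 'a set" where
  "cantor_ball B n i = cball (fst (cantor_scheme B n i)) (snd (cantor_scheme B n i))"

text \<open>The binary digits of \<open>u\<close> choose the branch: at level n the index is the
  integer part of 2^n u. For \<open>u\<close> in [0, 1) this coding turns each cell of level n into
  a dyadic interval of length 1 / 2^n.\<close>

definition cantor_point :: "'a::{polish_space, perfect_space} \<times> real \<Rightarrow> real \<Rightarrow> 'a" where
  "cantor_point B u = lim (\<lambda>n. fst (cantor_scheme B n \<lfloor>2 ^ n * u\<rfloor>))"

context
  fixes B :: "'a::{polish_space, perfect_space} \<times> real"
  assumes B: "snd B > 0"
begin

lemma cantor_radius_pos: "snd (cantor_scheme B n i) > 0"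
proof (induction n arbitrary: i)
  case (Suc n)
  then show ?case
    using nearby(1)[OF Suc[of "i div 2"], of "fst (cantor_scheme B n (i div 2))"]
    by (simp add: case_prod_beta)
qed (use B in simp)

lemma cantor_radius_le: "snd (cantor_scheme B n i) \<le> snd B / 2 ^ n"
proof (induction n arbitrary: i)
  case (Suc n)
  let ?c = "fst (cantor_scheme B n (i div 2))" and ?r = "snd (cantor_scheme B n (i div 2))"
  have "dist (nearby ?c ?r) ?c / 4 \<le> ?r / 2"
    using nearby(2)[OF cantor_radius_pos, of ?c n "i div 2"] cantor_radius_pos[of n "i div 2"] by linarith
  also have "\<dots> \<le> snd B / 2 ^ n / 2" using Suc[of "i div 2"] by simp
  finally show ?case by (simp add: case_prod_beta)
qed (use B in simp)

lemma cantor_ball_Suc_subset: "cantor_ball B (Suc n) i \<subseteq> cantor_ball B n (i div 2)"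
proof
  let ?c = "fst (cantor_scheme B n (i div 2))" and ?r = "snd (cantor_scheme B n (i div 2))"
  fix x assume "x \<in> cantor_ball B (Suc n) i"
  then have "dist (if odd i then nearby ?c ?r else ?c) x \<le> dist (nearby ?c ?r) ?c / 4"
    by (simp add: cantor_ball_def case_prod_beta)
  moreover have "dist ?c (if odd i then nearby ?c ?r else ?c) \<le> dist (nearby ?c ?r) ?c"
    by (auto simp: dist_commute)
  moreover have "dist (nearby ?c ?r) ?c < ?r / 2"
    by (rule nearby(2)[OF cantor_radius_pos])
  ultimately have "dist ?c x \<le> ?r"
    using dist_triangle[of ?c x "if odd i then nearby ?c ?r else ?c"] cantor_radius_pos[of n "i div 2"]
    by linarith
  then show "x \<in> cantor_ball B n (i div 2)" by (simp add: cantor_ball_def)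
qed

text \<open>Cells with different parents inherit the gap of the parents; for siblings, centres at
  distance d and radii d / 4 leave more than d / 4. A positive gap, rather than mere disjointness,
  is what bounds the mass of a small ball with arbitrary centre.\<close>

lemma cantor_ball_gap:
  assumes "i \<noteq> i'" "i \<in> {0..<2 ^ n}" "i' \<in> {0..<2 ^ n}"
  shows "\<exists>s>0. \<forall>x\<in>cantor_ball B n i. \<forall>y\<in>cantor_ball B n i'. s < dist x y"
  using assms
proof (induction n arbitrary: i i')
  case (Suc n)
  show ?case
  proof (cases "i div 2 = i' div 2")
    case False
    then have "\<exists>s>0. \<forall>x\<in>cantor_ball B n (i div 2). \<forall>y\<in>cantor_ball B n (i' div 2). s < dist x y"
      using Suc.prems by (intro Suc.IH) auto
    then show ?thesis using cantor_ball_Suc_subset[of n i] cantor_ball_Suc_subset[of n i'] by blast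
  next
    case True
    let ?c = "fst (cantor_scheme B n (i div 2))" and ?r = "snd (cantor_scheme B n (i div 2))"
    have parity: "odd i \<longleftrightarrow> even i'"
      using True Suc.prems(1) by presburger
    let ?d = "dist (nearby ?c ?r) ?c"
    have "?d > 0" using nearby(1)[OF cantor_radius_pos] by simp
    have "?d / 4 < dist x y" if "x \<in> cantor_ball B (Suc n) i" "y \<in> cantor_ball B (Suc n) i'" for x y
    proof -
      let ?p = "if odd i then nearby ?c ?r else ?c" and ?p' = "if odd i' then nearby ?c ?r else ?c"
      have "dist ?p x \<le> ?d / 4" "dist ?p' y \<le> ?d / 4"
        using that True by (auto simp: cantor_ball_def case_prod_beta split: if_splits)
      moreover have "dist ?p ?p' = ?d" using parity by (auto simp: dist_commute)
      moreover have "dist ?p ?p' \<le> dist ?p x + dist x y + dist ?p' y"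
        using dist_triangle[of ?p ?p' x] dist_triangle2[of x ?p' y] unfolding dist_commute[of y] by linarith
      ultimately show ?thesis using \<open>?d > 0\<close> by linarith
    qed
    then show ?thesis using \<open>?d > 0\<close> by (intro exI[of _ "?d / 4"]) auto
  qed
qed simp

lemma floor_pow2_div: "\<lfloor>2 ^ Suc n * u\<rfloor> div 2 = \<lfloor>2 ^ n * (u::real)\<rfloor>"
proof -
  have "\<lfloor>(2 ^ Suc n * u) / real_of_int 2\<rfloor> = \<lfloor>2 ^ Suc n * u\<rfloor> div 2"
    by (rule floor_divide_real_eq_div) simp
  then show ?thesis by simp
qed

lemma cantor_ball_floor_mono:
  "n \<le> m \<Longrightarrow> cantor_ball B m \<lfloor>2 ^ m * (u::real)\<rfloor> \<subseteq> cantor_ball B n \<lfloor>2 ^ n * u\<rfloor>"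
proof (induction m rule: dec_induct)
  case (step m)
  then show ?case using cantor_ball_Suc_subset[of m "\<lfloor>2 ^ Suc m * u\<rfloor>"] floor_pow2_div[of m u] by auto
qed simp

lemma cantor_center_in_ball:
  "n \<le> m \<Longrightarrow> fst (cantor_scheme B m \<lfloor>2 ^ m * (u::real)\<rfloor>) \<in> cantor_ball B n \<lfloor>2 ^ n * u\<rfloor>"
  using cantor_ball_floor_mono[of n m u] cantor_radius_pos[of m "\<lfloor>2 ^ m * u\<rfloor>"]
  by (auto simp: cantor_ball_def subset_eq)

lemma cantor_point_tendsto: "(\<lambda>n. fst (cantor_scheme B n \<lfloor>2 ^ n * u\<rfloor>)) \<longlonglongrightarrow> cantor_point B u"
proof -
  have "Cauchy (\<lambda>n. fst (cantor_scheme B n \<lfloor>2 ^ n * u\<rfloor>))" (is "Cauchy ?X")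
    unfolding Cauchy_altdef2
  proof (intro allI impI)
    fix e :: real assume "e > 0"
    then obtain N where N: "(1 / 2) ^ N < e / snd B"
      using real_arch_pow_inv[of "e / snd B" "1/2"] B by auto
    have "dist (?X n) (?X N) < e" if "n \<ge> N" for n
    proof -
      have "dist (?X n) (?X N) \<le> snd (cantor_scheme B N \<lfloor>2 ^ N * u\<rfloor>)"
        using cantor_center_in_ball[OF that, of u] by (simp add: cantor_ball_def dist_commute)
      also have "\<dots> \<le> snd B / 2 ^ N" by (rule cantor_radius_le)
      also have "\<dots> < e" using N B by (simp add: field_simps power_divide)
      finally show ?thesis .
    qed
    then show "\<exists>N. \<forall>n\<ge>N. dist (?X n) (?X N) < e" by blast
  qed
  then show ?thesis unfolding cantor_point_def by (simp add: Cauchy_convergent_iff convergent_LIMSEQ_iff)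
qed

lemma cantor_point_in_ball: "cantor_point B u \<in> cantor_ball B n \<lfloor>2 ^ n * u\<rfloor>"
proof (rule Lim_in_closed_set[OF _ _ _ cantor_point_tendsto])
  show "closed (cantor_ball B n \<lfloor>2 ^ n * u\<rfloor>)" by (simp add: cantor_ball_def)
  show "\<forall>\<^sub>F m in sequentially. fst (cantor_scheme B m \<lfloor>2 ^ m * u\<rfloor>) \<in> cantor_ball B n \<lfloor>2 ^ n * u\<rfloor>"
    unfolding eventually_sequentially using cantor_center_in_ball by blast
qed simp

lemma cantor_ball_gap_uniform:
  "\<exists>s>0. \<forall>i\<in>{0..<2 ^ n}. \<forall>i'\<in>{0..<2 ^ n}. i \<noteq> i' \<longrightarrow>
     (\<forall>x\<in>cantor_ball B n i. \<forall>y\<in>cantor_ball B n i'. s < dist x y)"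
proof -
  have "\<forall>\<^sub>F s in at_right (0::real). \<forall>i\<in>{0..<2 ^ n}. \<forall>i'\<in>{0..<2 ^ n}. i \<noteq> i' \<longrightarrow>
     (\<forall>x\<in>cantor_ball B n i. \<forall>y\<in>cantor_ball B n i'. s < dist x y)"
  proof (intro eventually_ball_finite ballI)
    fix i i' :: int assume i: "i \<in> {0..<2 ^ n}" "i' \<in> {0..<2 ^ n}"
    show "\<forall>\<^sub>F s in at_right 0. i \<noteq> i' \<longrightarrow> (\<forall>x\<in>cantor_ball B n i. \<forall>y\<in>cantor_ball B n i'. s < dist x y)"
    proof (cases "i = i'")
      case False
      obtain s where s: "s > 0" "\<forall>x\<in>cantor_ball B n i. \<forall>y\<in>cantor_ball B n i'. s < dist x y"
        using cantor_ball_gap[OF False i] by blast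
      show ?thesis using eventually_at_right_real[OF s(1)]
        by (rule eventually_mono) (use s(2) in fastforce)
    qed simp
  qed auto
  then have "\<forall>\<^sub>F s in at_right (0::real). s > 0 \<and> (\<forall>i\<in>{0..<2 ^ n}. \<forall>i'\<in>{0..<2 ^ n}. i \<noteq> i' \<longrightarrow>
     (\<forall>x\<in>cantor_ball B n i. \<forall>y\<in>cantor_ball B n i'. s < dist x y))"
    using eventually_at_right_less by (rule eventually_conj[rotated])
  then show ?thesis by (auto dest: eventually_happens)
qed

lemma measurable_cantor_point: "cantor_point B \<in> borel \<rightarrow>\<^sub>M borel"
proof (rule borel_measurable_LIMSEQ_metric[OF _ cantor_point_tendsto])
  fix n
  have "(\<lambda>u::real. \<lfloor>2 ^ n * u\<rfloor>) \<in> borel \<rightarrow>\<^sub>M count_space UNIV" by measurable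
  then show "(\<lambda>u::real. fst (cantor_scheme B n \<lfloor>2 ^ n * u\<rfloor>)) \<in> borel_measurable borel"
    by (rule measurable_compose) simp
qed

end

text \<open>The measure is the image of the uniform law under the Cantor coding. If all cells of
  level q are more than s apart, a ball of radius s / 2 meets the image of one dyadic interval only,
  whatever its centre, so it has mass at most 1 / 2^q.\<close>

lemma diffuse_measure_exists:
  fixes a :: "'a::{polish_space, perfect_space}"
  assumes "r > 0"
  shows "\<exists>\<nu>. prob_space \<nu> \<and> sets \<nu> = sets borel \<and> (AE x in \<nu>. dist x a \<le> r) \<and>
    (\<forall>q::nat. \<exists>s>0. \<forall>y. emeasure \<nu> (cball y s) \<le> ennreal (1 / 2 ^ q))"
proof -
  have B: "snd (a, r) > 0" using assms by simp
  define h where "h = cantor_point (a, r)"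
  define U where "U = uniform_measure lborel {0..<1::real}"
  interpret U: prob_space U unfolding U_def by (rule prob_space_uniform_measure) auto
  have sets_U: "sets U = sets borel" by (simp add: U_def)
  have h: "h \<in> U \<rightarrow>\<^sub>M borel"
    using measurable_cantor_point[OF B] measurable_cong_sets[OF sets_U refl] unfolding h_def by blast
  have "AE x in distr U borel h. dist x a \<le> r"
  proof (subst AE_distr_iff[OF h])
    have "{x. dist x a \<le> r} = cball a r" by (auto simp: dist_commute)
    then show "{x \<in> space borel. dist x a \<le> r} \<in> sets borel" by simp
    have "dist (h u) a \<le> r" for u
      using cantor_point_in_ball[OF B, of u 0] by (simp add: cantor_ball_def h_def dist_commute)
    then show "AE x in U. dist (h x) a \<le> r" by simp
  qed
  moreover have "\<exists>s>0. \<forall>y. emeasure (distr U borel h) (cball y s) \<le> ennreal (1 / 2 ^ q)" for q :: nat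
  proof -
    obtain s where s: "s > 0" "\<And>i i' x y. i \<in> {0..<2 ^ q} \<Longrightarrow> i' \<in> {0..<2 ^ q} \<Longrightarrow> i \<noteq> i' \<Longrightarrow>
       x \<in> cantor_ball (a, r) q i \<Longrightarrow> y \<in> cantor_ball (a, r) q i' \<Longrightarrow> s < dist x y"
      using cantor_ball_gap_uniform[OF B, of q] by blast
    have "emeasure (distr U borel h) (cball y (s / 2)) \<le> ennreal (1 / 2 ^ q)" for y
    proof -
      have "emeasure (distr U borel h) (cball y (s / 2)) = emeasure U (h -` cball y (s / 2))"
        using h by (simp add: emeasure_distr U_def)
      also have "\<dots> = emeasure lborel ({0..<1} \<inter> h -` cball y (s / 2))"
        using measurable_sets[OF h, of "cball y (s/2)"] sets_U by (simp add: U_def divide_ennreal_def)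
      also have "\<dots> \<le> ennreal (1 / 2 ^ q)"
      proof (cases "{0..<1} \<inter> h -` cball y (s / 2) = {}")
        case False
        then obtain u where u: "u \<in> {0..<1}" "h u \<in> cball y (s / 2)" by blast
        have range: "\<lfloor>2 ^ q * v\<rfloor> \<in> {0..<2 ^ q}" if "v \<in> {0..<1}" for v :: real
          using that by (simp add: floor_less_iff)
        define i where "i = \<lfloor>2 ^ q * u\<rfloor>"
        have "\<lfloor>2 ^ q * v\<rfloor> = i" if v: "v \<in> {0..<1}" "h v \<in> cball y (s / 2)" for v
        proof (rule ccontr)
          assume "\<lfloor>2 ^ q * v\<rfloor> \<noteq> i"
          then have "s < dist (h v) (h u)"
            using range[OF v(1)] range[OF u(1)] cantor_point_in_ball[OF B]
            by (intro s(2)[of "\<lfloor>2 ^ q * v\<rfloor>" "\<lfloor>2 ^ q * u\<rfloor>"]) (auto simp: i_def h_def)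
          then show False using v(2) u(2) dist_triangle3[of "h v" "h u" y] by simp
        qed
        then have "{0..<1} \<inter> h -` cball y (s / 2) \<subseteq> {v. \<lfloor>2 ^ q * v\<rfloor> = i}" by auto
        also have "\<dots> \<subseteq> {of_int i / 2 ^ q..(of_int i + 1) / 2 ^ q}"
          by (auto simp: floor_eq_iff field_simps)
        finally have "emeasure lborel ({0..<1} \<inter> h -` cball y (s / 2)) \<le>
            emeasure lborel {of_int i / 2 ^ q..(of_int i + 1) / 2 ^ q :: real}"
          by (intro emeasure_mono) auto
        also have "\<dots> = ennreal (1 / 2 ^ q)"
          by (subst emeasure_lborel_Icc) (auto simp: field_simps)
        finally show ?thesis .
      qed simp
      finally show ?thesis .
    qed
    then show ?thesis using s(1) by (intro exI[of _ "s / 2"]) auto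
  qed
  ultimately show ?thesis
    using U.prob_space_distr[OF h] by (intro exI[of _ "distr U borel h"]) auto
qed

section \<open>Laws of independent sequences\<close>

lemma closed_return_set: "closed {x :: 'a::metric_space biseq. dist ((full_shift ^^ n) x) x \<le> r}"
  by (intro closed_Collect_le continuous_intros continuous_on_biseqI)
    (simp_all add: coord_full_shift_funpow continuous_on_coord)

definition seq_measure :: "(int \<Rightarrow> 'a measure) \<Rightarrow> 'a::metric_space biseq measure" where
  "seq_measure \<kappa> = distr (PiM UNIV \<kappa>) borel Biseq"

context
  fixes \<kappa> :: "int \<Rightarrow> 'a::polish_space measure"
  assumes prob_\<kappa>: "\<And>i. prob_space (\<kappa> i)" and sets_\<kappa>: "\<And>i. sets (\<kappa> i) = sets borel"
begin

lemma sets_PiM_seq: "sets (PiM UNIV \<kappa>) = sets (PiM UNIV (\<lambda>_::int. borel :: 'a measure))"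
  using sets_\<kappa> by (intro sets_PiM_cong) auto

lemma measurable_Biseq_PiM: "Biseq \<in> PiM UNIV \<kappa> \<rightarrow>\<^sub>M borel"
  using measurable_Biseq measurable_cong_sets[OF sets_PiM_seq refl] by blast

lemma measurable_component: "(\<lambda>x. x i) \<in> PiM UNIV \<kappa> \<rightarrow>\<^sub>M borel"
  using measurable_component_singleton[of i UNIV \<kappa>] measurable_cong_sets[OF refl sets_\<kappa>] by blast

lemma space_PiM_seq: "space (PiM UNIV \<kappa>) = UNIV"
  using sets_eq_imp_space_eq[OF sets_\<kappa>] by (simp add: space_PiM)

lemma prob_space_seq_measure: "prob_space (seq_measure \<kappa>)"
  unfolding seq_measure_def
  by (intro prob_space.prob_space_distr prob_space_PiM prob_\<kappa> measurable_Biseq_PiM)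

lemma sets_seq_measure: "sets (seq_measure \<kappa>) = sets borel"
  by (simp add: seq_measure_def)

lemma AE_seq_measure_dist_le:
  assumes "\<And>i. AE y in \<kappa> i. dist y (z i) \<le> r"
  shows "AE x in seq_measure \<kappa>. \<forall>i. dist (coord x i) (z i) \<le> r"
  unfolding seq_measure_def
proof (subst AE_distr_iff[OF measurable_Biseq_PiM])
  have "closed {x. \<forall>i. dist (coord x i) (z i) \<le> r}"
    by (intro closed_Collect_all closed_Collect_le continuous_intros continuous_on_coord)
  then show "{x \<in> space borel. \<forall>i. dist (coord x i) (z i) \<le> r} \<in> sets borel" by simp
  have "AE x in PiM UNIV \<kappa>. dist (x i) (z i) \<le> r" for i
    by (rule AE_PiM_component[OF prob_\<kappa> _ assms]) simp
  then show "AE x in PiM UNIV \<kappa>. \<forall>i. dist (coord (Biseq x) i) (z i) \<le> r"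
    by (simp add: AE_all_countable Biseq_inverse)
qed

text \<open>The coordinate \<open>m\<close> is independent of everything that decides the event for smaller
  coordinates and of \<open>h m\<close>, so each coordinate contributes a factor \<open>c\<close>.\<close>

lemma emeasure_PiM_predictable_le:
  fixes h :: "nat \<Rightarrow> (int \<Rightarrow> 'a) \<Rightarrow> 'a"
  assumes c: "\<And>i y. emeasure (\<kappa> i) (cball y s) \<le> c"
    and h_meas: "\<And>k. h k \<in> PiM UNIV \<kappa> \<rightarrow>\<^sub>M borel"
    and h_past: "\<And>k j x y. int k \<le> j \<Longrightarrow> h k (x(j := y)) = h k x"
  shows "emeasure (PiM UNIV \<kappa>) {x. \<forall>k<m. dist (x (int k)) (h k x) \<le> s} \<le> c ^ m"
proof -
  interpret P: prob_space "PiM UNIV \<kappa>" by (rule prob_space_PiM[OF prob_\<kappa>])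
  define A where "A m = {x. \<forall>k<m. dist (x (int k)) (h k x) \<le> s}" for m
  have dist_meas: "(\<lambda>x. dist (x (int k)) (h k x)) \<in> borel_measurable (PiM UNIV \<kappa>)" for k
    by (rule borel_measurable_dist[OF measurable_component h_meas])
  have A_meas: "A m \<in> sets (PiM UNIV \<kappa>)" for m
  proof -
    have "{x \<in> space (PiM UNIV \<kappa>). \<forall>k\<in>{..<m}. dist (x (int k)) (h k x) \<le> s} \<in> sets (PiM UNIV \<kappa>)"
      by (intro sets.sets_Collect_finite_All borel_measurable_le dist_meas borel_measurable_const) auto
    then show ?thesis by (simp add: A_def space_PiM_seq Ball_def)
  qed
  have "emeasure (PiM UNIV \<kappa>) (A m) \<le> c ^ m"
  proof (induction m)
    case 0
    then show ?case using P.emeasure_space_1 by (simp add: A_def space_PiM_seq)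
  next
    case (Suc m)
    let ?K = "\<kappa> (int m)" and ?P = "PiM UNIV \<kappa>"
    interpret K: prob_space ?K by (rule prob_\<kappa>)
    interpret KP: pair_sigma_finite ?K ?P ..
    \<comment> \<open>Resampling coordinate \<open>m\<close> from its own law preserves the product
      measure. Fubini can then integrate over this coordinate with all others fixed.\<close>
    define f where "f = (\<lambda>(y, x :: int \<Rightarrow> 'a). x(int m := y))"
    have distr_f: "distr (?K \<Otimes>\<^sub>M ?P) ?P f = ?P"
      using distr_pair_PiM_eq_PiM[of UNIV \<kappa> "int m"] prob_\<kappa> by (simp add: f_def)
    have f_meas: "f \<in> ?K \<Otimes>\<^sub>M ?P \<rightarrow>\<^sub>M ?P"
      using measurable_add_dim[of "int m" UNIV \<kappa>] 
      unfolding f_def by (simp add: case_prod_beta) measurable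
    have pre: "f -` A (Suc m) \<inter> space (?K \<Otimes>\<^sub>M ?P) \<in> sets (?K \<Otimes>\<^sub>M ?P)"
      by (rule measurable_sets[OF f_meas A_meas])
    have "emeasure ?P (A (Suc m)) = emeasure (distr (?K \<Otimes>\<^sub>M ?P) ?P f) (A (Suc m))"
      by (simp add: distr_f)
    also have "\<dots> = emeasure (?K \<Otimes>\<^sub>M ?P) (f -` A (Suc m) \<inter> space (?K \<Otimes>\<^sub>M ?P))"
      by (rule emeasure_distr[OF f_meas A_meas])
    also have "\<dots> = (\<integral>\<^sup>+x. emeasure ?K ((\<lambda>y. (y, x)) -` (f -` A (Suc m) \<inter> space (?K \<Otimes>\<^sub>M ?P))) \<partial>?P)"
      by (rule KP.emeasure_pair_measure_alt2[OF pre])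
    also have "\<dots> \<le> (\<integral>\<^sup>+x. c * indicator (A m) x \<partial>?P)"
    proof (rule nn_integral_mono)
      fix x
      have "(\<lambda>y. (y, x)) -` (f -` A (Suc m) \<inter> space (?K \<Otimes>\<^sub>M ?P)) =
          (if x \<in> A m then cball (h m x) s else {})"
        using h_past sets_eq_imp_space_eq[OF sets_\<kappa>]
        by (auto simp: A_def f_def space_pair_measure space_PiM_seq less_Suc_eq dist_commute)
      then show "emeasure ?K ((\<lambda>y. (y, x)) -` (f -` A (Suc m) \<inter> space (?K \<Otimes>\<^sub>M ?P))) \<le> c * indicator (A m) x"
        using c by (simp add: indicator_def)
    qed
    also have "\<dots> = c * emeasure ?P (A m)"
      using A_meas by (simp add: nn_integral_cmult)
    also have "\<dots> \<le> c * c ^ m" by (intro mult_left_mono Suc.IH) simp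
    finally show ?case by simp
  qed
  then show ?thesis by (simp add: A_def)
qed

section \<open>Exponential bounds for balls and return sets\<close>

context
  fixes s :: real and c :: ennreal and e j :: nat
  assumes c: "\<And>i y. emeasure (\<kappa> i) (cball y s) \<le> c"
    and s: "s > 0" "1 / 2 ^ e \<le> s / (1 + s)" and j: "e \<le> j"
begin

text \<open>Control of coordinate \<open>k\<close> at scale \<open>s\<close> asks for 1 / 2^j \<le>
  s / (1 + s) / 2^k. The fixed loss of \<open>e\<close> binary digits pays for s / (1 + s), and the
  remaining j - e digits pay for one coordinate each.\<close>

lemma coord_dist_le_of_dyadic:
  assumes "dist x y \<le> 1 / 2 ^ j" "k < j - e"
  shows "dist (coord x (int k)) (coord y (int k)) \<le> s"
proof (rule biseq_coord_dist_le_of_dist_le[OF s(1)])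
  have "(2::real) ^ (k + e) \<le> 2 ^ j" using assms(2) j by (intro power_increasing) auto
  then have "1 / 2 ^ j \<le> 1 / 2 ^ e / (2::real) ^ k" by (simp add: field_simps power_add)
  also have "\<dots> \<le> s / (1 + s) / 2 ^ k" using s(2) by (intro divide_right_mono) auto
  finally show "dist x y \<le> s / (1 + s) / 2 ^ nat \<bar>int k\<bar>" using assms(1) by simp
qed

lemma emeasure_seq_measure_predictable_le:
  fixes h :: "nat \<Rightarrow> (int \<Rightarrow> 'a) \<Rightarrow> 'a"
  assumes R: "R \<in> sets borel"
    and R_sub: "\<And>x k. Biseq x \<in> R \<Longrightarrow> k < j - e \<Longrightarrow> dist (x (int k)) (h k x) \<le> s"
    and h_meas: "\<And>k. h k \<in> PiM UNIV \<kappa> \<rightarrow>\<^sub>M borel"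
    and h_past: "\<And>k j x y. int k \<le> j \<Longrightarrow> h k (x(j := y)) = h k x"
  shows "emeasure (seq_measure \<kappa>) R \<le> c ^ (j - e)"
proof -
  have "emeasure (seq_measure \<kappa>) R = emeasure (PiM UNIV \<kappa>) (Biseq -` R)"
    unfolding seq_measure_def using measurable_Biseq_PiM R by (simp add: emeasure_distr space_PiM_seq)
  also have "\<dots> \<le> emeasure (PiM UNIV \<kappa>) {x. \<forall>k<j - e. dist (x (int k)) (h k x) \<le> s}"
  proof (rule emeasure_mono)
    show "Biseq -` R \<subseteq> {x. \<forall>k<j - e. dist (x (int k)) (h k x) \<le> s}" using R_sub by auto
    have "{x \<in> space (PiM UNIV \<kappa>). \<forall>k\<in>{..<j - e}. dist (x (int k)) (h k x) \<le> s} \<in> sets (PiM UNIV \<kappa>)"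
      by (intro sets.sets_Collect_finite_All borel_measurable_le borel_measurable_const
          borel_measurable_dist measurable_component h_meas) auto
    then show "{x. \<forall>k<j - e. dist (x (int k)) (h k x) \<le> s} \<in> sets (PiM UNIV \<kappa>)"
      by (simp add: space_PiM_seq Ball_def)
  qed
  also have "\<dots> \<le> c ^ (j - e)" by (rule emeasure_PiM_predictable_le[OF c h_meas h_past])
  finally show ?thesis .
qed

lemma emeasure_seq_measure_cball_le: "emeasure (seq_measure \<kappa>) (cball z (1 / 2 ^ j)) \<le> c ^ (j - e)"
proof (rule emeasure_seq_measure_predictable_le[where h="\<lambda>k x. coord z (int k)"])
  fix x k assume "Biseq x \<in> cball z (1 / 2 ^ j)" "k < j - e"
  then show "dist (x (int k)) (coord z (int k)) \<le> s"
    using coord_dist_le_of_dyadic[of z "Biseq x" k] by (simp add: Biseq_inverse dist_commute)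
qed auto

text \<open>On the return set coordinate k is close to coordinate k - n, which belongs to its past
  since n \<ge> 1. The window of \<open>x\<close> and that of its shift may overlap and be
  dependent; revealing the coordinates in increasing order still gives one factor per
  coordinate.\<close>

lemma emeasure_seq_measure_return_le:
  assumes "n \<ge> 1"
  shows "emeasure (seq_measure \<kappa>) {x. dist ((full_shift ^^ n) x) x \<le> 1 / 2 ^ j} \<le> c ^ (j - e)"
proof (rule emeasure_seq_measure_predictable_le[where h="\<lambda>k x. x (int k - int n)"])
  fix x k assume "Biseq x \<in> {x. dist ((full_shift ^^ n) x) x \<le> 1 / 2 ^ j}" "k < j - e"
  then show "dist (x (int k)) (x (int k - int n)) \<le> s"
    using coord_dist_le_of_dyadic[of "(full_shift ^^ n) (Biseq x)" "Biseq x" k]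
    by (simp add: Biseq_inverse dist_commute coord_full_shift_funpow)
qed (use assms measurable_component closed_return_set in auto)

end

end

lemma distr_seq_measure_full_shift:
  fixes \<kappa> :: "int \<Rightarrow> 'a::polish_space measure"
  assumes "\<And>i. prob_space (\<kappa> i)" "\<And>i. sets (\<kappa> i) = sets borel"
  shows "distr (seq_measure \<kappa>) borel full_shift = seq_measure (\<lambda>i. \<kappa> (i - 1))"
proof -
  let ?P = "PiM UNIV \<kappa>" and ?P' = "PiM UNIV (\<lambda>i. \<kappa> (i - 1))"
  let ?g = "\<lambda>x (i::int). x (i - 1)"
  have reindex: "distr ?P ?P' ?g = ?P'"
    using distr_PiM_reindex[of UNIV \<kappa> "\<lambda>i. i - 1" UNIV] assms(1) by (simp add: inj_on_def restrict_def)
  have g: "?g \<in> ?P \<rightarrow>\<^sub>M ?P'"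
    by (rule measurable_PiM_single') (auto simp: space_PiM intro: measurable_component_singleton)
  note Bm = measurable_Biseq_PiM[OF assms]
  have Bm': "Biseq \<in> ?P' \<rightarrow>\<^sub>M borel"
    using measurable_Biseq_PiM[of "\<lambda>i. \<kappa> (i - 1)"] assms by blast
  have "distr (seq_measure \<kappa>) borel full_shift = distr ?P borel (full_shift \<circ> Biseq)"
    unfolding seq_measure_def by (rule distr_distr[OF measurable_full_shift Bm])
  also have "full_shift \<circ> Biseq = Biseq \<circ> ?g"
    by (auto simp: full_shift_def Biseq_inverse fun_eq_iff)
  also have "distr ?P borel (Biseq \<circ> ?g) = distr (distr ?P ?P' ?g) borel Biseq"
    by (rule distr_distr[OF Bm' g, symmetric])
  finally show ?thesis by (simp add: reindex seq_measure_def)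
qed

section \<open>Measures with superpolynomial decay\<close>

text \<open>At scale 1 / 2^j both quantities are O(1 / 2^(q j)) for every q, with an offset
  \<open>e\<close> that depends on \<open>q\<close> only. Uniformity in the centre serves pairs of
  points, and uniformity in \<open>n\<close> permits a union bound over exponentially many return
  times.\<close>

definition fast_decay :: "'a::metric_space biseq measure \<Rightarrow> bool" where
  "fast_decay \<mu> \<longleftrightarrow> (\<forall>q::nat. \<exists>e. \<forall>j\<ge>e.
     (\<forall>z. emeasure \<mu> (cball z (1 / 2 ^ j)) \<le> ennreal (1 / 2 ^ q) ^ (j - e)) \<and>
     (\<forall>n\<ge>1. emeasure \<mu> {x. dist ((full_shift ^^ n) x) x \<le> 1 / 2 ^ j} \<le> ennreal (1 / 2 ^ q) ^ (j - e)))"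

text \<open>The scale \<open>s\<close> has to serve all components and all coordinates at once; the
  bounds on the components then pass to their average.\<close>

lemma fast_decay_mixture:
  fixes \<kappa> :: "'i \<Rightarrow> int \<Rightarrow> 'a::polish_space measure"
  assumes "\<And>i t. prob_space (\<kappa> i t)" "\<And>i t. sets (\<kappa> i t) = sets borel"
    and diffuse: "\<And>q::nat. \<exists>s>0. \<forall>i t y. emeasure (\<kappa> i t) (cball y s) \<le> ennreal (1 / 2 ^ q)"
  shows "fast_decay (mixture p (\<lambda>i. seq_measure (\<kappa> i)))"
  unfolding fast_decay_def
proof
  fix q :: nat
  obtain s where s: "s > 0" "\<And>i t y. emeasure (\<kappa> i t) (cball y s) \<le> ennreal (1 / 2 ^ q)"
    using diffuse by blast
  have "s / (1 + s) > 0" using s(1) by simp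
  then obtain e where e: "(1 / 2) ^ e < s / (1 + s)" using real_arch_pow_inv[of _ "1/2"] by auto
  then have e': "1 / 2 ^ e \<le> s / (1 + s)" by (simp add: power_divide)
  note mix = emeasure_mixture[OF prob_space_seq_measure[OF assms(1,2)] sets_seq_measure[OF assms(1,2)]]
  have bound: "(\<integral>\<^sup>+i. emeasure (seq_measure (\<kappa> i)) A \<partial>p) \<le> c"
    if "\<And>i. emeasure (seq_measure (\<kappa> i)) A \<le> c" for A c
  proof -
    have "(\<integral>\<^sup>+i. emeasure (seq_measure (\<kappa> i)) A \<partial>p) \<le> (\<integral>\<^sup>+i. c \<partial>p)"
      using that by (intro nn_integral_mono) auto
    then show ?thesis by simp
  qed
  show "\<exists>e. \<forall>j\<ge>e. (\<forall>z. emeasure (mixture p (\<lambda>i. seq_measure (\<kappa> i))) (cball z (1 / 2 ^ j)) \<le> ennreal (1 / 2 ^ q) ^ (j - e)) \<and>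
     (\<forall>n\<ge>1. emeasure (mixture p (\<lambda>i. seq_measure (\<kappa> i))) {x. dist ((full_shift ^^ n) x) x \<le> 1 / 2 ^ j} \<le> ennreal (1 / 2 ^ q) ^ (j - e))"
  proof (intro exI[of _ e] allI impI conjI)
    fix j z assume "j \<ge> e"
    then have "emeasure (seq_measure (\<kappa> i)) (cball z (1 / 2 ^ j)) \<le> ennreal (1 / 2 ^ q) ^ (j - e)" for i
      by (intro emeasure_seq_measure_cball_le[where s=s] assms s e')
    then show "emeasure (mixture p (\<lambda>i. seq_measure (\<kappa> i))) (cball z (1 / 2 ^ j)) \<le> ennreal (1 / 2 ^ q) ^ (j - e)"
      by (subst mix) (auto intro: bound)
  next
    fix j n :: nat assume "j \<ge> e" "n \<ge> 1"
    then have "emeasure (seq_measure (\<kappa> i)) {x. dist ((full_shift ^^ n) x) x \<le> 1 / 2 ^ j} \<le> ennreal (1 / 2 ^ q) ^ (j - e)" for i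
      by (intro emeasure_seq_measure_return_le[where s=s] assms s e')
    then show "emeasure (mixture p (\<lambda>i. seq_measure (\<kappa> i))) {x. dist ((full_shift ^^ n) x) x \<le> 1 / 2 ^ j} \<le> ennreal (1 / 2 ^ q) ^ (j - e)"
      by (subst mix) (auto intro: bound borel_closed closed_return_set)
  qed
qed

text \<open>Half of the error goes to the periodic approximation, half to spreading each letter over
  a set of radius \<open>d\<close>. The product measures are carried into each other cyclically by
  the shift, and averaging over the phases restores invariance.\<close>

theorem fast_decay_approx:
  fixes \<mu> :: "'a::{polish_space, perfect_space} biseq measure"
  assumes \<mu>: "\<mu> \<in> invariant_measures full_shift"
    and F: "finite F" "\<And>f. f \<in> F \<Longrightarrow> bounded_lipschitz f" and "e > 0"
  shows "\<exists>\<nu>\<in>{\<nu> \<in> invariant_measures full_shift. fast_decay \<nu>}.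
    \<forall>f\<in>F. \<bar>(\<integral>x. f x \<partial>\<nu>) - (\<integral>x. f x \<partial>\<mu>)\<bar> < e"
proof -
  obtain P b where P: "P > 0" and b: "\<And>f. f \<in> F \<Longrightarrow> \<bar>(\<integral>x. f x \<partial>cyclic_measure P b) - (\<integral>x. f x \<partial>\<mu>)\<bar> < e / 2"
    using cyclic_measure_approx[OF \<mu> F, of "e / 2"] \<open>e > 0\<close> by auto
  obtain C where C: "C > 0" "\<And>f x. f \<in> F \<Longrightarrow> \<bar>f x\<bar> \<le> C"
      "\<And>f x y. f \<in> F \<Longrightarrow> \<bar>f x - f y\<bar> \<le> C * dist x y"
    using bounded_lipschitz_uniform[OF F] by metis
  have meas: "f \<in> borel_measurable borel" and bdd: "bounded (range f)" if "f \<in> F" for f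
    using F(2)[OF that] bounded_lipschitz_continuous by (auto simp: bounded_lipschitz_def intro: borel_measurable_continuous_onI)
  have "e / (2 * C) > 0" using C(1) \<open>e > 0\<close> by simp
  then obtain k d where k: "d > 0" "\<And>x y :: 'a biseq.
      (\<forall>n\<in>{-int k..int k}. dist (coord x n) (coord y n) \<le> d) \<Longrightarrow> dist x y < e / (2 * C)"
    using biseq_dist_uniform by metis
  have "\<forall>m. \<exists>\<nu>. prob_space \<nu> \<and> sets \<nu> = sets borel \<and> (AE x in \<nu>. dist x (b m) \<le> d) \<and>
    (\<forall>q::nat. \<exists>s>0. \<forall>y. emeasure \<nu> (cball y s) \<le> ennreal (1 / 2 ^ q))"
    using diffuse_measure_exists[OF k(1)] by blast
  from choice[OF this] obtain N where N': "\<forall>m. prob_space (N m) \<and> sets (N m) = sets borel \<and>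
      (AE x in N m. dist x (b m) \<le> d) \<and> (\<forall>q::nat. \<exists>s>0. \<forall>y. emeasure (N m) (cball y s) \<le> ennreal (1 / 2 ^ q))"
    by blast
  then have N: "prob_space (N m)" "sets (N m) = sets borel" "AE x in N m. dist x (b m) \<le> d"
      "\<exists>s>0. \<forall>y. emeasure (N m) (cball y s) \<le> ennreal (1 / 2 ^ q)" for m and q :: nat
    by blast+
  \<comment> \<open>Coordinates congruent modulo \<open>P\<close> share a law but are sampled
    independently; repeating one sample would produce periodic points again.\<close>
  define \<kappa> where "\<kappa> j t = N (nat ((int j - t) mod int P))" for j t
  define K where "K j = seq_measure (\<kappa> j)" for j
  define \<nu> where "\<nu> = mixture (pmf_of_set {..<P}) K"
  have \<kappa>: "prob_space (\<kappa> j t)" "sets (\<kappa> j t) = sets borel" for j t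
    using N by (simp_all add: \<kappa>_def)
  have K: "prob_space (K j)" "sets (K j) = sets borel" for j
    unfolding K_def using \<kappa> by (simp_all add: prob_space_seq_measure sets_seq_measure)
  have "distr (K j) borel full_shift = K (Suc j)" for j
  proof -
    have "(\<lambda>t. \<kappa> j (t - 1)) = \<kappa> (Suc j)" by (auto simp: \<kappa>_def fun_eq_iff algebra_simps)
    then show ?thesis unfolding K_def by (simp add: distr_seq_measure_full_shift[OF \<kappa>])
  qed
  moreover have "\<kappa> P = \<kappa> 0" by (auto simp: \<kappa>_def fun_eq_iff)
  then have "K P = K 0" by (simp add: K_def)
  ultimately have inv: "\<nu> \<in> invariant_measures full_shift"
    unfolding \<nu>_def using K P by (intro cyclic_mixture_invariant) auto
  have decay: "fast_decay \<nu>"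
    unfolding \<nu>_def K_def
  proof (rule fast_decay_mixture[OF \<kappa>])
    fix q :: nat
    from N(4)[of _ q] obtain s where s: "\<And>m. s m > 0" "\<And>m y. emeasure (N m) (cball y (s m)) \<le> ennreal (1 / 2 ^ q)"
      by metis
    \<comment> \<open>Only \<open>P\<close> different letter laws occur, so the smallest of their
      scales serves all coordinates.\<close>
    define s' where "s' = Min (s ` {..<P})"
    have "s' > 0" using s(1) P by (auto simp: s'_def Min_gr_iff lessThan_empty_iff)
    moreover have "emeasure (\<kappa> j t) (cball y s') \<le> ennreal (1 / 2 ^ q)" for j t y
    proof -
      let ?m = "nat ((int j - t) mod int P)"
      have "?m < P" using P by (simp add: nat_less_iff)
      then have "s' \<le> s ?m" by (auto simp: s'_def)
      then have "emeasure (N ?m) (cball y s') \<le> emeasure (N ?m) (cball y (s ?m))"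
        using N(2) by (intro emeasure_mono subset_cball) auto
      then show ?thesis using s(2)[of ?m y] unfolding \<kappa>_def by (rule order_trans)
    qed
    ultimately show "\<exists>s>0. \<forall>i t y. emeasure (\<kappa> i t) (cball y s) \<le> ennreal (1 / 2 ^ q)" by blast
  qed
  have "\<bar>(\<integral>x. f x \<partial>\<nu>) - (\<integral>x. f x \<partial>\<mu>)\<bar> < e" if f: "f \<in> F" for f
  proof -
    have Kj: "\<bar>(\<integral>x. f x \<partial>K j) - f (cyclic_seq P b j)\<bar> \<le> e / 2" for j
    proof -
      interpret Kj: prob_space "K j" by (rule K)
      have "AE x in K j. \<forall>i. dist (coord x i) (coord (cyclic_seq P b j) i) \<le> d"
        unfolding K_def
      proof (rule AE_seq_measure_dist_le[OF \<kappa>])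
        show "AE y in \<kappa> j i. dist y (coord (cyclic_seq P b j) i) \<le> d" for i
          unfolding \<kappa>_def coord_cyclic_seq by (rule N(3))
      qed
      then have AE: "AE x in K j. \<bar>f x - f (cyclic_seq P b j)\<bar> \<le> e / 2"
      proof (rule AE_mp[OF _ AE_I2], intro impI)
        fix x assume "\<forall>i. dist (coord x i) (coord (cyclic_seq P b j) i) \<le> d"
        then have "dist x (cyclic_seq P b j) < e / (2 * C)" using k(2) by blast
        then have "C * dist x (cyclic_seq P b j) \<le> C * (e / (2 * C))" using C(1) by (intro mult_left_mono) auto
        then show "\<bar>f x - f (cyclic_seq P b j)\<bar> \<le> e / 2"
          using C(1) C(3)[OF f, of x "cyclic_seq P b j"] by simp
      qed
      have int: "integrable (K j) f" by (rule integrable_bounded_borel[OF K meas[OF f] bdd[OF f]])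
      have "AE x in K j. f (cyclic_seq P b j) - e / 2 \<le> f x" using AE by eventually_elim linarith
      note lower = Kj.integral_ge_const[OF int this]
      have "AE x in K j. f x \<le> f (cyclic_seq P b j) + e / 2" using AE by eventually_elim linarith
      note upper = Kj.integral_le_const[OF int this]
      show ?thesis using lower upper by linarith
    qed
    have "(\<integral>x. f x \<partial>\<nu>) = (\<Sum>j<P. \<integral>x. f x \<partial>K j) / P"
      unfolding \<nu>_def using P K meas[OF f] bdd[OF f]
      by (subst integral_mixture) (auto simp: integral_pmf_of_set lessThan_empty_iff)
    then have eq: "(\<integral>x. f x \<partial>\<nu>) - (\<integral>x. f x \<partial>cyclic_measure P b) =
        (\<Sum>j<P. (\<integral>x. f x \<partial>K j) - f (cyclic_seq P b j)) / P"
      using integral_cyclic_measure[OF P meas[OF f] bdd[OF f]] by (simp add: sum_subtractf diff_divide_distrib)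
    have "\<bar>\<Sum>j<P. (\<integral>x. f x \<partial>K j) - f (cyclic_seq P b j)\<bar> \<le> (\<Sum>j<P. e / 2)"
      by (rule order_trans[OF sum_abs]) (intro sum_mono Kj)
    then have "\<bar>(\<integral>x. f x \<partial>\<nu>) - (\<integral>x. f x \<partial>cyclic_measure P b)\<bar> \<le> e / 2"
      using P unfolding eq by (simp add: abs_div pos_divide_le_eq mult.commute)
    then show ?thesis using b[OF f] by linarith
  qed
  then show ?thesis using inv decay by blast
qed

section \<open>Dimensions of measures\<close>

lemma lower_dim_le_upper_dim:
  assumes "prob_space \<mu>" "sets \<mu> = sets borel"
  shows "lower_dim D \<mu> \<le> upper_dim D \<mu>"
proof -
  interpret prob_space \<mu> by fact
  have "emeasure \<mu> E > 0" if "E \<in> sets borel" "emeasure \<mu> (- E) = 0" for E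
  proof (rule ccontr)
    assume "\<not> emeasure \<mu> E > 0"
    then have "E \<in> null_sets \<mu>" "- E \<in> null_sets \<mu>"
      using that assms(2) by (auto simp: null_sets_def borel_comp)
    then have "emeasure \<mu> (E \<union> - E) = 0" using null_sets.Un by blast
    then show False using emeasure_space_1 sets_eq_imp_space_eq[OF assms(2)] by simp
  qed
  then show ?thesis unfolding lower_dim_def upper_dim_def by (intro Inf_superset_mono) blast
qed

lemma ereal_Inf_lessE:
  fixes P :: "real \<Rightarrow> bool"
  assumes "Inf {ereal \<alpha> | \<alpha>. P \<alpha>} < c"
  obtains \<alpha> where "P \<alpha>" "ereal \<alpha> < c"
  using assms unfolding Inf_less_iff by blast

section \<open>Hausdorff dimension and open covers\<close>

lemma hausdorff_dim_nonneg: "hausdorff_dim E \<ge> 0"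
  unfolding hausdorff_dim_def by (rule Inf_greatest) auto

lemma diameter_leI:
  fixes A :: "'x::metric_space set"
  assumes "\<And>x y. x \<in> A \<Longrightarrow> y \<in> A \<Longrightarrow> dist x y \<le> d" "d \<ge> 0"
  shows "diameter A \<le> d"
  using assms unfolding diameter_def by (auto intro!: cSUP_least)

text \<open>A vanishing supremum forces the premeasure at scale 1 to vanish. Diameters at most 1
  allow the exponent to be raised later without increasing the sum.\<close>

lemma hausdorff_measure_eq_0D:
  assumes "hausdorff_measure \<alpha> E = 0" "e > 0"
  shows "\<exists>C. E \<subseteq> (\<Union>k::nat. C k) \<and> (\<forall>k. bounded (C k) \<and> diameter (C k) \<le> 1) \<and>
    (\<Sum>k. ennreal (diameter (C k) powr \<alpha>)) < e"
proof -
  have "hausdorff_premeasure 1 \<alpha> E \<le> (SUP \<delta>\<in>{0<..}. hausdorff_premeasure \<delta> \<alpha> E)"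
    by (rule SUP_upper) simp
  then have "hausdorff_premeasure 1 \<alpha> E < e"
    using assms by (simp add: hausdorff_measure_eq_SUP)
  then show ?thesis unfolding hausdorff_premeasure_def Inf_less_iff by auto
qed

text \<open>A small sum forces small diameters, so the constraint on the diameters is immaterial.\<close>

lemma hausdorff_measure_eq_0I:
  fixes E :: "'x::metric_space set"
  assumes "\<alpha> > 0"
    and "\<And>e::real. e > 0 \<Longrightarrow> \<exists>C. E \<subseteq> (\<Union>k::nat. C k) \<and> (\<forall>k. bounded (C k)) \<and>
      (\<Sum>k. ennreal (diameter (C k) powr \<alpha>)) < ennreal e"
  shows "hausdorff_measure \<alpha> E = 0"
proof -
  have "hausdorff_premeasure \<delta> \<alpha> E \<le> 0" if "\<delta> > 0" for \<delta>
  proof (rule ennreal_le_epsilon)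
    fix e :: real assume "e > 0"
    then have "min e (\<delta> powr \<alpha>) > 0" using that by simp
    from assms(2)[OF this] obtain C where C: "E \<subseteq> (\<Union>k. C k)" "\<And>k. bounded (C k)"
      "(\<Sum>k. ennreal (diameter (C k) powr \<alpha>)) < ennreal (min e (\<delta> powr \<alpha>))" by blast
    have "diameter (C k) \<le> \<delta>" for k
    proof (rule ccontr)
      assume "\<not> diameter (C k) \<le> \<delta>"
      then have "\<delta> powr \<alpha> \<le> diameter (C k) powr \<alpha>"
        using that assms(1) by (intro powr_mono2) auto
      then have "ennreal (min e (\<delta> powr \<alpha>)) \<le> ennreal (diameter (C k) powr \<alpha>)"
        by (intro ennreal_leI) simp
      also have "\<dots> = sum (\<lambda>k. ennreal (diameter (C k) powr \<alpha>)) {k}" by simp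
      also have "\<dots> \<le> (\<Sum>k. ennreal (diameter (C k) powr \<alpha>))"
        by (rule sum_le_suminf) auto
      finally show False using C(3) by simp
    qed
    then have "hausdorff_premeasure \<delta> \<alpha> E \<le> (\<Sum>k. ennreal (diameter (C k) powr \<alpha>))"
      unfolding hausdorff_premeasure_def using C by (intro Inf_lower) blast
    also have "\<dots> \<le> ennreal e"
      using C(3) by (meson ennreal_leI less_imp_le min.cobounded1 order_trans)
    finally show "hausdorff_premeasure \<delta> \<alpha> E \<le> 0 + ennreal e" by simp
  qed
  then have "(SUP \<delta>\<in>{0<..}. hausdorff_premeasure \<delta> \<alpha> E) \<le> 0" by (intro SUP_least) auto
  then show ?thesis by (simp add: hausdorff_measure_eq_SUP)
qed

text \<open>The s-neighbourhood of \<open>A\<close> exceeds its diameter by at most 2 s, and t powr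
  \<alpha> is continuous on t \<ge> 0, also at 0, because \<alpha> > 0.\<close>

lemma open_enlargement:
  fixes A :: "'x::metric_space set"
  assumes "bounded A" "\<alpha> > 0" "e > 0"
  shows "\<exists>U. open U \<and> bounded U \<and> A \<subseteq> U \<and> diameter U powr \<alpha> < diameter A powr \<alpha> + e"
proof -
  have d0: "diameter A \<ge> 0" using diameter_ge_0[OF assms(1)] .
  have "((\<lambda>s. (diameter A + 2 * s) powr \<alpha>) \<longlongrightarrow> (diameter A + 2 * 0) powr \<alpha>) (at_right 0)"
    using assms(2) d0
    by (intro tendsto_powr' tendsto_intros) (auto simp: eventually_at_filter)
  then have "\<forall>\<^sub>F s in at_right 0. (diameter A + 2 * s) powr \<alpha> < diameter A powr \<alpha> + e"
    using assms(3) by (intro order_tendstoD) auto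
  then have "\<forall>\<^sub>F s in at_right 0. s > 0 \<and> (diameter A + 2 * s) powr \<alpha> < diameter A powr \<alpha> + e"
    using eventually_at_right_less by (rule eventually_conj[rotated])
  then obtain s where s: "s > 0" "(diameter A + 2 * s) powr \<alpha> < diameter A powr \<alpha> + e"
    by (auto dest: eventually_happens)
  define U where "U = (\<Union>x\<in>A. ball x s)"
  have dist_U: "dist x y \<le> diameter A + 2 * s" if xy: "x \<in> U" "y \<in> U" for x y
  proof -
    obtain x' y' where "x' \<in> A" "x \<in> ball x' s" "y' \<in> A" "y \<in> ball y' s" using xy unfolding U_def by blast
    then have "x' \<in> A" "dist x' x < s" "y' \<in> A" "dist y' y < s" by simp_all
    moreover have "dist x y \<le> dist x' x + dist x' y' + dist y' y"
      using dist_triangle[of x y x'] dist_triangle[of x' y y'] by (simp add: dist_commute)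
    ultimately show ?thesis using diameter_bounded_bound[OF assms(1), of x' y'] by simp
  qed
  have "bounded U"
  proof (cases "U = {}")
    case False
    then obtain x where "x \<in> U" by blast
    then show ?thesis using dist_U unfolding bounded_def by blast
  qed simp
  have "diameter U \<le> diameter A + 2 * s" using dist_U d0 s(1) by (intro diameter_leI) auto
  then have "diameter U powr \<alpha> \<le> (diameter A + 2 * s) powr \<alpha>"
    using diameter_ge_0[OF \<open>bounded U\<close>] assms(2) by (intro powr_mono2) auto
  moreover have "open U" "A \<subseteq> U" using s(1) by (auto simp: U_def)
  ultimately show ?thesis using s(2) \<open>bounded U\<close> by (intro exI[of _ U]) auto
qed

text \<open>Finitely many open sets are used because asking for their union to have mass above a
  bound is an open condition on the measure. Such a union covers almost all of the mass instead of a
  whole set.\<close>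

definition small_open_cover :: "real \<Rightarrow> real \<Rightarrow> nat \<Rightarrow> (nat \<Rightarrow> 'x::metric_space set) \<Rightarrow> bool" where
  "small_open_cover \<alpha> e N U \<longleftrightarrow> (\<forall>i. open (U i) \<and> bounded (U i)) \<and> (\<Sum>i<N. diameter (U i) powr \<alpha>) < e"

lemma sum_geometric_le: "(\<Sum>i<N. e / 2 ^ (i + 2)) \<le> (e::real) / 2" if "e \<ge> 0"
proof -
  have "(\<Sum>i<N. e / 2 ^ (i + 2)) = e / 2 - e / 2 ^ (N + 1)"
    by (induction N) (auto simp: field_simps)
  then show ?thesis using that by simp
qed

definition thin_along_subsequence :: "'x::metric_space measure \<Rightarrow> bool" where
  "thin_along_subsequence \<mu> \<longleftrightarrow>
     (\<forall>a J::nat. AE x in \<mu>. \<exists>j\<ge>J. measure \<mu> (cball x (1 / 2 ^ j)) < (1 / 2) ^ (j * a))"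

context borel_prob_family
begin

lemma openin_small_open_cover:
  "openin W {\<mu> \<in> S. \<exists>N U. small_open_cover \<alpha> e N U \<and> measure \<mu> (\<Union>i<N. U i) > a}"
proof -
  have "{\<mu> \<in> S. \<exists>N U. small_open_cover \<alpha> e N U \<and> measure \<mu> (\<Union>i<N. U i) > a} =
      (\<Union>(N, U)\<in>{(N, U). small_open_cover \<alpha> e N U}. {\<mu> \<in> S. measure \<mu> (\<Union>i<N. U i) > a})"
    by auto
  moreover have "openin W \<dots>"
    by (intro openin_Union) (auto simp: small_open_cover_def intro!: openin_measure_gt open_UN)
  ultimately show ?thesis by simp
qed

text \<open>The sets of a cover of cost below e / 2 are enlarged to open sets with a further budget
  of e / 2^(k + 2) each; by continuity from below a finite number of them already has mass above
  \<open>a\<close>.\<close>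

lemma hausdorff_null_imp_small_open_cover:
  assumes \<mu>: "\<mu> \<in> S" and E: "E \<in> sets borel" "emeasure \<mu> (- E) = 0"
    and \<alpha>: "hausdorff_measure \<alpha> E = 0" "0 < \<alpha>" "\<alpha> \<le> \<beta>" and "e > 0" "a < 1"
  shows "\<exists>N U. small_open_cover \<beta> e N U \<and> measure \<mu> (\<Union>i<N. U i) > a"
proof -
  interpret prob_space \<mu> using \<mu> prob by blast
  have "0 < ennreal (e / 2)" using \<open>e > 0\<close> by simp
  from hausdorff_measure_eq_0D[OF \<alpha>(1) this] obtain C where C': "E \<subseteq> (\<Union>k::nat. C k)"
      "\<forall>k. bounded (C k) \<and> diameter (C k) \<le> 1"
      "(\<Sum>k. ennreal (diameter (C k) powr \<alpha>)) < ennreal (e / 2)"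
    by (elim exE conjE)
  then have C: "E \<subseteq> (\<Union>k::nat. C k)" "bounded (C k)" "diameter (C k) \<le> 1"
      "(\<Sum>k. ennreal (diameter (C k) powr \<alpha>)) < ennreal (e / 2)" for k
    by blast+
  have "\<forall>k. \<exists>U. open U \<and> bounded U \<and> C k \<subseteq> U \<and> diameter U powr \<beta> < diameter (C k) powr \<beta> + e / 2 ^ (k + 2)"
    using open_enlargement[OF C(2), of \<beta>] \<alpha> \<open>e > 0\<close> by simp
  from choice[OF this] obtain U where U: "\<And>k. open (U k)" "\<And>k. bounded (U k)" "\<And>k. C k \<subseteq> U k"
      "\<And>k. diameter (U k) powr \<beta> < diameter (C k) powr \<beta> + e / 2 ^ (k + 2)" by blast
  have cover: "small_open_cover \<beta> e N U" for N
    unfolding small_open_cover_def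
  proof (intro conjI)
    have "ennreal (\<Sum>k<N. diameter (C k) powr \<alpha>) = (\<Sum>k<N. ennreal (diameter (C k) powr \<alpha>))"
      by (rule sum_ennreal[symmetric]) simp
    also have "\<dots> \<le> (\<Sum>k. ennreal (diameter (C k) powr \<alpha>))" by (rule sum_le_suminf) auto
    also note C(4)
    finally have *: "(\<Sum>k<N. diameter (C k) powr \<alpha>) < e / 2"
      by (subst (asm) ennreal_less_iff) (auto intro: sum_nonneg)
    have "(\<Sum>k<N. diameter (U k) powr \<beta>) \<le> (\<Sum>k<N. diameter (C k) powr \<alpha> + e / 2 ^ (k + 2))"
    proof (rule sum_mono)
      fix k
      have "diameter (C k) powr \<beta> \<le> diameter (C k) powr \<alpha>"
        using C(2,3) \<alpha> by (intro powr_mono' diameter_ge_0) auto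
      then show "diameter (U k) powr \<beta> \<le> diameter (C k) powr \<alpha> + e / 2 ^ (k + 2)" using U(4)[of k] by simp
    qed
    also have "\<dots> \<le> (\<Sum>k<N. diameter (C k) powr \<alpha>) + e / 2"
      using sum_geometric_le[of e N] \<open>e > 0\<close> by (simp add: sum.distrib)
    also have "\<dots> < e" using * by simp
    finally show "(\<Sum>k<N. diameter (U k) powr \<beta>) < e" .
  qed (use U in auto)
  have "(\<lambda>N. measure \<mu> (\<Union>i<N. U i)) \<longlonglongrightarrow> measure \<mu> (\<Union>N. \<Union>i<N. U i)"
  proof (rule finite_Lim_measure_incseq)
    show "range (\<lambda>N. \<Union>i<N. U i) \<subseteq> sets \<mu>" using U(1) sets_borel[OF \<mu>] by auto
    show "incseq (\<lambda>N. \<Union>i<N. U i)" unfolding incseq_def by (intro allI impI UN_mono) auto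
  qed
  also have "(\<Union>N. \<Union>i<N. U i) = (\<Union>i. U i)" by auto
  also have "measure \<mu> (\<Union>i. U i) = 1"
  proof -
    have "- E \<in> null_sets \<mu>" using E sets_borel[OF \<mu>] by (auto simp: null_sets_def borel_comp)
    then have AE_E: "AE x in \<mu>. x \<in> E" using AE_not_in[of "- E" \<mu>] by simp
    have "(\<Union>k. C k) \<subseteq> (\<Union>i. U i)" by (rule UN_mono[OF order_refl U(3)])
    with C(1) have "E \<subseteq> (\<Union>i. U i)" by (rule order_trans)
    from AE_E have "AE x in \<mu>. x \<in> (\<Union>i. U i)"
      by (rule eventually_mono) (rule subsetD[OF \<open>E \<subseteq> (\<Union>i. U i)\<close>])
    moreover have "(\<Union>i. U i) \<in> sets \<mu>" using U(1) sets_borel[OF \<mu>] by auto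
    ultimately show ?thesis using prob_eq_1 by blast
  qed
  finally have "\<forall>\<^sub>F N in sequentially. a < measure \<mu> (\<Union>i<N. U i)"
    using \<open>a < 1\<close> by (rule order_tendstoD)
  then show ?thesis using cover unfolding eventually_sequentially by blast
qed

text \<open>\<open>E\<close> is the limsup of the finite unions \<open>V m\<close>. Their masses
  tend to 1, so each tail union has full measure, while the tail from k on covers \<open>E\<close>
  at cost at most the sum of 1 / 2^(k + m).\<close>

lemma small_open_covers_imp_hausdorff_null:
  assumes \<mu>: "\<mu> \<in> S" and "\<alpha> > 0"
    and cov: "\<And>m. \<exists>N U. small_open_cover \<alpha> (1 / 2 ^ m) N U \<and> measure \<mu> (\<Union>i<N. U i) > 1 - 1 / 2 ^ m"
  shows "\<exists>E\<in>sets borel. emeasure \<mu> (- E) = 0 \<and> hausdorff_measure \<alpha> E = 0"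
proof -
  interpret prob_space \<mu> using \<mu> prob by blast
  from cov obtain N U where U: "\<And>m. small_open_cover \<alpha> (1 / 2 ^ m) (N m) (U m)"
      "\<And>m. measure \<mu> (\<Union>i<N m. U m i) > 1 - 1 / 2 ^ m" by metis
  have U_open: "open (U m i)" "bounded (U m i)" for m i using U(1) by (auto simp: small_open_cover_def)
  define V where "V m = (\<Union>i<N m. U m i)" for m
  have V_open: "open (V m)" for m unfolding V_def using U_open by auto
  define E where "E = (\<Inter>k. \<Union>m. V (k + m))"
  have E_borel: "E \<in> sets borel" unfolding E_def using V_open by auto
  have "AE x in \<mu>. x \<in> (\<Union>m. V (k + m))" for k
  proof -
    have meas: "(\<Union>m. V (k + m)) \<in> sets \<mu>" using V_open sets_borel[OF \<mu>] by auto
    have "1 - 1 / 2 ^ m \<le> measure \<mu> (\<Union>m. V (k + m))" for m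
    proof -
      have "1 - 1 / 2 ^ m \<le> 1 - 1 / (2::real) ^ (k + m)"
        by (simp add: power_increasing frac_le)
      also have "\<dots> \<le> measure \<mu> (V (k + m))" using U(2)[of "k + m"] by (simp add: V_def)
      also have "\<dots> \<le> measure \<mu> (\<Union>m. V (k + m))" using meas by (intro finite_measure_mono) auto
      finally show ?thesis .
    qed
    moreover have "(\<lambda>m. 1 - (1/2) ^ m :: real) \<longlonglongrightarrow> 1 - 0"
      by (intro tendsto_intros LIMSEQ_realpow_zero) auto
    ultimately have "1 \<le> measure \<mu> (\<Union>m. V (k + m))"
      by (intro LIMSEQ_le_const2[of "\<lambda>m. 1 - (1/2) ^ m :: real"]) (auto simp: power_divide)
    then show ?thesis using prob_eq_1[OF meas] prob_le_1 by (metis antisym)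
  qed
  then have "AE x in \<mu>. x \<in> E" unfolding E_def by (simp add: AE_all_countable)
  then have "AE x in \<mu>. x \<notin> - E" by simp
  then have "emeasure \<mu> (- E) = 0"
    using E_borel sets_borel[OF \<mu>] AE_iff_null_sets[of "- E" \<mu>] by (auto simp: borel_comp)
  moreover have "hausdorff_measure \<alpha> E = 0"
  proof (rule hausdorff_measure_eq_0I[OF \<open>\<alpha> > 0\<close>])
    fix e :: real assume "e > 0"
    \<comment> \<open>The tail from \<open>k\<close> on costs at most 2 / 2^k.\<close>
    then obtain k where k: "(1/2) ^ k < e / 2" using real_arch_pow_inv[of "e/2" "1/2"] by auto
    \<comment> \<open>A double sequence, padded with empty sets of cost 0, which
      \<open>prod_decode\<close> turns into a sequence.\<close>
    define f where "f = (\<lambda>(m, i). if i < N (k + m) then U (k + m) i else {})"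
    define C where "C n = f (prod_decode n)" for n
    have f_eq: "f (m, i) = (if i < N (k + m) then U (k + m) i else {})" for m i by (simp add: f_def)
    have "E \<subseteq> (\<Union>m. V (k + m))" by (auto simp: E_def)
    also have "\<dots> \<subseteq> (\<Union>n. C n)"
    proof
      fix x assume "x \<in> (\<Union>m. V (k + m))"
      then obtain m i where "i < N (k + m)" "x \<in> U (k + m) i" by (auto simp: V_def)
      then have "x \<in> C (prod_encode (m, i))" by (simp add: C_def f_eq)
      then show "x \<in> (\<Union>n. C n)" by blast
    qed
    finally have "E \<subseteq> (\<Union>n. C n)" .
    moreover have "bounded (C n)" for n
      unfolding C_def using U_open by (cases "prod_decode n") (auto simp: f_eq)
    moreover have "(\<Sum>n. ennreal (diameter (C n) powr \<alpha>)) < ennreal e"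
    proof -
      have row: "(\<Sum>i. ennreal (diameter (f (m, i)) powr \<alpha>)) \<le> ennreal (1 / 2 ^ k * (1 / 2) ^ m)" for m
      proof -
        have "(\<Sum>i. ennreal (diameter (f (m, i)) powr \<alpha>)) = (\<Sum>i<N (k + m). ennreal (diameter (f (m, i)) powr \<alpha>))"
          by (rule suminf_finite) (auto simp: f_eq)
        also have "\<dots> = (\<Sum>i<N (k + m). ennreal (diameter (U (k + m) i) powr \<alpha>))"
          by (intro sum.cong) (auto simp: f_eq)
        also have "\<dots> = ennreal (\<Sum>i<N (k + m). diameter (U (k + m) i) powr \<alpha>)"
          by (rule sum_ennreal) simp
        also have "\<dots> \<le> ennreal (1 / 2 ^ (k + m))"
          using U(1)[of "k + m"] by (intro ennreal_leI) (simp add: small_open_cover_def)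
        also have "1 / 2 ^ (k + m) = (1 / 2 ^ k * (1 / 2) ^ m :: real)" by (simp add: power_add power_divide)
        finally show ?thesis .
      qed
      have "(\<Sum>n. ennreal (diameter (C n) powr \<alpha>)) = (\<Sum>m. \<Sum>i. ennreal (diameter (f (m, i)) powr \<alpha>))"
        unfolding C_def by (rule suminf_ennreal_2dimen) simp
      also have "\<dots> \<le> (\<Sum>m. ennreal (1 / 2 ^ k * (1 / 2) ^ m))"
        by (intro suminf_le row) auto
      also have "\<dots> = ennreal (1 / 2 ^ k * 2)"
        by (intro suminf_ennreal_eq sums_mult) (use geometric_sums[of "1/2::real"] in auto)
      also have "\<dots> < ennreal e" using k \<open>e > 0\<close> by (intro ennreal_lessI) (auto simp: power_divide)
      finally show ?thesis .
    qed
    ultimately show "\<exists>C. E \<subseteq> (\<Union>k::nat. C k) \<and> (\<forall>k. bounded (C k)) \<and>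
      (\<Sum>k. ennreal (diameter (C k) powr \<alpha>)) < ennreal e" by blast
  qed
  ultimately show ?thesis using E_borel by blast
qed

text \<open>The set of full measure may vary with \<open>n\<close>, because the upper dimension is
  an infimum over such sets; the lower dimension is squeezed between 0 and the upper one.\<close>

lemma has_hausdorff_dim_0I:
  assumes "\<mu> \<in> S" and "\<And>n::nat. \<exists>E\<in>sets borel. emeasure \<mu> (- E) = 0 \<and> hausdorff_measure (1 / real (Suc n)) E = 0"
  shows "has_dim hausdorff_dim \<mu> 0"
proof -
  have "upper_dim hausdorff_dim \<mu> \<le> 0"
  proof (rule ccontr)
    assume "\<not> upper_dim hausdorff_dim \<mu> \<le> 0"
    then obtain r where r: "0 < ereal r" "ereal r < upper_dim hausdorff_dim \<mu>"
      using ereal_dense2[of 0 "upper_dim hausdorff_dim \<mu>"] by (auto simp: not_le)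
    then obtain n where n: "1 / real (Suc n) < r"
      using reals_Archimedean[of r] by (auto simp: inverse_eq_divide)
    obtain E where E: "E \<in> sets borel" "emeasure \<mu> (- E) = 0" "hausdorff_measure (1 / real (Suc n)) E = 0"
      using assms(2) by blast
    have "upper_dim hausdorff_dim \<mu> \<le> hausdorff_dim E"
      unfolding upper_dim_def using E by (intro Inf_lower) blast
    also have "\<dots> \<le> ereal (1 / real (Suc n))"
      unfolding hausdorff_dim_def using E(3) by (intro Inf_lower CollectI exI[of _ "1 / real (Suc n)"]) auto
    also have "\<dots> < ereal r" using n by simp
    finally show False using r(2) by simp
  qed
  moreover have "0 \<le> lower_dim hausdorff_dim \<mu>"
    unfolding lower_dim_def by (rule Inf_greatest) (auto simp: hausdorff_dim_nonneg)
  moreover note lower_dim_le_upper_dim[OF prob[OF assms(1)] sets_borel[OF assms(1)], of hausdorff_dim]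
  ultimately show ?thesis unfolding has_dim_def by (meson antisym order_trans)
qed

text \<open>Being of dimension 0 means having, for each exponent 1 / (n + 1), a set of full measure
  that is null for it. Covers of small cost 1 / 2^m and mass above 1 - 1 / 2^m translate this into
  countably many open conditions.\<close>

lemma gdelta_in_hausdorff_dim_0: "gdelta_in W {\<mu> \<in> S. has_dim hausdorff_dim \<mu> 0}"
proof -
  define G where "G n m = {\<mu> \<in> S. \<exists>N U. small_open_cover (1 / real (Suc n)) (1 / 2 ^ m) N U \<and>
    measure \<mu> (\<Union>i<N. U i) > 1 - 1 / 2 ^ m}" for n m :: nat
  have "{\<mu> \<in> S. has_dim hausdorff_dim \<mu> 0} = (\<Inter>n. \<Inter>m. G n m)"
  proof (intro set_eqI iffI)
    fix \<mu> assume \<mu>: "\<mu> \<in> {\<mu> \<in> S. has_dim hausdorff_dim \<mu> 0}"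
    have "\<mu> \<in> G n m" for n m
    proof -
      have "upper_dim hausdorff_dim \<mu> < ereal (1 / real (Suc n))" using \<mu> by (simp add: has_dim_def)
      then obtain E where E: "E \<in> sets borel" "emeasure \<mu> (- E) = 0" "hausdorff_dim E < ereal (1 / real (Suc n))"
        unfolding upper_dim_def Inf_less_iff by blast
      then obtain \<alpha> where "\<alpha> > 0 \<and> hausdorff_measure \<alpha> E = 0" "\<alpha> < 1 / real (Suc n)"
        unfolding hausdorff_dim_def by (elim ereal_Inf_lessE) simp
      then show ?thesis
        unfolding G_def using \<mu> E by (auto intro!: hausdorff_null_imp_small_open_cover[of \<mu> E \<alpha>])
    qed
    then show "\<mu> \<in> (\<Inter>n. \<Inter>m. G n m)" by blast
  next
    fix \<mu> assume \<mu>: "\<mu> \<in> (\<Inter>n. \<Inter>m. G n m)"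
    then have "\<mu> \<in> S" by (auto simp: G_def)
    moreover have "\<exists>E\<in>sets borel. emeasure \<mu> (- E) = 0 \<and> hausdorff_measure (1 / real (Suc n)) E = 0" for n
      using \<mu> by (intro small_open_covers_imp_hausdorff_null \<open>\<mu> \<in> S\<close>) (auto simp: G_def)
    ultimately show "\<mu> \<in> {\<mu> \<in> S. has_dim hausdorff_dim \<mu> 0}" using has_hausdorff_dim_0I by blast
  qed
  then show ?thesis
    unfolding G_def by (simp only:) (intro gdelta_in_INT_nat open_imp_gdelta_in openin_small_open_cover)
qed

text \<open>The closed balls of radius r + 1 / (n + 1) decrease to \<open>cball x r\<close>, so a
  strict bound survives for some larger radius. That ball contains \<open>cball y r\<close> for all
  y near x, and the mass of a closed set is upper semicontinuous.\<close>

lemma measure_cball_less_open: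
  assumes \<mu>: "\<mu> \<in> S" and "measure \<mu> (cball x r) < c"
  shows "\<exists>U V. open U \<and> x \<in> U \<and> openin W V \<and> \<mu> \<in> V \<and> (\<forall>y\<in>U. \<forall>\<nu>\<in>V. measure \<nu> (cball y r) < c)"
proof -
  interpret prob_space \<mu> using \<mu> prob by blast
  have "(\<lambda>n. measure \<mu> (cball x (r + 1 / real (Suc n)))) \<longlonglongrightarrow> measure \<mu> (\<Inter>n. cball x (r + 1 / real (Suc n)))"
  proof (rule finite_Lim_measure_decseq)
    show "range (\<lambda>n. cball x (r + 1 / real (Suc n))) \<subseteq> sets \<mu>"
      by (intro image_subsetI) (simp add: sets_borel[OF \<mu>])
    show "decseq (\<lambda>n. cball x (r + 1 / real (Suc n)))"
      unfolding decseq_def by (intro allI impI subset_cball) (simp add: frac_le)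
  qed
  also have "(\<Inter>n. cball x (r + 1 / real (Suc n))) = cball x r"
  proof (intro set_eqI iffI)
    fix y assume y: "y \<in> (\<Inter>n. cball x (r + 1 / real (Suc n)))"
    have "(\<lambda>n. r + 1 / real (Suc n)) \<longlonglongrightarrow> r + 0"
      by (intro tendsto_intros LIMSEQ_Suc[OF lim_1_over_n])
    moreover have "dist x y \<le> r + 1 / real (Suc n)" for n using y by auto
    ultimately have "dist x y \<le> r + 0" by (intro LIMSEQ_le_const) auto
    then show "y \<in> cball x r" by simp
  next
    fix y assume "y \<in> cball x r"
    then show "y \<in> (\<Inter>n. cball x (r + 1 / real (Suc n)))" by (auto intro: add_increasing2)
  qed
  finally have "\<forall>\<^sub>F n in sequentially. measure \<mu> (cball x (r + 1 / real (Suc n))) < c"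
    using assms(2) by (rule order_tendstoD)
  then obtain n where n: "measure \<mu> (cball x (r + 1 / real (Suc n))) < c"
    unfolding eventually_sequentially by blast
  define s where "s = 1 / real (Suc n)"
  define V where "V = {\<nu> \<in> S. measure \<nu> (cball x (r + s)) < c}"
  have "measure \<nu> (cball y r) < c" if "y \<in> ball x s" "\<nu> \<in> V" for y \<nu>
  proof -
    have "\<nu> \<in> S" using that by (simp add: V_def)
    interpret \<nu>: prob_space \<nu> using \<open>\<nu> \<in> S\<close> prob by blast
    have "cball y r \<subseteq> cball x (r + s)"
    proof
      fix z assume "z \<in> cball y r"
      then show "z \<in> cball x (r + s)" using that(1) dist_triangle[of x z y] by simp
    qed
    then have "measure \<nu> (cball y r) \<le> measure \<nu> (cball x (r + s))"
      using sets_borel[OF \<open>\<nu> \<in> S\<close>] by (intro \<nu>.finite_measure_mono) auto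
    then show ?thesis using that(2) by (simp add: V_def)
  qed
  moreover have "openin W V" unfolding V_def by (rule openin_measure_lt) simp
  moreover have "\<mu> \<in> V" using \<mu> n by (simp add: V_def s_def)
  moreover have "x \<in> ball x s" by (simp add: s_def)
  ultimately show ?thesis by (intro exI[of _ "ball x s"] exI[of _ V]) simp
qed

lemma thin_rectangle:
  assumes "\<mu> \<in> S" "\<exists>j\<ge>J. measure \<mu> (cball x (1 / 2 ^ j)) < (1 / 2) ^ (j * a)"
  shows "\<exists>U V. open U \<and> x \<in> U \<and> openin W V \<and> \<mu> \<in> V \<and>
    (\<forall>y\<in>U. \<forall>\<nu>\<in>V. \<exists>j\<ge>J. measure \<nu> (cball y (1 / 2 ^ j)) < (1 / 2) ^ (j * a))"
proof -
  obtain j where "j \<ge> J" "measure \<mu> (cball x (1 / 2 ^ j)) < (1 / 2) ^ (j * a)" using assms(2) by blast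
  from measure_cball_less_open[OF assms(1) this(2)] obtain U V where
    "open U" "x \<in> U" "openin W V" "\<mu> \<in> V" "\<forall>y\<in>U. \<forall>\<nu>\<in>V. measure \<nu> (cball y (1 / 2 ^ j)) < (1 / 2) ^ (j * a)"
    by blast
  then show ?thesis using \<open>j \<ge> J\<close> by (intro exI[of _ U] exI[of _ V]) auto
qed

lemma gdelta_in_thin: "gdelta_in W {\<mu> \<in> S. thin_along_subsequence \<mu>}"
proof -
  have "{\<mu> \<in> S. thin_along_subsequence \<mu>} =
    (\<Inter>a. \<Inter>J. {\<mu> \<in> S. AE x in \<mu>. \<exists>j\<ge>J. measure \<mu> (cball x (1 / 2 ^ j)) < (1 / 2) ^ (j * a)})"
    by (auto simp: thin_along_subsequence_def)
  also have "gdelta_in W \<dots>"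
    by (intro gdelta_in_INT_nat gdelta_in_AE_section thin_rectangle)
  finally show ?thesis .
qed

end

section \<open>Packing dimension and the mass of small balls\<close>

lemma packing_measure_eq_0I:
  assumes "packing_premeasure_0 \<alpha> E = 0"
  shows "packing_measure \<alpha> E = 0"
proof -
  have "packing_measure \<alpha> E \<le> (\<Sum>k::nat. packing_premeasure_0 \<alpha> E)"
    unfolding packing_measure_def by (intro Inf_lower CollectI exI[of _ "\<lambda>_. E"]) auto
  then show ?thesis using assms by simp
qed

lemma half_power_eq_powr: "(1 / 2) ^ n = (2::real) powr (- real n)"
  by (simp add: powr_minus powr_realpow inverse_eq_divide power_one_over)

lemma dyadic_between:
  fixes r :: real
  assumes "0 < r" "r \<le> 1"
  shows "\<exists>j::nat. 1 / 2 ^ j \<le> r \<and> r < 2 / 2 ^ j"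
proof -
  obtain n where "(1/2) ^ n < r" using real_arch_pow_inv[OF assms(1), of "1/2"] by auto
  then have ex: "1 / 2 ^ n \<le> r" by (simp add: power_divide)
  define j where "j = (LEAST j. 1 / 2 ^ j \<le> r)"
  have j: "1 / 2 ^ j \<le> r" unfolding j_def using ex by (rule LeastI)
  moreover have "r < 2 / 2 ^ j"
  proof (cases j)
    case 0
    then show ?thesis using assms(2) by simp
  next
    case (Suc i)
    then have "\<not> 1 / 2 ^ i \<le> r" using not_less_Least[of i "\<lambda>j. 1 / 2 ^ j \<le> r"] unfolding j_def by simp
    then show ?thesis using Suc by simp
  qed
  ultimately show ?thesis by blast
qed

text \<open>The balls of a packing are disjoint, so their masses add up to at most 1.\<close>

lemma packing_dim_le_of_measure_cball_ge:
  fixes \<mu> :: "'x::metric_space measure"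
  assumes \<mu>: "prob_space \<mu>" "sets \<mu> = sets borel"
    and lower: "\<And>x j. x \<in> E \<Longrightarrow> j \<ge> J \<Longrightarrow> (1 / 2) ^ (j * a) \<le> measure \<mu> (cball x (1 / 2 ^ j))"
  shows "packing_dim E \<le> ereal (real (Suc a))"
proof -
  interpret prob_space \<mu> by fact
  \<comment> \<open>The exponent is one larger than the rate of the mass bound. The spare factor 2 r
    \<le> \<delta> drives the premeasure to 0, and passing from r to the next smaller dyadic radius
    costs the factor 4^a.\<close>
  have pre: "packing_premeasure \<delta> (real (Suc a)) E \<le> ennreal (\<delta> * 4 ^ a)"
    if \<delta>: "0 < \<delta>" "\<delta> < 1" "\<delta> < 1 / 2 ^ J" for \<delta>
    unfolding packing_premeasure_def
  proof (rule Sup_least, safe)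
    fix C assume C: "is_packing \<delta> E C"
    have "(\<Sum>\<^sub>\<infinity>(x, r)\<in>C. ennreal ((2 * r) powr real (Suc a))) =
        (SUP F\<in>{F. finite F \<and> F \<subseteq> C}. \<Sum>(x, r)\<in>F. ennreal ((2 * r) powr real (Suc a)))"
      by (rule nonneg_infsum_complete) auto
    also have "\<dots> \<le> ennreal (\<delta> * 4 ^ a)"
    proof (rule SUP_least, safe)
      fix F assume F: "finite F" "F \<subseteq> C"
      have term_le: "(2 * r) powr real (Suc a) \<le> \<delta> * 4 ^ a * measure \<mu> (cball x r)" if "(x, r) \<in> F" for x r
      proof -
        have xr: "x \<in> E" "0 < r" "r \<le> \<delta> / 2" using C F that by (auto simp: is_packing_def)
        then have "r \<le> 1" using \<delta> by simp
        then obtain j where j: "1 / 2 ^ j \<le> r" "r < 2 / 2 ^ j" using dyadic_between xr(2) by blast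
        have "J \<le> j"
        proof (rule ccontr)
          assume "\<not> J \<le> j"
          then have "1 / 2 ^ J \<le> 1 / (2::real) ^ j" by (simp add: frac_le power_increasing)
          also have "\<dots> \<le> \<delta> / 2" using j xr by simp
          finally show False using \<delta> by simp
        qed
        have "(2 * r) ^ a \<le> (4 / 2 ^ j) ^ a" using j xr by (intro power_mono) auto
        also have "\<dots> = 4 ^ a * (1 / 2) ^ (j * a)" by (simp add: power_divide power_mult)
        also have "\<dots> \<le> 4 ^ a * measure \<mu> (cball x (1 / 2 ^ j))"
          by (intro mult_left_mono lower xr \<open>J \<le> j\<close>) auto
        also have "\<dots> \<le> 4 ^ a * measure \<mu> (cball x r)"
          using j(1) \<mu>(2) by (intro mult_left_mono finite_measure_mono subset_cball) auto
        finally have "(2 * r) ^ a \<le> 4 ^ a * measure \<mu> (cball x r)" .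
        then have "(2 * r) * (2 * r) ^ a \<le> \<delta> * (4 ^ a * measure \<mu> (cball x r))"
          using xr by (intro mult_mono) auto
        then show ?thesis using xr(2) by (simp add: powr_realpow[of "2 * r" "Suc a"] del: of_nat_Suc)
      qed
      have disj: "disjoint_family_on (\<lambda>p. cball (fst p) (snd p)) F"
        using C F disjoint_family_on_mono[OF F(2)] unfolding is_packing_def case_prod_beta' by blast
      have "(\<Sum>(x, r)\<in>F. ennreal ((2 * r) powr real (Suc a))) = ennreal (\<Sum>(x, r)\<in>F. (2 * r) powr real (Suc a))"
        unfolding case_prod_beta by (rule sum_ennreal) simp
      also have "(\<Sum>(x, r)\<in>F. (2 * r) powr real (Suc a)) \<le> (\<Sum>(x, r)\<in>F. \<delta> * 4 ^ a * measure \<mu> (cball x r))"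
        by (rule sum_mono) (use term_le in auto)
      also have "\<dots> = \<delta> * 4 ^ a * (\<Sum>p\<in>F. measure \<mu> (cball (fst p) (snd p)))"
        unfolding case_prod_beta' by (rule sum_distrib_left[symmetric])
      also have "(\<Sum>p\<in>F. measure \<mu> (cball (fst p) (snd p))) = measure \<mu> (\<Union>p\<in>F. cball (fst p) (snd p))"
        by (rule finite_measure_finite_Union[symmetric, OF F(1) _ disj]) (intro image_subsetI, simp add: \<mu>(2))
      also have "\<delta> * 4 ^ a * measure \<mu> (\<Union>p\<in>F. cball (fst p) (snd p)) \<le> \<delta> * 4 ^ a * 1"
        using \<delta> by (intro mult_left_mono prob_le_1) auto
      finally show "(\<Sum>(x, r)\<in>F. ennreal ((2 * r) powr real (Suc a))) \<le> ennreal (\<delta> * 4 ^ a)"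
        by (simp add: ennreal_leI)
    qed
    finally show "(\<Sum>\<^sub>\<infinity>(x, r)\<in>C. ennreal ((2 * r) powr real (Suc a))) \<le> ennreal (\<delta> * 4 ^ a)" .
  qed
  have "packing_premeasure_0 (real (Suc a)) E \<le> 0"
  proof (rule ennreal_le_epsilon)
    fix e :: real assume "e > 0"
    define \<delta> where "\<delta> = min (1 / 2) (min (1 / 2 ^ Suc J) (e / 4 ^ a))"
    have \<delta>: "0 < \<delta>" "\<delta> < 1" "\<delta> < 1 / 2 ^ J" "\<delta> \<le> e / 4 ^ a"
    proof -
      show "0 < \<delta>" "\<delta> < 1" "\<delta> \<le> e / 4 ^ a" using \<open>e > 0\<close> by (auto simp: \<delta>_def)
      have "\<delta> \<le> 1 / 2 ^ Suc J" by (simp add: \<delta>_def)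
      also have "\<dots> < 1 / 2 ^ J" by (simp add: field_simps)
      finally show "\<delta> < 1 / 2 ^ J" .
    qed
    have "packing_premeasure_0 (real (Suc a)) E \<le> packing_premeasure \<delta> (real (Suc a)) E"
      unfolding packing_premeasure_0_eq_INF using \<delta> by (intro INF_lower) auto
    also have "\<dots> \<le> ennreal (\<delta> * 4 ^ a)" by (rule pre[OF \<delta>(1-3)])
    also have "\<dots> \<le> ennreal e" using \<delta>(4) by (intro ennreal_leI) (simp add: field_simps)
    finally show "packing_premeasure_0 (real (Suc a)) E \<le> 0 + ennreal e" by simp
  qed
  then have "packing_measure (real (Suc a)) E = 0" by (intro packing_measure_eq_0I) simp
  then show ?thesis
    unfolding packing_dim_def by (intro Inf_lower CollectI exI[of _ "real (Suc a)"]) auto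
qed

text \<open>A separated set of maximal cardinality is a net, since a point that it misses could be
  added. The assumed bound on cardinalities guarantees that a maximum exists.\<close>

lemma finite_net:
  fixes A :: "'x::metric_space set"
  assumes "r \<ge> 0"
    and "\<And>D. finite D \<Longrightarrow> D \<subseteq> A \<Longrightarrow> (\<And>x y. x \<in> D \<Longrightarrow> y \<in> D \<Longrightarrow> x \<noteq> y \<Longrightarrow> r < dist x y) \<Longrightarrow> real (card D) \<le> N"
  shows "\<exists>D. finite D \<and> D \<subseteq> A \<and> A \<subseteq> (\<Union>x\<in>D. cball x r) \<and> real (card D) \<le> N"
proof -
  define P where "P D \<longleftrightarrow> finite D \<and> D \<subseteq> A \<and> (\<forall>x\<in>D. \<forall>y\<in>D. x \<noteq> y \<longrightarrow> r < dist x y)" for D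
  have P_card: "real (card D) \<le> N" if "P D" for D using that assms(2)[of D] by (auto simp: P_def)
  obtain b :: nat where b: "N < real b" using reals_Archimedean2 by blast
  have "P {}" by (simp add: P_def)
  moreover have "\<forall>D. P D \<longrightarrow> card D < b" using P_card b by fastforce
  ultimately obtain D where D: "P D" "\<And>D'. P D' \<Longrightarrow> card D' \<le> card D"
    using ex_has_greatest_nat[of P "{}" card b] by blast
  have "A \<subseteq> (\<Union>x\<in>D. cball x r)"
  proof (rule subsetI, rule ccontr)
    fix y assume y: "y \<in> A" "y \<notin> (\<Union>x\<in>D. cball x r)"
    then have "\<And>x. x \<in> D \<Longrightarrow> r < dist x y" by auto
    then have "P (insert y D)" using y(1) D(1) by (auto simp: P_def dist_commute)
    moreover have "y \<notin> D" using y(2) assms(1) by auto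
    then have "card (insert y D) = Suc (card D)" using D(1) by (simp add: P_def)
    ultimately show False using D(2)[of "insert y D"] by simp
  qed
  then show ?thesis using D(1) P_card by (auto simp: P_def)
qed

text \<open>Around r-separated points the balls of radius r / 3 are disjoint and form a packing, so
  the cardinality times (2 r / 3) powr \<alpha> stays below 1.\<close>

lemma packing_net:
  fixes E :: "'x::metric_space set"
  assumes pre: "packing_premeasure \<delta> \<alpha> E < 1" and r: "0 < r" "2 * r / 3 \<le> \<delta>" and "A \<subseteq> E"
  shows "\<exists>D. finite D \<and> D \<subseteq> A \<and> A \<subseteq> (\<Union>x\<in>D. cball x r) \<and> real (card D) \<le> (3 / (2 * r)) powr \<alpha>"
proof (rule finite_net)
  show "r \<ge> 0" using r by simp
  fix D assume D: "finite D" "D \<subseteq> A" "\<And>x y. x \<in> D \<Longrightarrow> y \<in> D \<Longrightarrow> x \<noteq> y \<Longrightarrow> r < dist x y"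
  define C where "C = (\<lambda>x. (x, r / 3)) ` D"
  have "finite C" using D by (simp add: C_def)
  have card: "card C = card D" unfolding C_def by (rule card_image) (simp add: inj_on_def)
  have "disjoint_family_on (\<lambda>(x, r). cball x r) C"
    unfolding disjoint_family_on_def
  proof (intro ballI impI)
    fix p p' assume p: "p \<in> C" "p' \<in> C" "p \<noteq> p'"
    then obtain x y where xy: "p = (x, r / 3)" "p' = (y, r / 3)" "x \<in> D" "y \<in> D" "x \<noteq> y" by (auto simp: C_def)
    then have "r < dist x y" using D(3) by blast
    have "False" if "z \<in> cball x (r / 3)" "z \<in> cball y (r / 3)" for z
      using that \<open>r < dist x y\<close> dist_triangle2[of x y z] r(1) by simp
    then show "(case p of (x, r) \<Rightarrow> cball x r) \<inter> (case p' of (x, r) \<Rightarrow> cball x r) = {}" using xy by auto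
  qed
  moreover have "countable C" using \<open>finite C\<close> by (rule countable_finite)
  ultimately have "is_packing \<delta> E C"
    using D(2) \<open>A \<subseteq> E\<close> r by (auto simp: is_packing_def C_def)
  then have "(\<Sum>\<^sub>\<infinity>(x, r)\<in>C. ennreal ((2 * r) powr \<alpha>)) \<le> packing_premeasure \<delta> \<alpha> E"
    unfolding packing_premeasure_def by (intro Sup_upper) blast
  also have "(\<Sum>\<^sub>\<infinity>(x, r)\<in>C. ennreal ((2 * r) powr \<alpha>)) = (\<Sum>(x, r)\<in>C. ennreal ((2 * r) powr \<alpha>))"
    using \<open>finite C\<close> by simp
  also have "\<dots> = (\<Sum>p\<in>C. ennreal ((2 * (r / 3)) powr \<alpha>))"
    by (rule sum.cong) (auto simp: C_def)
  also have "\<dots> = ennreal (real (card D) * (2 * r / 3) powr \<alpha>)"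
    using card by (simp add: ennreal_mult ennreal_of_nat_eq_real_of_nat)
  finally have "ennreal (real (card D) * (2 * r / 3) powr \<alpha>) < 1" using pre by (rule le_less_trans)
  then have "real (card D) * (2 * r / 3) powr \<alpha> < 1" by (simp add: ennreal_less_one_iff)
  moreover have "(3 / (2 * r)) powr \<alpha> = 1 / (2 * r / 3) powr \<alpha>"
    using r by (simp add: powr_divide)
  ultimately show "real (card D) \<le> (3 / (2 * r)) powr \<alpha>"
    using r by (simp add: pos_le_divide_eq)
qed


context borel_prob_family
begin

text \<open>A piece of a cover with packing premeasure less than 1 meets \<open>G j\<close> in a set with few separated
  points, that is, in a set covered by few balls of tiny mass; by Borel-Cantelli almost no point of
  the piece lies in infinitely many \<open>G j\<close>.\<close>

lemma thin_imp_has_packing_dim_infinity: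
  assumes \<mu>: "\<mu> \<in> S" and thin: "thin_along_subsequence \<mu>"
  shows "has_dim packing_dim \<mu> \<infinity>"
proof -
  interpret prob_space \<mu> using \<mu> prob by blast
  have null: "emeasure \<mu> E = 0" if E: "E \<in> sets borel" and \<alpha>: "\<alpha> > 0" "packing_measure \<alpha> E = 0" for E \<alpha>
  proof -
    have "packing_measure \<alpha> E < 1" using \<alpha> by simp
    then obtain C where C: "E \<subseteq> (\<Union>k::nat. C k)" "(\<Sum>k. packing_premeasure_0 \<alpha> (C k)) < 1"
      unfolding packing_measure_def Inf_less_iff by blast
    \<comment> \<open>At scale 1 / 2^j about 2^(j \<alpha>) balls are used, each of mass below 1 /
      2^(j a); this choice leaves a total of order 1 / 2^j, which is summable.\<close>
    obtain a :: nat where a: "\<alpha> + 1 \<le> real a" using real_arch_simple by blast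
    define G where "G j = {x. measure \<mu> (cball x (1 / 2 ^ j)) < (1 / 2) ^ (j * a)}" for j
    have AE_k: "AE x in \<mu>. x \<in> C k \<longrightarrow> (\<forall>\<^sub>F j in sequentially. x \<notin> G j)" for k
    proof -
      have "packing_premeasure_0 \<alpha> (C k) = sum (\<lambda>k. packing_premeasure_0 \<alpha> (C k)) {k}" by simp
      also have "\<dots> \<le> (\<Sum>k. packing_premeasure_0 \<alpha> (C k))" by (rule sum_le_suminf) auto
      finally have "packing_premeasure_0 \<alpha> (C k) < 1" using C(2) by (rule le_less_trans)
      then obtain \<delta> where \<delta>: "0 < \<delta>" "packing_premeasure \<delta> \<alpha> (C k) < 1"
        unfolding packing_premeasure_0_eq_INF INF_less_iff by auto
      obtain J where J: "(1/2) ^ J < \<delta>" using real_arch_pow_inv[OF \<delta>(1), of "1/2"] by auto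
      have "\<exists>D. finite D \<and> (j \<ge> J \<longrightarrow> C k \<inter> G j \<subseteq> (\<Union>x\<in>D. cball x (1 / 2 ^ j))) \<and> D \<subseteq> G j \<and>
          real (card D) \<le> (3 / (2 * (1 / 2 ^ j))) powr \<alpha>" for j
      proof (cases "j \<ge> J")
        case True
        have "2 * (1 / 2 ^ j) / 3 \<le> (1 / (2::real) ^ j)" by (simp add: field_simps)
        also have "\<dots> \<le> 1 / 2 ^ J" using True by (simp add: frac_le power_increasing)
        also have "\<dots> \<le> \<delta>" using J by (simp add: power_divide)
        finally show ?thesis
          using packing_net[OF \<delta>(2), of "1 / 2 ^ j" "C k \<inter> G j"] by (simp, blast)
      next
        case False
        then show ?thesis by (intro exI[of _ "{}"]) simp
      qed
      then obtain D where D: "\<And>j. finite (D j)" "\<And>j. D j \<subseteq> G j"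
          "\<And>j. j \<ge> J \<Longrightarrow> C k \<inter> G j \<subseteq> (\<Union>x\<in>D j. cball x (1 / 2 ^ j))"
          "\<And>j. real (card (D j)) \<le> (3 / (2 * (1 / 2 ^ j))) powr \<alpha>" by metis
      define U where "U j = (\<Union>x\<in>D j. cball x (1 / 2 ^ j))" for j
      have U_meas: "U j \<in> sets \<mu>" for j
        unfolding U_def using D(1) sets_borel[OF \<mu>] by (intro sets.finite_UN) auto
      have U_bound: "measure \<mu> (U j) \<le> (3 / 2) powr \<alpha> * (1 / 2) ^ j" for j
      proof -
        have "measure \<mu> (U j) \<le> (\<Sum>x\<in>D j. measure \<mu> (cball x (1 / 2 ^ j)))"
          unfolding U_def using D(1) sets_borel[OF \<mu>] by (intro finite_measure_subadditive_finite) auto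
        also have "\<dots> \<le> (\<Sum>x\<in>D j. (1 / 2) ^ (j * a))"
          using D(2)[of j] by (intro sum_mono) (auto simp: G_def intro: less_imp_le)
        also have "\<dots> = real (card (D j)) * (1 / 2) ^ (j * a)" by simp
        also have "\<dots> \<le> (3 / (2 * (1 / 2 ^ j))) powr \<alpha> * (1 / 2) ^ (j * a)"
          using D(4)[of j] by (intro mult_right_mono) auto
        also have "(3 / (2 * (1 / 2 ^ j))) powr \<alpha> = (3 / 2) powr \<alpha> * (2 ^ j) powr \<alpha>"
          by (simp flip: powr_mult)
        also have "(2 ^ j) powr \<alpha> = (2::real) powr (real j * \<alpha>)"
          by (simp add: powr_powr flip: powr_realpow)
        also have "(1 / 2) ^ (j * a) = (2::real) powr (- real (j * a))" by (rule half_power_eq_powr)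
        also have "(3 / 2) powr \<alpha> * 2 powr (real j * \<alpha>) * 2 powr (- real (j * a)) =
            (3 / 2) powr \<alpha> * (2::real) powr (real j * \<alpha> - real j * real a)"
          by (simp only: mult.assoc powr_add[symmetric] of_nat_mult diff_conv_add_uminus)
        also have "\<dots> \<le> (3 / 2) powr \<alpha> * 2 powr (- real j)"
        proof (intro mult_left_mono powr_mono)
          have "real j * (\<alpha> + 1) \<le> real j * real a" using a by (intro mult_left_mono) auto
          then show "real j * \<alpha> - real j * real a \<le> - real j" by (simp add: algebra_simps)
        qed auto
        also have "2 powr (- real j) = (1 / (2::real)) ^ j" by (rule half_power_eq_powr[symmetric])
        finally show ?thesis .
      qed
      have "summable (\<lambda>j. measure \<mu> (U j))"
        by (rule summable_comparison_test'[of "\<lambda>j. (3 / 2) powr \<alpha> * (1 / 2) ^ j" 0])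
          (use U_bound in \<open>auto intro!: summable_mult summable_geometric\<close>)
      then have "AE x in \<mu>. \<forall>\<^sub>F j in sequentially. x \<in> space \<mu> - U j"
        by (intro borel_cantelli_AE1 U_meas) (auto simp: emeasure_eq_measure)
      then show ?thesis
      proof (rule AE_mp[OF _ AE_I2], intro impI)
        fix x assume ev: "\<forall>\<^sub>F j in sequentially. x \<in> space \<mu> - U j" and "x \<in> C k"
        show "\<forall>\<^sub>F j in sequentially. x \<notin> G j"
          using ev eventually_ge_at_top[of J]
        proof eventually_elim
          case (elim j)
          then show ?case using D(3)[of j] \<open>x \<in> C k\<close> by (auto simp: U_def)
        qed
      qed
    qed
    have AE_inf: "AE x in \<mu>. \<forall>J. \<exists>j\<ge>J. x \<in> G j"
      using thin by (simp add: AE_all_countable thin_along_subsequence_def G_def)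
    have "AE x in \<mu>. \<forall>k. x \<in> C k \<longrightarrow> (\<forall>\<^sub>F j in sequentially. x \<notin> G j)"
      unfolding AE_all_countable using AE_k by blast
    with AE_inf have "AE x in \<mu>. x \<notin> E"
    proof eventually_elim
      case (elim x)
      then have "x \<notin> C k" for k unfolding eventually_sequentially by meson
      then show ?case using C(1) by blast
    qed
    then show ?thesis using E sets_borel[OF \<mu>] AE_iff_null_sets[of E \<mu>] by auto
  qed
  have "packing_dim E = \<infinity>" if "E \<in> sets borel" "emeasure \<mu> E > 0" for E
  proof -
    \<comment> \<open>No exponent is admissible, and the infimum of the empty set is
      \<infinity>.\<close>
    have empty: "{ereal \<alpha> | \<alpha>. \<alpha> > 0 \<and> packing_measure \<alpha> E = 0} = {}" using null[OF that(1)] that(2) by auto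
    show ?thesis unfolding packing_dim_def empty by (simp add: top_ereal_def)
  qed
  then have "lower_dim packing_dim \<mu> \<ge> \<infinity>"
    unfolding lower_dim_def by (intro Inf_greatest) auto
  then show ?thesis
    using lower_dim_le_upper_dim[OF prob[OF \<mu>] sets_borel[OF \<mu>], of packing_dim]
    by (simp add: has_dim_def)
qed

text \<open>If thinness fails for some \<open>a\<close> and \<open>J\<close>, the points whose balls
  of radius 1 / 2^j have mass at least 1 / 2^(j a) for all j \<ge> J form a set of positive measure,
  whose packing dimension is at most a + 1.\<close>

lemma has_packing_dim_infinity_imp_thin:
  assumes \<mu>: "\<mu> \<in> S" and dim: "has_dim packing_dim \<mu> \<infinity>"
  shows "thin_along_subsequence \<mu>"
proof (rule ccontr)
  interpret prob_space \<mu> using \<mu> prob by blast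
  assume "\<not> thin_along_subsequence \<mu>"
  then obtain a J where not_AE: "\<not> (AE x in \<mu>. \<exists>j\<ge>J. measure \<mu> (cball x (1 / 2 ^ j)) < (1 / 2) ^ (j * a))"
    by (auto simp: thin_along_subsequence_def)
  define G where "G = {x. \<exists>j\<ge>J. measure \<mu> (cball x (1 / 2 ^ j)) < (1 / 2) ^ (j * a)}"
  have "open G" unfolding G_def by (rule open_section[OF thin_rectangle \<mu>])
  then have "- G \<in> sets borel" by auto
  moreover have "emeasure \<mu> (- G) > 0"
  proof (rule ccontr)
    assume "\<not> emeasure \<mu> (- G) > 0"
    then have "- G \<in> null_sets \<mu>" using \<open>- G \<in> sets borel\<close> sets_borel[OF \<mu>] by (auto simp: null_sets_def)
    then have "AE x in \<mu>. x \<in> G" using AE_not_in[of "- G" \<mu>] by simp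
    then show False using not_AE by (simp add: G_def)
  qed
  ultimately have "lower_dim packing_dim \<mu> \<le> packing_dim (- G)"
    unfolding lower_dim_def by (intro Inf_lower) blast
  also have "\<dots> \<le> ereal (real (Suc a))"
    by (rule packing_dim_le_of_measure_cball_ge[OF prob[OF \<mu>] sets_borel[OF \<mu>], of _ J])
      (auto simp: G_def not_less)
  finally show False using dim by (simp add: has_dim_def)
qed

lemma gdelta_in_packing_dim_infinity: "gdelta_in W {\<mu> \<in> S. has_dim packing_dim \<mu> \<infinity>}"
proof -
  have "{\<mu> \<in> S. has_dim packing_dim \<mu> \<infinity>} = {\<mu> \<in> S. thin_along_subsequence \<mu>}"
    using thin_imp_has_packing_dim_infinity has_packing_dim_infinity_imp_thin by blast
  then show ?thesis using gdelta_in_thin by simp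
qed

end

section \<open>Recurrence rates\<close>

lemma return_time_le_enat_iff:
  "return_time T r x y \<le> enat N \<longleftrightarrow> (\<exists>n\<ge>1. n \<le> N \<and> dist y ((T ^^ n) x) \<le> r)"
proof
  let ?A = "{enat n | n. n \<ge> 1 \<and> (T ^^ n) x \<in> cball y r}"
  assume le: "return_time T r x y \<le> enat N"
  have "?A \<noteq> {}"
  proof
    assume empty: "?A = {}"
    have "return_time T r x y = \<infinity>" unfolding return_time_def empty by (simp add: top_enat_def)
    then show False using le by simp
  qed
  then have "Inf ?A \<in> ?A" unfolding Inf_enat_def by (auto intro: LeastI)
  then show "\<exists>n\<ge>1. n \<le> N \<and> dist y ((T ^^ n) x) \<le> r"
    using le unfolding return_time_def by auto
next
  assume "\<exists>n\<ge>1. n \<le> N \<and> dist y ((T ^^ n) x) \<le> r"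
  then obtain n where n: "n \<ge> 1" "n \<le> N" "dist y ((T ^^ n) x) \<le> r" by blast
  then have "return_time T r x y \<le> enat n"
    unfolding return_time_def by (intro Inf_lower) auto
  also have "\<dots> \<le> enat N" using n by simp
  finally show "return_time T r x y \<le> enat N" .
qed

lemma return_time_ge_1: "enat 1 \<le> return_time T r x y"
  unfolding return_time_def by (rule Inf_greatest) auto

lemma log_enat_nonneg: "enat 1 \<le> t \<Longrightarrow> 0 \<le> log_enat t"
  by (cases t) auto

lemma log_enat_le: "enat 1 \<le> t \<Longrightarrow> t \<le> enat n \<Longrightarrow> log_enat t \<le> ereal (ln (real n))"
  by (cases t) auto

text \<open>The strict bound \<open>2 * r\<close> makes the condition open in \<open>(x, y)\<close>; the factor 2 is harmless on the
  logarithmic scale.\<close>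

definition rec_close :: "('x::metric_space \<Rightarrow> 'x) \<Rightarrow> nat \<Rightarrow> nat \<Rightarrow> 'x \<Rightarrow> 'x \<Rightarrow> bool" where
  "rec_close T a J x y \<longleftrightarrow> (\<exists>r>0. r < 1 / 2 ^ (J + 2) \<and>
     (\<exists>n\<ge>1. real n \<le> r powr (- 1 / real (Suc a)) \<and> dist y ((T ^^ n) x) < 2 * r))"

text \<open>Missing a closed ball is a strict inequality already, and it is asked only for the
  finitely many n up to r powr (- a), so the condition is open in both points.\<close>

definition rec_far :: "('x::metric_space \<Rightarrow> 'x) \<Rightarrow> nat \<Rightarrow> nat \<Rightarrow> 'x \<Rightarrow> 'x \<Rightarrow> bool" where
  "rec_far T a J x y \<longleftrightarrow> (\<exists>r>0. r < 1 / 2 ^ (J + 2) \<and>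
     (\<forall>n\<ge>1. real n \<le> r powr (- real a) \<longrightarrow> r < dist y ((T ^^ n) x)))"

lemma eventually_at_right_0_dyadic: "\<forall>\<^sub>F r in at_right (0::real). 0 < r \<and> r < 1 / 2 ^ (J + 2)"
proof -
  have "\<forall>\<^sub>F r in at_right (0::real). r \<in> {0<..<1 / 2 ^ (J + 2)}"
    by (rule eventually_at_right_real) simp
  then show ?thesis by (rule eventually_mono) simp
qed

text \<open>This is the purpose of the 2 in J + 2: for r < 1/4 both - ln r and - ln (2 r) are
  positive, and the first is at most twice the second.\<close>

lemma dyadic_small: "r < 1 / 2 ^ (J + 2) \<Longrightarrow> r < 1 / (4::real)"
  by (erule less_le_trans) (simp add: field_simps)

lemma lower_rec_nonneg: "0 \<le> lower_rec T x y"
  unfolding lower_rec_def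
proof (rule Liminf_bounded)
  show "\<forall>\<^sub>F r in at_right 0. 0 \<le> log_enat (return_time T r x y) / ereal (- ln r)"
    using eventually_at_right_0_dyadic[of 0]
  proof eventually_elim
    case (elim r)
    then have "- ln r > 0" by simp
    then show ?case using log_enat_nonneg[OF return_time_ge_1, of T r x y]
      by (cases "return_time T r x y") (auto simp: divide_nonneg_neg)
  qed
qed

text \<open>A return rate below 1 / (a + 1) at radius r means a hit before time r powr (- 1 / (a +
  1)), and \<open>J\<close> makes the radii arbitrarily small. Conversely the hits are only within 2
  r, so the rate is read off at radius 2 r.\<close>

lemma lower_rec_eq_0_iff: "lower_rec T x y = 0 \<longleftrightarrow> (\<forall>a J. rec_close T a J x y)"
proof
  assume L: "lower_rec T x y = 0"
  show "\<forall>a J. rec_close T a J x y"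
  proof (intro allI)
    fix a J
    let ?c = "1 / real (Suc a)" and ?f = "\<lambda>r. log_enat (return_time T r x y) / ereal (- ln r)"
    have "\<not> (\<forall>\<^sub>F r in at_right 0. ereal ?c \<le> ?f r)"
    proof
      assume "\<forall>\<^sub>F r in at_right 0. ereal ?c \<le> ?f r"
      then have "ereal ?c \<le> lower_rec T x y" unfolding lower_rec_def by (rule Liminf_bounded)
      then show False using L by simp
    qed
    then have "\<exists>\<^sub>F r in at_right 0. \<not> ereal ?c \<le> ?f r" by (simp add: frequently_def)
    then have "\<exists>\<^sub>F r in at_right 0. \<not> ereal ?c \<le> ?f r \<and> 0 < r \<and> r < 1 / 2 ^ (J + 2)"
      using eventually_at_right_0_dyadic by (rule frequently_eventually_frequently)
    then obtain r where r: "?f r < ereal ?c" "0 < r" "r < 1 / 2 ^ (J + 2)"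
      by (auto dest!: frequently_ex simp: not_le)
    have lnr: "- ln r > 0" using r dyadic_small[OF r(3)] by simp
    obtain n where n: "return_time T r x y = enat n"
    proof (cases "return_time T r x y")
      case infinity
      then show ?thesis using r(1) lnr by (simp add: ereal_divide_eq)
    qed blast
    have "n \<ge> 1" using return_time_ge_1[of T r x y] n by simp
    have "ln (real n) / (- ln r) < ?c" using r(1) n lnr by simp
    then have "ln (real n) < - ln r / real (Suc a)" using pos_divide_less_eq[OF lnr] by simp
    also have "\<dots> = ln (r powr (- 1 / real (Suc a)))" using r by (simp add: ln_powr)
    finally have "real n < r powr (- 1 / real (Suc a))"
      using \<open>n \<ge> 1\<close> r(2) by (subst (asm) ln_less_cancel_iff) auto
    moreover obtain n' where "n' \<ge> 1" "n' \<le> n" "dist y ((T ^^ n') x) \<le> r"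
      using return_time_le_enat_iff[of T r x y n] n by auto
    ultimately have "n' \<ge> 1 \<and> real n' \<le> r powr (- 1 / real (Suc a)) \<and> dist y ((T ^^ n') x) < 2 * r"
      using r(2) by auto
    then show "rec_close T a J x y" unfolding rec_close_def using r by blast
  qed
next
  assume R: "\<forall>a J. rec_close T a J x y"
  have "lower_rec T x y \<le> 0"
  proof (rule ccontr)
    assume "\<not> lower_rec T x y \<le> 0"
    then obtain c where c: "0 < c" "ereal c < lower_rec T x y"
      using ereal_dense2[of 0 "lower_rec T x y"] by (auto simp: not_le)
    let ?f = "\<lambda>r. log_enat (return_time T r x y) / ereal (- ln r)"
    have "\<forall>\<^sub>F r in at_right 0. ereal c < ?f r"
      using c(2) unfolding lower_rec_def by (rule less_LiminfD)
    then obtain d where d: "d > 0" "\<And>r. 0 < r \<Longrightarrow> r < d \<Longrightarrow> ereal c < ?f r"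
      unfolding eventually_at_right_field by auto
    \<comment> \<open>Half of \<open>c\<close> is given away for - ln r \<le> 2 (- ln (2 r)), the
      change from radius r to 2 r.\<close>
    obtain a where a: "inverse (real (Suc a)) < c / 2" using reals_Archimedean[of "c/2"] c(1) by auto
    obtain J where J: "(1/2) ^ J < d" using real_arch_pow_inv[OF d(1), of "1/2"] by auto
    obtain r n where r: "0 < r" "r < 1 / 2 ^ (J + 2)" "n \<ge> 1" "real n \<le> r powr (- 1 / real (Suc a))"
      "dist y ((T ^^ n) x) < 2 * r" using R unfolding rec_close_def by blast
    have r4: "r < 1 / 4" using r(2) by (rule dyadic_small)
    have "2 * r < d"
    proof -
      have "2 * r < 2 * (1 / 2 ^ (J + 2))" using r(2) by simp
      also have "\<dots> \<le> (1 / 2) ^ J" by (simp add: power_divide field_simps)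
      finally show ?thesis using J by simp
    qed
    then have "ereal c < ?f (2 * r)" using d(2)[of "2 * r"] r(1) by simp
    moreover have "?f (2 * r) \<le> ereal c"
    proof -
      have ln2: "- ln (2 * r) > 0" using r(1) r4 by simp
      have "log_enat (return_time T (2 * r) x y) \<le> ereal (ln (real n))"
        using r(3,5) by (intro log_enat_le return_time_ge_1) (auto simp: return_time_le_enat_iff)
      also have "ln (real n) \<le> ln (r powr (- 1 / real (Suc a)))"
        using r by (subst ln_le_cancel_iff) auto
      also have "\<dots> = - ln r / real (Suc a)" using r by (simp add: ln_powr)
      also have "\<dots> = - ln r * inverse (real (Suc a))" by (simp add: divide_inverse)
      also have "\<dots> \<le> - ln r * (c / 2)" using a r4 r(1) by (intro mult_left_mono) auto
      also have "\<dots> \<le> c * (- ln (2 * r))"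
      proof -
        have "ln (2 * (2 * r)) \<le> 0" using r(1) r4 by (subst ln_le_zero_iff) auto
        moreover have "ln (2 * (2 * r)) = ln 2 + ln (2 * r)" by (rule ln_mult_pos) (use r(1) in auto)
        moreover have "ln (2 * r) = ln 2 + ln r" by (rule ln_mult_pos) (use r(1) in auto)
        ultimately have "- ln r \<le> 2 * (- ln (2 * r))" by linarith
        then have "c / 2 * (- ln r) \<le> c / 2 * (2 * (- ln (2 * r)))" using c(1) by (intro mult_left_mono) auto
        then show ?thesis by (simp add: algebra_simps)
      qed
      finally have "log_enat (return_time T (2 * r) x y) \<le> ereal (c * (- ln (2 * r)))" by simp
      then have "?f (2 * r) \<le> ereal (c * (- ln (2 * r))) / ereal (- ln (2 * r))"
        using ln2 by (intro ereal_divide_right_mono) auto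
      then show ?thesis using ln2 by simp
    qed
    ultimately show False by simp
  qed
  then show "lower_rec T x y = 0" using lower_rec_nonneg by (rule antisym)
qed

text \<open>Exceeding the rate \<open>a\<close> at radius r means missing the ball at all times up
  to r powr (- a), and an infinite limsup asks for this at arbitrarily small radii for every
  \<open>a\<close>.\<close>

lemma upper_rec_eq_infinity_iff: "upper_rec T x y = \<infinity> \<longleftrightarrow> (\<forall>a J. rec_far T a J x y)"
proof
  let ?f = "\<lambda>r. log_enat (return_time T r x y) / ereal (- ln r)"
  assume L: "upper_rec T x y = \<infinity>"
  show "\<forall>a J. rec_far T a J x y"
  proof (intro allI)
    fix a J
    have "\<not> (\<forall>\<^sub>F r in at_right 0. ?f r \<le> ereal (real a))"
    proof
      assume "\<forall>\<^sub>F r in at_right 0. ?f r \<le> ereal (real a)"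
      then have "upper_rec T x y \<le> ereal (real a)" unfolding upper_rec_def by (rule Limsup_bounded)
      then show False using L by simp
    qed
    then have "\<exists>\<^sub>F r in at_right 0. \<not> ?f r \<le> ereal (real a)" by (simp add: frequently_def)
    then have "\<exists>\<^sub>F r in at_right 0. \<not> ?f r \<le> ereal (real a) \<and> 0 < r \<and> r < 1 / 2 ^ (J + 2)"
      using eventually_at_right_0_dyadic by (rule frequently_eventually_frequently)
    then obtain r where r: "\<not> ?f r \<le> ereal (real a)" "0 < r" "r < 1 / 2 ^ (J + 2)"
      by (auto dest!: frequently_ex)
    have lnr: "- ln r > 0" using r dyadic_small[OF r(3)] by simp
    have "r < dist y ((T ^^ n) x)" if n: "n \<ge> 1" "real n \<le> r powr (- real a)" for n
    proof (rule ccontr)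
      assume "\<not> r < dist y ((T ^^ n) x)"
      then have "log_enat (return_time T r x y) \<le> ereal (ln (real n))"
        using n by (intro log_enat_le return_time_ge_1) (auto simp: return_time_le_enat_iff not_less)
      also have "ln (real n) \<le> ln (r powr (- real a))"
        using n r by (subst ln_le_cancel_iff) auto
      also have "\<dots> = real a * (- ln r)" using r by (simp add: ln_powr)
      finally have "log_enat (return_time T r x y) \<le> ereal (real a * (- ln r))" by simp
      then have "?f r \<le> ereal (real a * (- ln r)) / ereal (- ln r)"
        using lnr by (intro ereal_divide_right_mono) auto
      then show False using lnr r(1) by simp
    qed
    then show "rec_far T a J x y" unfolding rec_far_def using r by blast
  qed
next
  let ?f = "\<lambda>r. log_enat (return_time T r x y) / ereal (- ln r)"
  assume R: "\<forall>a J. rec_far T a J x y"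
  show "upper_rec T x y = \<infinity>"
  proof (rule ccontr)
    assume "upper_rec T x y \<noteq> \<infinity>"
    then obtain a :: nat where a: "upper_rec T x y < ereal (real a)"
      using less_PInf_Ex_of_nat by blast
    then have "\<forall>\<^sub>F r in at_right 0. ?f r < ereal (real a)"
      unfolding upper_rec_def by (rule Limsup_lessD)
    then obtain d where d: "d > 0" "\<And>r. 0 < r \<Longrightarrow> r < d \<Longrightarrow> ?f r < ereal (real a)"
      unfolding eventually_at_right_field by auto
    obtain J where J: "(1/2) ^ J < d" using real_arch_pow_inv[OF d(1), of "1/2"] by auto
    obtain r where r: "0 < r" "r < 1 / 2 ^ (J + 2)"
      "\<And>n. n \<ge> 1 \<Longrightarrow> real n \<le> r powr (- real a) \<Longrightarrow> r < dist y ((T ^^ n) x)"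
      using R unfolding rec_far_def by blast
    have lnr: "- ln r > 0" using r dyadic_small[OF r(2)] by simp
    have "r < d"
    proof -
      have "1 / 2 ^ (J + 2) \<le> (1 / (2::real)) ^ J" by (simp add: power_divide field_simps)
      then show ?thesis using r(2) J by linarith
    qed
    then have f: "?f r < ereal (real a)" using d(2) r(1) by blast
    have "ereal (real a) \<le> ?f r"
    proof (cases "return_time T r x y")
      case infinity
      then show ?thesis using lnr by simp
    next
      case (enat n)
      then obtain n' where n': "n' \<ge> 1" "n' \<le> n" "dist y ((T ^^ n') x) \<le> r"
        using return_time_le_enat_iff[of T r x y n] by auto
      then have "\<not> real n' \<le> r powr (- real a)" using r(3)[of n'] by auto
      then have "r powr (- real a) \<le> real n" using n'(2) by linarith
      then have "ln (r powr (- real a)) \<le> ln (real n)" using r(1) n' by (subst ln_le_cancel_iff) auto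
      then have "real a * (- ln r) \<le> ln (real n)" using r(1) by (simp add: ln_powr)
      then have "real a \<le> ln (real n) / (- ln r)" using pos_le_divide_eq[OF lnr] by blast
      then show ?thesis using enat lnr by simp
    qed
    then show False using f by simp
  qed
qed

section \<open>Openness of the recurrence conditions\<close>

lemma continuous_on_funpow:
  fixes T :: "'x::topological_space \<Rightarrow> 'x"
  assumes "continuous_on UNIV T"
  shows "continuous_on UNIV (T ^^ n)"
proof (induction n)
  case (Suc n)
  then show ?case using continuous_on_compose2[OF assms Suc] by (simp add: o_def)
qed (simp add: id_def)

lemma open_rec_close:
  assumes "continuous_on UNIV T"
  shows "open {p. rec_close T a J (fst p) (snd p)}"
proof -
  have "continuous_on UNIV (\<lambda>p. (T ^^ n) (fst p))" for n
    by (rule continuous_on_compose2[OF continuous_on_funpow[OF assms]]) (auto intro: continuous_intros)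
  then have "open {p. dist (snd p) ((T ^^ n) (fst p)) < 2 * r}" for n r
    by (intro open_Collect_less continuous_intros)
  then have "open (\<Union>r\<in>{0<..<1 / 2 ^ (J + 2)}. \<Union>n\<in>{n. n \<ge> 1 \<and> real n \<le> r powr (- 1 / real (Suc a))}.
      {p. dist (snd p) ((T ^^ n) (fst p)) < 2 * r})"
    by (intro open_UN ballI)
  also have "\<dots> = {p. rec_close T a J (fst p) (snd p)}"
    unfolding rec_close_def by (auto simp del: of_nat_Suc)
  finally show ?thesis .
qed

lemma open_rec_far:
  assumes "continuous_on UNIV T"
  shows "open {p. rec_far T a J (fst p) (snd p)}"
proof -
  have "continuous_on UNIV (\<lambda>p. (T ^^ n) (fst p))" for n
    by (rule continuous_on_compose2[OF continuous_on_funpow[OF assms]]) (auto intro: continuous_intros)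
  then have op: "open {p. r < dist (snd p) ((T ^^ n) (fst p))}" for n r
    by (intro open_Collect_less continuous_intros)
  have fin: "finite {n. n \<ge> 1 \<and> real n \<le> R}" for R
    by (rule finite_subset[of _ "{..nat \<lceil>R\<rceil>}"]) (auto simp: le_nat_iff le_ceiling_iff intro: order_trans[OF _ of_nat_ceiling])
  have "open (\<Union>r\<in>{0<..<1 / 2 ^ (J + 2)}. \<Inter>n\<in>{n. n \<ge> 1 \<and> real n \<le> r powr (- real a)}.
      {p. r < dist (snd p) ((T ^^ n) (fst p))})"
    by (intro open_UN ballI open_INT fin op)
  also have "\<dots> = {p. rec_far T a J (fst p) (snd p)}"
    unfolding rec_far_def by auto
  finally show ?thesis .
qed

lemma open_diagonal_section:
  assumes "open {p. Q (fst p) (snd p)}"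
  shows "open {x. Q x x}"
proof -
  have "open ((\<lambda>x. (x, x)) -` {p. Q (fst p) (snd p)})"
    by (intro open_vimage assms continuous_intros)
  then show ?thesis by simp
qed

lemma Collect_all2_eq_INT: "{x \<in> A. \<forall>i j. P i j x} = (\<Inter>i. \<Inter>j. {x \<in> A. P i j x})"
  by auto

lemma sets_pair_borel:
  fixes \<mu> :: "'x::second_countable_topology measure"
  assumes "sets \<mu> = sets borel"
  shows "sets (\<mu> \<Otimes>\<^sub>M \<mu>) = sets borel"
proof -
  have "sets (\<mu> \<Otimes>\<^sub>M \<mu>) = sets (borel \<Otimes>\<^sub>M (borel :: 'x measure))"
    by (rule sets_pair_measure_cong[OF assms assms])
  then show ?thesis by (simp only: borel_prod)
qed

lemma AE_pair_borel_iff: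
  fixes \<mu> :: "'x::second_countable_topology measure"
  assumes "prob_space \<mu>" "sets \<mu> = sets borel" "{p. P p} \<in> sets borel"
  shows "(AE p in \<mu> \<Otimes>\<^sub>M \<mu>. P p) \<longleftrightarrow> (AE x in \<mu>. AE y in \<mu>. P (x, y))"
proof -
  interpret prob_space \<mu> by fact
  interpret pair_sigma_finite \<mu> \<mu> ..
  have "{p \<in> space (\<mu> \<Otimes>\<^sub>M \<mu>). P p} \<in> sets (\<mu> \<Otimes>\<^sub>M \<mu>)"
    using assms(3) sets_pair_borel[OF assms(2)] sets_eq_imp_space_eq[OF sets_pair_borel[OF assms(2)]] by simp
  then show ?thesis using AE_pair AE_pair_measure by blast
qed

section \<open>G_delta sets defined by almost all points or pairs\<close>

context borel_prob_family
begin

lemma gdelta_in_AE_open: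
  assumes "open U"
  shows "gdelta_in W {\<mu> \<in> S. AE x in \<mu>. x \<in> U}"
proof (rule gdelta_in_AE_section)
  fix x and \<mu> assume "\<mu> \<in> S" "x \<in> U"
  then show "\<exists>U' V. open U' \<and> x \<in> U' \<and> openin W V \<and> \<mu> \<in> V \<and> (\<forall>y\<in>U'. \<forall>\<nu>\<in>V. y \<in> U)"
    using assms openin_topspace[of W, unfolded topspace_weak_topology]
    by (intro exI[of _ U] exI[of _ S]) auto
qed

text \<open>The y whose whole fibre over a ball about x lies in \<open>O'\<close> exhaust the
  section at x as the ball shrinks. The interior of one such set has mass above \<open>c\<close>; it
  is open, so this persists for nearby measures, and it is contained in the sections at all nearby
  points.\<close>

lemma measure_section_gt_open:
  fixes x :: 'x
  assumes O: "open O'" and \<mu>: "\<mu> \<in> S" and gt: "measure \<mu> {y. (x, y) \<in> O'} > c"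
  shows "\<exists>U V. open U \<and> x \<in> U \<and> openin W V \<and> \<mu> \<in> V \<and> (\<forall>x'\<in>U. \<forall>\<nu>\<in>V. measure \<nu> {y. (x', y) \<in> O'} > c)"
proof -
  interpret prob_space \<mu> using \<mu> prob by blast
  have section_open: "open {y. (x', y) \<in> O'}" for x'
  proof -
    have "open ((\<lambda>y. (x', y)) -` O')" by (intro open_vimage O continuous_intros)
    then show ?thesis by (simp add: vimage_def)
  qed
  define A where "A n = interior {y. \<forall>x'\<in>ball x (1 / real (Suc n)). (x', y) \<in> O'}" for n
  have "incseq A"
  proof (unfold incseq_def A_def, intro allI impI interior_mono Collect_mono)
    fix m n :: nat and y assume "m \<le> n" and *: "\<forall>x'\<in>ball x (1 / real (Suc m)). (x', y) \<in> O'"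
    have "ball x (1 / real (Suc n)) \<subseteq> ball x (1 / real (Suc m))"
      using \<open>m \<le> n\<close> by (intro subset_ball) (simp add: frac_le)
    then show "\<forall>x'\<in>ball x (1 / real (Suc n)). (x', y) \<in> O'" using * by blast
  qed
  have "(\<Union>n. A n) = {y. (x, y) \<in> O'}"
  proof (intro set_eqI iffI)
    fix y assume "y \<in> (\<Union>n. A n)"
    then obtain n where "y \<in> A n" by blast
    then have "\<forall>x'\<in>ball x (1 / real (Suc n)). (x', y) \<in> O'"
      using interior_subset unfolding A_def by blast
    then show "y \<in> {y. (x, y) \<in> O'}" by (simp del: of_nat_Suc)
  next
    fix y assume "y \<in> {y. (x, y) \<in> O'}"
    then obtain U V where UV: "open U" "open V" "(x, y) \<in> U \<times> V" "U \<times> V \<subseteq> O'"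
      using O by (auto elim: open_prod_elim)
    then obtain e where e: "e > 0" "ball x e \<subseteq> U" using open_contains_ball by blast
    obtain n where n: "1 / real (Suc n) < e" using reals_Archimedean[OF e(1)] by (auto simp: inverse_eq_divide)
    have "V \<subseteq> {y. \<forall>x'\<in>ball x (1 / real (Suc n)). (x', y) \<in> O'}"
      using subset_ball[OF less_imp_le[OF n], of x] e(2) UV(4) by blast
    then have "V \<subseteq> A n" unfolding A_def by (rule interior_maximal[OF _ UV(2)])
    then show "y \<in> (\<Union>n. A n)" using UV(3) by blast
  qed
  moreover have "(\<lambda>n. measure \<mu> (A n)) \<longlonglongrightarrow> measure \<mu> (\<Union>n. A n)"
    by (rule finite_Lim_measure_incseq[OF _ \<open>incseq A\<close>]) (intro image_subsetI, simp add: A_def sets_borel[OF \<mu>])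
  ultimately have "\<forall>\<^sub>F n in sequentially. c < measure \<mu> (A n)"
    using gt by (intro order_tendstoD) auto
  then obtain n where n: "c < measure \<mu> (A n)" unfolding eventually_sequentially by blast
  define V where "V = {\<nu> \<in> S. c < measure \<nu> (A n)}"
  have "c < measure \<nu> {y. (x', y) \<in> O'}" if "x' \<in> ball x (1 / real (Suc n))" "\<nu> \<in> V" for x' \<nu>
  proof -
    have "\<nu> \<in> S" using that by (simp add: V_def)
    interpret \<nu>: prob_space \<nu> using \<open>\<nu> \<in> S\<close> prob by blast
    have "A n \<subseteq> {y. (x', y) \<in> O'}" using that(1) interior_subset unfolding A_def by blast
    then have "measure \<nu> (A n) \<le> measure \<nu> {y. (x', y) \<in> O'}"
      using section_open sets_borel[OF \<open>\<nu> \<in> S\<close>] by (intro \<nu>.finite_measure_mono) auto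
    then show ?thesis using that(2) by (simp add: V_def)
  qed
  moreover have "openin W V" unfolding V_def A_def by (rule openin_measure_gt) simp
  moreover have "\<mu> \<in> V" using \<mu> n by (simp add: V_def)
  moreover have "x \<in> ball x (1 / real (Suc n))" by (simp del: of_nat_Suc)
  ultimately show ?thesis by (intro exI[of _ "ball x (1 / real (Suc n))"] exI[of _ V]) (auto simp del: of_nat_Suc)
qed

text \<open>By Fubini the condition says that almost every section has mass above 1 - 1 / (n + 1)
  for all n. Each of these is jointly open in the point and the measure, so the one-variable result
  applies.\<close>

lemma gdelta_in_AE_pair_open:
  assumes O: "open O'"
  shows "gdelta_in W {\<mu> \<in> S. AE p in \<mu> \<Otimes>\<^sub>M \<mu>. p \<in> O'}"
proof -
  have "(AE p in \<mu> \<Otimes>\<^sub>M \<mu>. p \<in> O') \<longleftrightarrow> (\<forall>n. AE x in \<mu>. measure \<mu> {y. (x, y) \<in> O'} > 1 - 1 / real (Suc n))"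
    if \<mu>: "\<mu> \<in> S" for \<mu>
  proof -
    interpret prob_space \<mu> using \<mu> prob by blast
    have eq: "(AE y in \<mu>. (x, y) \<in> O') \<longleftrightarrow> (\<forall>n. measure \<mu> {y. (x, y) \<in> O'} > 1 - 1 / real (Suc n))" for x
    proof -
      have "open ((\<lambda>y. (x, y)) -` O')" by (intro open_vimage O continuous_intros)
      then have "{y. (x, y) \<in> O'} \<in> sets \<mu>" using sets_borel[OF \<mu>] by (simp add: vimage_def)
      then have "(AE y in \<mu>. (x, y) \<in> O') \<longleftrightarrow> measure \<mu> {y. (x, y) \<in> O'} = 1"
        using prob_eq_1[of "{y. (x, y) \<in> O'}"] by simp
      also have "\<dots> \<longleftrightarrow> (\<forall>n. measure \<mu> {y. (x, y) \<in> O'} > 1 - 1 / real (Suc n))"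
        by (rule eq_1_iff_gt[OF prob_le_1])
      finally show ?thesis .
    qed
    have "{p. p \<in> O'} \<in> sets borel" using O by simp
    then have "(AE p in \<mu> \<Otimes>\<^sub>M \<mu>. p \<in> O') \<longleftrightarrow> (AE x in \<mu>. AE y in \<mu>. (x, y) \<in> O')"
      by (rule AE_pair_borel_iff[OF prob[OF \<mu>] sets_borel[OF \<mu>]])
    also have "\<dots> \<longleftrightarrow> (\<forall>n. AE x in \<mu>. measure \<mu> {y. (x, y) \<in> O'} > 1 - 1 / real (Suc n))"
      unfolding eq by (rule AE_all_countable)
    finally show ?thesis .
  qed
  then have "{\<mu> \<in> S. AE p in \<mu> \<Otimes>\<^sub>M \<mu>. p \<in> O'} =
      (\<Inter>n. {\<mu> \<in> S. AE x in \<mu>. measure \<mu> {y. (x, y) \<in> O'} > 1 - 1 / real (Suc n)})"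
    by auto
  also have "gdelta_in W \<dots>"
    by (intro gdelta_in_INT_nat gdelta_in_AE_section measure_section_gt_open O)
  finally show ?thesis .
qed

context
  fixes T :: "'x \<Rightarrow> 'x"
  assumes T: "continuous_on UNIV T"
begin

lemma gdelta_in_lower_rec: "gdelta_in W {\<mu> \<in> S. AE x in \<mu>. lower_rec T x x = 0}"
proof -
  have "{\<mu> \<in> S. AE x in \<mu>. lower_rec T x x = 0} =
      (\<Inter>a. \<Inter>J. {\<mu> \<in> S. AE x in \<mu>. x \<in> {x. rec_close T a J x x}})"
    unfolding lower_rec_eq_0_iff AE_all_countable mem_Collect_eq by (rule Collect_all2_eq_INT)
  also have "gdelta_in W \<dots>"
    by (intro gdelta_in_INT_nat gdelta_in_AE_open open_diagonal_section[OF open_rec_close[OF T]])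
  finally show ?thesis .
qed

lemma gdelta_in_upper_rec: "gdelta_in W {\<mu> \<in> S. AE x in \<mu>. upper_rec T x x = \<infinity>}"
proof -
  have "{\<mu> \<in> S. AE x in \<mu>. upper_rec T x x = \<infinity>} =
      (\<Inter>a. \<Inter>J. {\<mu> \<in> S. AE x in \<mu>. x \<in> {x. rec_far T a J x x}})"
    unfolding upper_rec_eq_infinity_iff AE_all_countable mem_Collect_eq by (rule Collect_all2_eq_INT)
  also have "gdelta_in W \<dots>"
    by (intro gdelta_in_INT_nat gdelta_in_AE_open open_diagonal_section[OF open_rec_far[OF T]])
  finally show ?thesis .
qed

lemma gdelta_in_lower_rec_pair: "gdelta_in W {\<mu> \<in> S. AE (x, y) in \<mu> \<Otimes>\<^sub>M \<mu>. lower_rec T x y = 0}"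
proof -
  have eq: "(\<lambda>(x, y). lower_rec T x y = 0) = (\<lambda>p. \<forall>a J. rec_close T a J (fst p) (snd p))"
    by (auto simp: fun_eq_iff lower_rec_eq_0_iff)
  have "(AE (x, y) in \<mu> \<Otimes>\<^sub>M \<mu>. lower_rec T x y = 0) \<longleftrightarrow>
      (\<forall>a J. AE p in \<mu> \<Otimes>\<^sub>M \<mu>. rec_close T a J (fst p) (snd p))" for \<mu>
    unfolding eq AE_all_countable ..
  then have "{\<mu> \<in> S. AE (x, y) in \<mu> \<Otimes>\<^sub>M \<mu>. lower_rec T x y = 0} =
      (\<Inter>a. \<Inter>J. {\<mu> \<in> S. AE p in \<mu> \<Otimes>\<^sub>M \<mu>. p \<in> {p. rec_close T a J (fst p) (snd p)}})"
    by (simp only: mem_Collect_eq Collect_all2_eq_INT)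
  also have "gdelta_in W \<dots>"
    by (intro gdelta_in_INT_nat gdelta_in_AE_pair_open open_rec_close T)
  finally show ?thesis .
qed

lemma gdelta_in_upper_rec_pair: "gdelta_in W {\<mu> \<in> S. AE (x, y) in \<mu> \<Otimes>\<^sub>M \<mu>. upper_rec T x y = \<infinity>}"
proof -
  have eq: "(\<lambda>(x, y). upper_rec T x y = \<infinity>) = (\<lambda>p. \<forall>a J. rec_far T a J (fst p) (snd p))"
    by (auto simp: fun_eq_iff upper_rec_eq_infinity_iff)
  have "(AE (x, y) in \<mu> \<Otimes>\<^sub>M \<mu>. upper_rec T x y = \<infinity>) \<longleftrightarrow>
      (\<forall>a J. AE p in \<mu> \<Otimes>\<^sub>M \<mu>. rec_far T a J (fst p) (snd p))" for \<mu>
    unfolding eq AE_all_countable ..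
  then have "{\<mu> \<in> S. AE (x, y) in \<mu> \<Otimes>\<^sub>M \<mu>. upper_rec T x y = \<infinity>} =
      (\<Inter>a. \<Inter>J. {\<mu> \<in> S. AE p in \<mu> \<Otimes>\<^sub>M \<mu>. p \<in> {p. rec_far T a J (fst p) (snd p)}})"
    by (simp only: mem_Collect_eq Collect_all2_eq_INT)
  also have "gdelta_in W \<dots>"
    by (intro gdelta_in_INT_nat gdelta_in_AE_pair_open open_rec_far T)
  finally show ?thesis .
qed

end

section \<open>Full support\<close>

lemma gdelta_in_full_support: "gdelta_in W {\<mu> \<in> S. msupp \<mu> = UNIV}"
proof -
  obtain B :: "'x set set" where B: "countable B" "topological_basis B"
    using ex_countable_basis by blast
  \<comment> \<open>\<open>UNIV\<close> makes the family non-empty; for the remaining sets a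
    countable base suffices to detect the support.\<close>
  define B' where "B' = insert UNIV (B - {{}})"
  have "(msupp \<mu> = UNIV) \<longleftrightarrow> (\<forall>U\<in>B'. measure \<mu> U > 0)" if "\<mu> \<in> S" for \<mu>
  proof -
    interpret prob_space \<mu> using that prob by blast
    have pos: "emeasure \<mu> U > 0 \<longleftrightarrow> measure \<mu> U > 0" for U
      by (simp add: emeasure_eq_measure)
    show ?thesis
    proof
      assume supp: "msupp \<mu> = UNIV"
      show "\<forall>U\<in>B'. measure \<mu> U > 0"
      proof
        fix U assume "U \<in> B'"
        then have "open U" "U \<noteq> {}" using B(2) topological_basis_open by (auto simp: B'_def)
        then obtain x where "x \<in> U" by blast
        then show "measure \<mu> U > 0"
          using supp \<open>open U\<close> pos unfolding msupp_def by (metis (no_types, lifting) UNIV_I mem_Collect_eq)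
      qed
    next
      assume *: "\<forall>U\<in>B'. measure \<mu> U > 0"
      have "emeasure \<mu> U > 0" if U: "open U" "x \<in> U" for x U
      proof -
        obtain V where V: "V \<in> B" "x \<in> V" "V \<subseteq> U" using topological_basisE[OF B(2) U] by metis
        then have "measure \<mu> V > 0" using * by (auto simp: B'_def)
        moreover have "measure \<mu> V \<le> measure \<mu> U"
          using V U sets_borel[OF \<open>\<mu> \<in> S\<close>] by (intro finite_measure_mono) auto
        ultimately show ?thesis using pos by simp
      qed
      then show "msupp \<mu> = UNIV" by (auto simp: msupp_def)
    qed
  qed
  then have "{\<mu> \<in> S. msupp \<mu> = UNIV} = (\<Inter>U\<in>B'. {\<mu> \<in> S. measure \<mu> U > 0})"
    by (auto simp: B'_def)
  also have "gdelta_in W \<dots>"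
  proof (rule gdelta_in_Inter)
    show "countable ((\<lambda>U. {\<mu> \<in> S. measure \<mu> U > 0}) ` B')" using B(1) by (simp add: B'_def)
    show "(\<lambda>U. {\<mu> \<in> S. measure \<mu> U > 0}) ` B' \<noteq> {}" by (auto simp: B'_def)
    fix X assume "X \<in> (\<lambda>U. {\<mu> \<in> S. measure \<mu> U > 0}) ` B'"
    then obtain U where "X = {\<mu> \<in> S. measure \<mu> U > 0}" "open U"
      using B(2) topological_basis_open by (auto simp: B'_def)
    then show "gdelta_in W X" using open_imp_gdelta_in openin_measure_gt by blast
  qed
  finally show ?thesis .
qed

end

section \<open>A countable family of conditions implying ergodicity\<close>

definition orbit_average :: "('x \<Rightarrow> 'x) \<Rightarrow> nat \<Rightarrow> ('x \<Rightarrow> real) \<Rightarrow> 'x \<Rightarrow> real" where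
  "orbit_average T n f x = (\<Sum>l<n. f ((T ^^ l) x)) / real n"

text \<open>A countable family of open sets, chosen before the measure, that approximates every open
  set from inside in the sense of mass, for each probability measure.\<close>

definition finite_unions :: "'x set set \<Rightarrow> 'x set set" where
  "finite_unions B = Union ` {D. finite D \<and> D \<subseteq> B}"

lemma countable_finite_unions: "countable B \<Longrightarrow> countable (finite_unions B)"
  unfolding finite_unions_def by (intro countable_image countable_Collect_finite_subset)

lemma finite_union_approx:
  fixes \<mu> :: "'x::second_countable_topology measure"
  assumes \<mu>: "prob_space \<mu>" "sets \<mu> = sets borel" and B: "countable B" "topological_basis B"
    and U: "open U" and "e > 0"
  shows "\<exists>V\<in>finite_unions B. open V \<and> V \<subseteq> U \<and> measure \<mu> U - e < measure \<mu> V"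
proof -
  obtain B0 where B0: "B0 \<subseteq> B" "\<Union>B0 = U" using B(2) U unfolding topological_basis_def by blast
  have B0_open: "open V" if "V \<in> B0" for V using that B0(1) topological_basis_open[OF B(2)] by blast
  obtain D where D: "finite D" "D \<subseteq> B0" "measure \<mu> U - e < measure \<mu> (\<Union>D)"
    using measure_finite_Union_gt[OF \<mu> countable_subset[OF B0(1) B(1)] B0_open, of "measure \<mu> U - e"] B0(2) \<open>e > 0\<close>
    by auto
  have "\<Union>D \<in> finite_unions B" using D(1,2) B0(1) unfolding finite_unions_def by blast
  moreover have "open (\<Union>D)" using D(2) B0_open by (intro open_Union) blast
  ultimately show ?thesis using D(2,3) B0(2) by blast
qed

text \<open>Outer regularity gives an open \<open>U\<close> around \<open>A\<close>, a finite union
  \<open>V\<close> fills most of \<open>U\<close>, and a bump function most of \<open>V\<close>, at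
  the price of e / 3 each. Thus countably many continuous functions approximate all indicators in
  \<open>L\<^sup>1\<close>, for every measure.\<close>

lemma inner_bump_approx_indicator:
  fixes \<mu> :: "'x::polish_space measure"
  assumes \<mu>: "prob_space \<mu>" "sets \<mu> = sets borel" and B: "countable B" "topological_basis B"
    and A: "A \<in> sets borel" and "e > 0"
  shows "\<exists>V\<in>finite_unions B. \<exists>k. (\<integral>x. \<bar>inner_bump V k x - indicator A x\<bar> \<partial>\<mu>) < e"
proof -
  interpret prob_space \<mu> by fact
  have "emeasure \<mu> (space \<mu>) \<noteq> \<infinity>" by simp
  from outer_regular[OF \<mu>(2) this A]
  have reg: "emeasure \<mu> A = (INF U\<in>{U. A \<subseteq> U \<and> open U}. emeasure \<mu> U)" .
  have "emeasure \<mu> A < ennreal (measure \<mu> A + e / 3)"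
    using \<open>e > 0\<close> unfolding emeasure_eq_measure by (intro ennreal_lessI) (auto intro: add_nonneg_pos)
  then obtain U where U: "A \<subseteq> U" "open U" "emeasure \<mu> U < ennreal (measure \<mu> A + e / 3)"
    unfolding reg INF_less_iff by blast
  then have U_lt: "measure \<mu> U < measure \<mu> A + e / 3"
    unfolding emeasure_eq_measure by (subst (asm) ennreal_less_iff) auto
  obtain V where V: "V \<in> finite_unions B" "open V" "V \<subseteq> U" "measure \<mu> U - e / 3 < measure \<mu> V"
    using finite_union_approx[OF \<mu> B U(2), of "e / 3"] \<open>e > 0\<close> by auto
  have "\<forall>\<^sub>F k in sequentially. measure \<mu> V - e / 3 < (\<integral>x. inner_bump V k x \<partial>\<mu>)"
    using integral_inner_bump_tendsto[OF \<mu> V(2)] \<open>e > 0\<close> by (intro order_tendstoD) auto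
  then obtain k where k: "measure \<mu> V - e / 3 < (\<integral>x. inner_bump V k x \<partial>\<mu>)"
    unfolding eventually_sequentially by blast
  let ?f = "inner_bump V k"
  have space: "space \<mu> = UNIV" using sets_eq_imp_space_eq[OF \<mu>(2)] by simp
  have f_int: "integrable \<mu> ?f"
    by (intro integrable_bounded_continuous \<mu> continuous_on_inner_bump bounded_inner_bump)
  have ind_int: "integrable \<mu> (\<lambda>x. indicator D x :: real)" if "D \<in> sets borel" for D
    using that \<mu>(2) by (intro integrable_real_indicator) (auto simp: emeasure_eq_measure)
  have U_borel: "U \<in> sets borel" using U(2) by simp
  have "(\<integral>x. \<bar>?f x - indicator A x\<bar> \<partial>\<mu>) \<le>
      (\<integral>x. (indicator U x - ?f x) + (indicator U x - indicator A x) \<partial>\<mu>)"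
  proof (rule integral_mono)
    show "integrable \<mu> (\<lambda>x. \<bar>?f x - indicator A x\<bar>)" using f_int ind_int[OF A] by auto
    show "integrable \<mu> (\<lambda>x. (indicator U x - ?f x) + (indicator U x - indicator A x))"
      using f_int ind_int[OF A] ind_int[OF U_borel] by auto
    show "\<bar>?f x - indicator A x\<bar> \<le> (indicator U x - ?f x) + (indicator U x - indicator A x)" for x
      using inner_bump_bounds(1,2)[of V k x] inner_bump_bounds(3)[of V k x] U(1) V(3)
      by (cases "x \<in> V") (auto simp: indicator_def split: if_splits)
  qed
  also have "\<dots> = (measure \<mu> U - (\<integral>x. ?f x \<partial>\<mu>)) + (measure \<mu> U - measure \<mu> A)"
    using f_int ind_int[OF A] ind_int[OF U_borel] by (simp add: space)
  also have "\<dots> < e" using U_lt V(4) k by linarith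
  finally show ?thesis using V(1) by blast
qed

lemma orbit_average_bounds:
  assumes "n \<ge> 1" "\<And>x. 0 \<le> f x" "\<And>x. f x \<le> 1"
  shows "0 \<le> orbit_average T n f x" "orbit_average T n f x \<le> 1"
proof -
  show "0 \<le> orbit_average T n f x"
    unfolding orbit_average_def using assms by (intro divide_nonneg_nonneg sum_nonneg) auto
  have "(\<Sum>l<n. f ((T ^^ l) x)) \<le> (\<Sum>l<n. 1)" using assms by (intro sum_mono) auto
  then show "orbit_average T n f x \<le> 1"
    unfolding orbit_average_def using assms(1) by (simp add: divide_le_eq)
qed

text \<open>If the orbit averages of functions that are dense in \<open>L\<^sup>1\<close> come close to constants, then so
  does the indicator of every invariant set.\<close>

lemma ergodicI:
  fixes \<mu> :: "'x::polish_space measure"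
  assumes \<mu>: "\<mu> \<in> invariant_measures T" and T: "T \<in> borel \<rightarrow>\<^sub>M borel"
    and B: "countable B" "topological_basis B"
    and crit: "\<And>V k \<delta>. V \<in> finite_unions B \<Longrightarrow> \<delta> > 0 \<Longrightarrow> \<exists>n\<ge>1.
      (\<integral>x. (orbit_average T n (inner_bump V k) x)\<^sup>2 \<partial>\<mu>) - (\<integral>x. inner_bump V k x \<partial>\<mu>)\<^sup>2 < \<delta>"
  shows "\<mu> \<in> ergodic_measures T"
proof -
  note \<mu>' = invariant_measuresD(1,2)[OF \<mu>]
  interpret prob_space \<mu> by (rule \<mu>')
  have space: "space \<mu> = UNIV" using sets_eq_imp_space_eq[OF \<mu>'(2)] by simp
  have "emeasure \<mu> A = 0 \<or> emeasure \<mu> A = 1" if A: "A \<in> sets borel" and inv: "T -` A = A" for A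
  proof -
    define a where "a = measure \<mu> A"
    have a: "0 \<le> a" "a \<le> 1" by (auto simp: a_def)
    have ind_T: "indicator A ((T ^^ l) x) = (indicator A x :: real)" for l x
    proof (induction l)
      case (Suc l)
      have "T y \<in> A \<longleftrightarrow> y \<in> A" for y using inv by blast
      then show ?case using Suc by (simp add: indicator_def)
    qed simp
    have ind_int: "integrable \<mu> (\<lambda>x. indicator A x :: real)"
      using A \<mu>'(2) by (intro integrable_real_indicator) (auto simp: emeasure_eq_measure)
    have bound: "\<bar>a - a\<^sup>2\<bar> \<le> 4 * e" if "e > 0" for e
    proof -
      obtain V k where V: "V \<in> finite_unions B" "(\<integral>x. \<bar>inner_bump V k x - indicator A x\<bar> \<partial>\<mu>) < e"
        using inner_bump_approx_indicator[OF \<mu>' B A \<open>e > 0\<close>] by blast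
      define f where "f = inner_bump V k"
      define c where "c = (\<integral>x. f x \<partial>\<mu>)"
      obtain n where n: "n \<ge> 1" "(\<integral>x. (orbit_average T n f x)\<^sup>2 \<partial>\<mu>) - c\<^sup>2 < e\<^sup>2"
        using crit[OF V(1), of "e\<^sup>2" k] \<open>e > 0\<close> unfolding f_def c_def by auto
      define g where "g = orbit_average T n f"
      have f01: "0 \<le> f x" "f x \<le> 1" for x unfolding f_def by (rule inner_bump_bounds)+
      have g01: "0 \<le> g x" "g x \<le> 1" for x unfolding g_def by (rule orbit_average_bounds[OF n(1) f01])+
      have f_meas: "f \<in> borel_measurable borel"
        unfolding f_def by (rule borel_measurable_continuous_onI[OF continuous_on_inner_bump])
      have f_int: "integrable \<mu> f"
        unfolding f_def by (intro integrable_bounded_continuous \<mu>' continuous_on_inner_bump bounded_inner_bump)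
      have fT_meas: "(\<lambda>x. f ((T ^^ l) x)) \<in> borel_measurable borel" for l
        by (rule measurable_compose[OF measurable_compose_n[OF T] f_meas])
      have fT_int: "integrable \<mu> (\<lambda>x. f ((T ^^ l) x))" for l
        using fT_meas f01 by (intro integrable_bounded_borel \<mu>') (auto intro!: boundedI[of _ 1])
      have g_meas: "g \<in> borel_measurable borel"
        unfolding g_def orbit_average_def using fT_meas by auto
      have g_int: "integrable \<mu> g"
        using g_meas g01 by (intro integrable_bounded_borel \<mu>') (auto intro!: boundedI[of _ 1])
      have "g x * g x \<le> 1" for x using mult_mono[of "g x" 1 "g x" 1] g01[of x] by simp
      then have g2_int: "integrable \<mu> (\<lambda>x. (g x)\<^sup>2)"
        using g_meas g01 by (intro integrable_bounded_borel \<mu>') (auto intro!: boundedI[of _ 1] simp: power2_eq_square)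
      have g_mean: "(\<integral>x. g x \<partial>\<mu>) = c"
        unfolding g_def orbit_average_def c_def using fT_int n(1)
          integral_invariant_measure_funpow[OF \<mu> T f_meas] by simp
      \<comment> \<open>Since \<open>A\<close> and \<mu> are invariant, averaging along orbits does
        not increase the \<open>L\<^sup>1\<close> distance to the indicator.\<close>
      have L1: "(\<integral>x. \<bar>g x - indicator A x\<bar> \<partial>\<mu>) < e"
      proof -
        let ?h = "\<lambda>x. \<bar>f x - indicator A x\<bar>"
        have h_meas: "?h \<in> borel_measurable borel" using f_meas A by auto
        have hT: "?h ((T ^^ l) x) = \<bar>f ((T ^^ l) x) - indicator A x\<bar>" for l x by (simp add: ind_T)
        have hT_int: "integrable \<mu> (\<lambda>x. ?h ((T ^^ l) x))" for l
          unfolding hT using fT_int ind_int by auto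
        have "(\<integral>x. \<bar>g x - indicator A x\<bar> \<partial>\<mu>) \<le> (\<integral>x. (\<Sum>l<n. ?h ((T ^^ l) x)) / real n \<partial>\<mu>)"
        proof (rule integral_mono)
          show "integrable \<mu> (\<lambda>x. \<bar>g x - indicator A x\<bar>)" using g_int ind_int by auto
          show "integrable \<mu> (\<lambda>x. (\<Sum>l<n. ?h ((T ^^ l) x)) / real n)" using hT_int by auto
          fix x
          have "g x - indicator A x = (\<Sum>l<n. f ((T ^^ l) x) - indicator A x) / real n"
            unfolding g_def orbit_average_def using n(1) by (simp add: sum_subtractf field_simps)
          then have "\<bar>g x - indicator A x\<bar> = \<bar>\<Sum>l<n. f ((T ^^ l) x) - indicator A x\<bar> / real n"
            by (simp add: abs_div)
          also have "\<dots> \<le> (\<Sum>l<n. \<bar>f ((T ^^ l) x) - indicator A x\<bar>) / real n"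
            by (intro divide_right_mono sum_abs) simp
          finally show "\<bar>g x - indicator A x\<bar> \<le> (\<Sum>l<n. ?h ((T ^^ l) x)) / real n" unfolding hT .
        qed
        also have "\<dots> = (\<Sum>l<n. \<integral>x. ?h ((T ^^ l) x) \<partial>\<mu>) / real n"
          using hT_int by simp
        also have "\<dots> = (\<integral>x. ?h x \<partial>\<mu>)"
          unfolding integral_invariant_measure_funpow[OF \<mu> T h_meas] using n(1) by simp
        also have "\<dots> < e" using V(2) by (simp add: f_def)
        finally show ?thesis .
      qed
      have "(\<integral>x. (g x - c)\<^sup>2 \<partial>\<mu>) = (\<integral>x. (g x)\<^sup>2 - 2 * c * g x + c\<^sup>2 \<partial>\<mu>)"
        by (intro Bochner_Integration.integral_cong) (auto simp: power2_diff)
      also have "\<dots> = (\<integral>x. (g x)\<^sup>2 \<partial>\<mu>) - c\<^sup>2"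
        using g2_int g_int g_mean by (simp add: prob_space power2_eq_square)
      finally have var: "(\<integral>x. (g x - c)\<^sup>2 \<partial>\<mu>) < e\<^sup>2" using n(2) by (simp add: g_def)
      have var_int: "integrable \<mu> (\<lambda>x. (g x - c)\<^sup>2)"
        unfolding power2_diff using g2_int g_int by auto
      have L1c: "(\<integral>x. \<bar>g x - c\<bar> \<partial>\<mu>) \<le> 2 * e"
      proof -
        \<comment> \<open>The inequality |t| \<le> e + t^2 / e turns the variance bound e^2 into an
          \<open>L\<^sup>1\<close> bound; this is why the criterion was applied with e^2.\<close>
        have "(\<integral>x. \<bar>g x - c\<bar> \<partial>\<mu>) \<le> (\<integral>x. e + (g x - c)\<^sup>2 / e \<partial>\<mu>)"
        proof (rule integral_mono)
          fix x
          show "\<bar>g x - c\<bar> \<le> e + (g x - c)\<^sup>2 / e"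
          proof (cases "\<bar>g x - c\<bar> \<le> e")
            case False
            then have "\<bar>g x - c\<bar> * e \<le> \<bar>g x - c\<bar> * \<bar>g x - c\<bar>" by (intro mult_left_mono) auto
            then have "\<bar>g x - c\<bar> \<le> (g x - c)\<^sup>2 / e"
              using \<open>e > 0\<close> by (simp add: pos_le_divide_eq power2_eq_square)
            then show ?thesis using \<open>e > 0\<close> by linarith
          qed (use \<open>e > 0\<close> in \<open>simp add: add_increasing2\<close>)
        qed (use g_int var_int in auto)
        also have "\<dots> = e + (\<integral>x. (g x - c)\<^sup>2 \<partial>\<mu>) / e" using var_int by (simp add: prob_space)
        also have "(\<integral>x. (g x - c)\<^sup>2 \<partial>\<mu>) / e \<le> e"
          using var \<open>e > 0\<close> by (simp add: pos_divide_le_eq power2_eq_square)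
        finally show ?thesis by simp
      qed
      have "\<bar>c - a\<bar> = \<bar>\<integral>x. f x - indicator A x \<partial>\<mu>\<bar>"
        using f_int ind_int by (simp add: c_def a_def space)
      also have "\<dots> \<le> (\<integral>x. \<bar>f x - indicator A x\<bar> \<partial>\<mu>)" by (rule integral_abs_bound)
      finally have ca: "\<bar>c - a\<bar> \<le> e" using V(2) by (simp add: f_def)
      \<comment> \<open>On \<open>A\<close> the average \<open>g\<close> is close to both 1 and
        \<open>c\<close>. This forces a |1 - c| to be small, and \<open>c\<close> itself is close to
        \<open>a\<close>, so a - a^2 is small.\<close>
      have "a * \<bar>1 - c\<bar> = (\<integral>x. indicator A x * \<bar>1 - c\<bar> \<partial>\<mu>)"
        using ind_int by (simp add: a_def space)
      also have "\<dots> \<le> (\<integral>x. \<bar>g x - indicator A x\<bar> + \<bar>g x - c\<bar> \<partial>\<mu>)"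
        by (rule integral_mono) (use g_int ind_int in \<open>auto simp: indicator_def\<close>)
      also have "\<dots> = (\<integral>x. \<bar>g x - indicator A x\<bar> \<partial>\<mu>) + (\<integral>x. \<bar>g x - c\<bar> \<partial>\<mu>)"
        using g_int ind_int by (intro Bochner_Integration.integral_add) auto
      also have "\<dots> \<le> 3 * e" using L1 L1c by simp
      finally have "\<bar>a * (1 - c)\<bar> \<le> 3 * e" using a by (simp add: abs_mult)
      moreover have "\<bar>a * (c - a)\<bar> \<le> 1 * e" unfolding abs_mult using a ca by (intro mult_mono) auto
      moreover have "a - a\<^sup>2 = a * (1 - c) + a * (c - a)" by (simp add: power2_eq_square algebra_simps)
      ultimately show ?thesis by linarith
    qed
    have "a - a\<^sup>2 = 0"
    proof (rule ccontr)
      assume "a - a\<^sup>2 \<noteq> 0"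
      then show False using bound[of "\<bar>a - a\<^sup>2\<bar> / 8"] by simp
    qed
    then have "a * (1 - a) = 0" by (simp add: power2_eq_square algebra_simps)
    then show ?thesis by (auto simp: a_def emeasure_eq_measure)
  qed
  then show ?thesis using \<mu> by (auto simp: ergodic_measures_def)
qed

text \<open>An intermediate value s separates the two integrals, so the set is a union of
  intersections of two subbasic sets.\<close>

lemma (in borel_prob_family) openin_integral_diff_square_less:
  fixes f g :: "'x \<Rightarrow> real"
  assumes "continuous_on UNIV f" "bounded (range f)" "continuous_on UNIV g" "bounded (range g)"
  shows "openin W {\<mu> \<in> S. (\<integral>x. g x \<partial>\<mu>) - (\<integral>x. f x \<partial>\<mu>)\<^sup>2 < c}"
proof -
  have op: "open {t::real. s - t\<^sup>2 < c}" for s by (intro open_Collect_less continuous_intros)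
  have eq: "(u - v\<^sup>2 < c) \<longleftrightarrow> (\<exists>s. u < s \<and> s - v\<^sup>2 < c)" for u v :: real
  proof
    assume "u - v\<^sup>2 < c"
    then have "u < c + v\<^sup>2" by simp
    then obtain s where "u < s" "s < c + v\<^sup>2" using dense by blast
    then show "\<exists>s. u < s \<and> s - v\<^sup>2 < c" by (intro exI[of _ s]) auto
  qed auto
  have "{\<mu> \<in> S. (\<integral>x. g x \<partial>\<mu>) - (\<integral>x. f x \<partial>\<mu>)\<^sup>2 < c} =
      (\<Union>s. {\<mu> \<in> S. (\<integral>x. g x \<partial>\<mu>) \<in> {..<s}} \<inter> {\<mu> \<in> S. (\<integral>x. f x \<partial>\<mu>) \<in> {t. s - t\<^sup>2 < c}})"
  proof (rule set_eqI)
    fix \<mu>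
    show "\<mu> \<in> {\<mu> \<in> S. (\<integral>x. g x \<partial>\<mu>) - (\<integral>x. f x \<partial>\<mu>)\<^sup>2 < c} \<longleftrightarrow> \<mu> \<in>
        (\<Union>s. {\<mu> \<in> S. (\<integral>x. g x \<partial>\<mu>) \<in> {..<s}} \<inter> {\<mu> \<in> S. (\<integral>x. f x \<partial>\<mu>) \<in> {t. s - t\<^sup>2 < c}})"
      using eq[of "\<integral>x. g x \<partial>\<mu>" "\<integral>x. f x \<partial>\<mu>"] by auto
  qed
  also have "openin W \<dots>"
    by (intro openin_Union) (auto intro!: openin_Int openin_weak_integral assms op open_lessThan simp del: lessThan_iff mem_Collect_eq)
  finally show ?thesis .
qed

section \<open>Orbit averages along periodic orbits\<close>

lemma sum_cyclic_seq_shift: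
  fixes f :: "'a biseq \<Rightarrow> real"
  shows "(\<Sum>l<P. f (cyclic_seq P b (j + l))) = (\<Sum>l<P. f (cyclic_seq P b l))"
proof (induction j)
  case (Suc j)
  have "(\<Sum>l<P. f (cyclic_seq P b (Suc j + l))) + f (cyclic_seq P b j) = (\<Sum>l<Suc P. f (cyclic_seq P b (j + l)))"
    by (subst sum.lessThan_Suc_shift) simp
  also have "\<dots> = (\<Sum>l<P. f (cyclic_seq P b (j + l))) + f (cyclic_seq P b j)"
    using cyclic_seq_add_period[of P b j] by simp
  finally show ?case using Suc by simp
qed simp

text \<open>Over a full period the average takes the same value at every phase, so its variance
  under the orbit measure is exactly 0. This places the periodic orbit measures in all sets of the
  ergodicity criterion.\<close>

lemma orbit_average_cyclic_seq:
  "orbit_average full_shift P f (cyclic_seq P b j) = (\<Sum>l<P. f (cyclic_seq P b l)) / real P"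
  unfolding orbit_average_def full_shift_funpow_cyclic_seq sum_cyclic_seq_shift ..

lemma continuous_on_orbit_average:
  fixes T :: "'x::topological_space \<Rightarrow> 'x"
  assumes "continuous_on UNIV T" "continuous_on UNIV f"
  shows "continuous_on UNIV (orbit_average T n f)"
proof -
  have "continuous_on UNIV (\<lambda>x. f ((T ^^ l) x))" for l
    by (rule continuous_on_compose2[OF assms(2) continuous_on_funpow[OF assms(1)]]) simp
  then show ?thesis unfolding orbit_average_def[abs_def] divide_inverse by (intro continuous_intros)
qed

section \<open>Generic properties on dense sets\<close>

lemma lower_rec_eq_0_of_hit:
  assumes "n \<ge> 1" "(T ^^ n) x = y"
  shows "lower_rec T x y = 0"
  unfolding lower_rec_eq_0_iff
proof (intro allI)
  fix a J
  \<comment> \<open>The second term makes \<open>n\<close> an admissible time for the rate 1 / (a +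
    1); the first makes r small.\<close>
  define r where "r = min (1 / 2 ^ (J + 3)) (real n powr (- real (Suc a)))"
  have r: "0 < r" "r \<le> real n powr (- real (Suc a))" using assms(1) by (auto simp: r_def)
  have "r \<le> 1 / 2 ^ (J + 3)" by (simp add: r_def)
  also have "\<dots> < 1 / 2 ^ (J + 2)" by (intro divide_strict_left_mono power_strict_increasing) auto
  finally have "r < 1 / 2 ^ (J + 2)" .
  have "real n = (real n powr (- real (Suc a))) powr (- 1 / real (Suc a))"
    using assms(1) by (simp add: powr_powr del: of_nat_Suc)
  also have "\<dots> \<le> r powr (- 1 / real (Suc a))"
    using r by (intro powr_mono2') auto
  finally have "real n \<le> r powr (- 1 / real (Suc a))" .
  moreover have "dist y ((T ^^ n) x) < 2 * r" using assms(2) r(1) by simp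
  ultimately show "rec_close T a J x y"
    unfolding rec_close_def using r(1) \<open>r < 1 / 2 ^ (J + 2)\<close> assms(1) by blast
qed

lemma lower_rec_cyclic_seq:
  assumes "i < P" "j < P"
  shows "lower_rec full_shift (cyclic_seq P b i) (cyclic_seq P b j :: 'a::metric_space biseq) = 0"
proof (rule lower_rec_eq_0_of_hit)
  show "j + P - i \<ge> 1" using assms by simp
  have "i + (j + P - i) = j + P" using assms by simp
  then show "(full_shift ^^ (j + P - i)) (cyclic_seq P b i) = cyclic_seq P b j"
    unfolding full_shift_funpow_cyclic_seq by (simp add: cyclic_seq_add_period)
qed

lemma hausdorff_measure_finite:
  assumes "finite E" "\<alpha> > 0"
  shows "hausdorff_measure \<alpha> E = 0"
proof (rule hausdorff_measure_eq_0I[OF assms(2)])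
  fix e :: real assume "e > 0"
  obtain xs where xs: "set xs = E" using finite_list[OF assms(1)] by blast
  define C where "C k = (if k < length xs then {xs ! k} else {})" for k
  have "E \<subseteq> (\<Union>k. C k)" unfolding C_def using xs by (auto simp: in_set_conv_nth)
  moreover have "bounded (C k)" for k by (simp add: C_def)
  moreover have "diameter (C k) = 0" for k by (simp add: C_def)
  then have "(\<Sum>k. ennreal (diameter (C k) powr \<alpha>)) < ennreal e" using \<open>e > 0\<close> by simp
  ultimately show "\<exists>C. E \<subseteq> (\<Union>k::nat. C k) \<and> (\<forall>k. bounded (C k)) \<and> (\<Sum>k. ennreal (diameter (C k) powr \<alpha>)) < ennreal e"
    by blast
qed

section \<open>Consequences of fast decay\<close>

lemma AE_eventually_not_hit:
  fixes \<mu> :: "'x measure" and R :: "nat \<Rightarrow> nat \<Rightarrow> 'x set"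
  assumes \<mu>: "prob_space \<mu>" and meas: "\<And>j n. R j n \<in> sets \<mu>"
    and decay: "\<And>j n. j \<ge> e \<Longrightarrow> n \<ge> 1 \<Longrightarrow> emeasure \<mu> (R j n) \<le> ennreal (1 / 2 ^ Suc a) ^ (j - e)"
  shows "AE x in \<mu>. \<forall>\<^sub>F j in sequentially. \<forall>n\<ge>1. n \<le> 2 ^ (j * a) \<longrightarrow> x \<notin> R j n"
proof -
  interpret prob_space \<mu> by fact
  define U where "U j = (if j \<ge> e then (\<Union>n\<in>{1..2 ^ (j * a)}. R j n) else {})" for j
  have U_meas: "U j \<in> sets \<mu>" for j
    unfolding U_def using meas by auto
  \<comment> \<open>The union bound over 2^(j a) times is beaten by the rate a + 1: what remains is
    1 / 2^j, with the constant 2^(e (a + 1)) from the offset \<open>e\<close>. Borel-Cantelli then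
    applies.\<close>
  have U_bound: "measure \<mu> (U j) \<le> 2 ^ (e * Suc a) * (1 / 2) ^ j" for j
  proof (cases "j \<ge> e")
    case True
    then obtain i where j: "j = e + i" using le_Suc_ex by blast
    have R_bound: "measure \<mu> (R j n) \<le> (1 / 2 ^ Suc a) ^ i" if "n \<ge> 1" for n
    proof -
      have "ennreal (measure \<mu> (R j n)) \<le> ennreal ((1 / 2 ^ Suc a) ^ i)"
        using decay[OF True that] by (simp add: j emeasure_eq_measure ennreal_power)
      then show ?thesis by (subst (asm) ennreal_le_iff) auto
    qed
    have "measure \<mu> (U j) \<le> (\<Sum>n\<in>{1..2 ^ (j * a)}. measure \<mu> (R j n))"
      using True meas unfolding U_def by (auto intro!: finite_measure_subadditive_finite)
    also have "\<dots> \<le> (\<Sum>n\<in>{1..2 ^ (j * a) :: nat}. (1 / 2 ^ Suc a) ^ i)"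
      using R_bound by (intro sum_mono) auto
    also have "\<dots> = 2 ^ (j * a) * (1 / 2 ^ Suc a) ^ i" by simp
    also have "\<dots> = 2 ^ (e * Suc a) * (1 / 2) ^ j"
      unfolding j by (simp add: power_add power_mult power_divide power_mult_distrib field_simps)
    finally show ?thesis .
  qed (simp add: U_def)
  have "summable (\<lambda>j. measure \<mu> (U j))"
    by (rule summable_comparison_test'[of "\<lambda>j. 2 ^ (e * Suc a) * (1 / 2) ^ j" 0])
      (use U_bound in \<open>auto intro!: summable_mult summable_geometric\<close>)
  then have "AE x in \<mu>. \<forall>\<^sub>F j in sequentially. x \<in> space \<mu> - U j"
    by (intro borel_cantelli_AE1 U_meas) (auto simp: emeasure_eq_measure)
  then show ?thesis
  proof (rule AE_mp[OF _ AE_I2], intro impI)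
    fix x assume ev: "\<forall>\<^sub>F j in sequentially. x \<in> space \<mu> - U j"
    show "\<forall>\<^sub>F j in sequentially. \<forall>n\<ge>1. n \<le> 2 ^ (j * a) \<longrightarrow> x \<notin> R j n"
      using ev eventually_ge_at_top[of e] by eventually_elim (auto simp: U_def)
  qed
qed

text \<open>The witness is the dyadic radius r = 1 / 2^j, for which r powr (- a) is exactly 2^(j
  a).\<close>

lemma rec_far_of_eventually:
  assumes "\<forall>\<^sub>F j in sequentially. \<forall>n\<ge>1. n \<le> 2 ^ (j * a) \<longrightarrow> 1 / 2 ^ j < dist y ((T ^^ n) x)"
  shows "rec_far T a J x y"
proof -
  obtain j where j: "j \<ge> J + 3" "\<And>n. n \<ge> 1 \<Longrightarrow> n \<le> 2 ^ (j * a) \<Longrightarrow> 1 / 2 ^ j < dist y ((T ^^ n) x)"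
    using eventually_happens[OF eventually_conj[OF assms eventually_ge_at_top[of "J + 3"]]] by auto
  have "(2::real) ^ (J + 2) < 2 ^ j" using j(1) by (intro power_strict_increasing) auto
  then have "1 / 2 ^ j < 1 / (2::real) ^ (J + 2)" by (simp add: frac_less2)
  moreover have "(1 / 2 ^ j) powr (- real a) = (2::real) ^ (j * a)"
    by (simp add: powr_minus powr_realpow power_divide power_mult)
  then have "\<forall>n\<ge>1. real n \<le> (1 / 2 ^ j) powr (- real a) \<longrightarrow> 1 / 2 ^ j < dist y ((T ^^ n) x)"
    using j(2) by simp
  ultimately show ?thesis unfolding rec_far_def by (intro exI[of _ "1 / 2 ^ j"]) auto
qed

context
  fixes \<mu> :: "'a::polish_space biseq measure"
  assumes \<mu>: "prob_space \<mu>" "sets \<mu> = sets borel" and decay: "fast_decay \<mu>"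
begin

lemma fast_decay_upper_rec: "AE x in \<mu>. upper_rec full_shift x x = \<infinity>"
proof -
  have "AE x in \<mu>. rec_far full_shift a J x x" for a J
  proof -
    obtain e where "\<And>j n. j \<ge> e \<Longrightarrow> n \<ge> 1 \<Longrightarrow>
        emeasure \<mu> {x. dist ((full_shift ^^ n) x) x \<le> 1 / 2 ^ j} \<le> ennreal (1 / 2 ^ Suc a) ^ (j - e)"
      using decay unfolding fast_decay_def by blast
    moreover have "{x. dist ((full_shift ^^ n) x) x \<le> 1 / 2 ^ j} \<in> sets \<mu>" for j n
      unfolding \<mu>(2) by (intro borel_closed closed_return_set)
    ultimately have "AE x in \<mu>. \<forall>\<^sub>F j in sequentially. \<forall>n\<ge>1. n \<le> 2 ^ (j * a) \<longrightarrow>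
        x \<notin> {x. dist ((full_shift ^^ n) x) x \<le> 1 / 2 ^ j}"
      by (intro AE_eventually_not_hit[OF \<mu>(1)])
    then show ?thesis
      by (rule eventually_mono) (auto intro!: rec_far_of_eventually simp: not_le dist_commute)
  qed
  then show ?thesis unfolding upper_rec_eq_infinity_iff by (simp add: AE_all_countable)
qed

text \<open>By Fubini the first point is fixed; its orbit is then a sequence of given centres, and
  the uniform bound on the mass of balls applies to the second point.\<close>

lemma fast_decay_upper_rec_pair: "AE (x, y) in \<mu> \<Otimes>\<^sub>M \<mu>. upper_rec full_shift x y = \<infinity>"
proof -
  have "AE p in \<mu> \<Otimes>\<^sub>M \<mu>. rec_far full_shift a J (fst p) (snd p)" for a J
  proof (subst AE_pair_borel_iff[OF \<mu>])
    show "{p :: 'a biseq \<times> 'a biseq. rec_far full_shift a J (fst p) (snd p)} \<in> sets borel"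
      by (intro borel_open open_rec_far continuous_on_full_shift)
    have "AE y in \<mu>. rec_far full_shift a J x y" for x
    proof -
      obtain e where "\<And>j z. j \<ge> e \<Longrightarrow> emeasure \<mu> (cball z (1 / 2 ^ j)) \<le> ennreal (1 / 2 ^ Suc a) ^ (j - e)"
        using decay unfolding fast_decay_def by blast
      moreover have "cball z r \<in> sets \<mu>" for z r unfolding \<mu>(2) by simp
      ultimately have "AE y in \<mu>. \<forall>\<^sub>F j in sequentially. \<forall>n\<ge>1. n \<le> 2 ^ (j * a) \<longrightarrow>
          y \<notin> cball ((full_shift ^^ n) x) (1 / 2 ^ j)"
        by (intro AE_eventually_not_hit[OF \<mu>(1), where R="\<lambda>j n. cball ((full_shift ^^ n) x) (1 / 2 ^ j)"])
      then show ?thesis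
        by (rule eventually_mono) (auto intro!: rec_far_of_eventually simp: not_le dist_commute)
    qed
    then show "AE x in \<mu>. AE y in \<mu>. rec_far full_shift a J (fst (x, y)) (snd (x, y))" by simp
  qed
  then have "AE p in \<mu> \<Otimes>\<^sub>M \<mu>. \<forall>a J. rec_far full_shift a J (fst p) (snd p)"
    unfolding AE_all_countable by blast
  then show ?thesis by (rule eventually_mono) (auto simp: upper_rec_eq_infinity_iff)
qed

end

interpretation shift: borel_prob_family "invariant_measures (full_shift :: 'a::polish_space biseq \<Rightarrow> _)"
  by (rule borel_prob_family.intro) (rule invariant_measuresD, assumption)+

lemma fast_decay_thin:
  fixes \<mu> :: "'a::polish_space biseq measure"
  assumes "prob_space \<mu>" "fast_decay \<mu>"
  shows "thin_along_subsequence \<mu>"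
  unfolding thin_along_subsequence_def
proof (intro allI AE_I2)
  interpret prob_space \<mu> by fact
  fix a J :: nat and x
  obtain e where e: "\<And>j z. j \<ge> e \<Longrightarrow> emeasure \<mu> (cball z (1 / 2 ^ j)) \<le> ennreal (1 / 2 ^ Suc a) ^ (j - e)"
    using assms(2) unfolding fast_decay_def by blast
  \<comment> \<open>The inequality (e + i) a < (a + 1) i asks for i > e a, and the summand
    \<open>J\<close> makes the index at least \<open>J\<close>.\<close>
  define i where "i = J + e * Suc a + 1"
  have "emeasure \<mu> (cball x (1 / 2 ^ (e + i))) \<le> ennreal (1 / 2 ^ Suc a) ^ i"
    using e[of "e + i" x] by simp
  then have "ennreal (measure \<mu> (cball x (1 / 2 ^ (e + i)))) \<le> ennreal ((1 / 2 ^ Suc a) ^ i)"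
    by (simp add: emeasure_eq_measure ennreal_power)
  then have "measure \<mu> (cball x (1 / 2 ^ (e + i))) \<le> (1 / 2 ^ Suc a) ^ i"
    by (subst (asm) ennreal_le_iff) auto
  also have "\<dots> = (1 / 2) ^ (Suc a * i)" by (simp only: power_mult power_one_over)
  also have "\<dots> < (1 / 2) ^ ((e + i) * a)"
    by (intro power_strict_decreasing) (auto simp: i_def algebra_simps)
  finally show "\<exists>j\<ge>J. measure \<mu> (cball x (1 / 2 ^ j)) < (1 / 2) ^ (j * a)"
    by (intro exI[of _ "e + i"]) (auto simp: i_def)
qed

section \<open>Dense families of invariant measures\<close>

lemma dense_in_superset:
  assumes "dense_in X A" "A \<subseteq> B" "B \<subseteq> topspace X"
  shows "dense_in X B"
  using assms closure_of_mono[OF assms(2), of X] closure_of_subset_topspace[of X B]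
  unfolding dense_in_def by auto

lemma dense_cyclic_measures:
  "dense_in shift.W {cyclic_measure P (b :: nat \<Rightarrow> 'a::polish_space) | P b. P > 0}"
proof (rule shift.dense_in_weakI)
  show "{cyclic_measure P (b :: nat \<Rightarrow> 'a) | P b. P > 0} \<subseteq> invariant_measures full_shift"
    using cyclic_measure_invariant by blast
  fix \<mu> :: "'a biseq measure" and F :: "('a biseq \<Rightarrow> real) set" and e :: real
  assume "\<mu> \<in> invariant_measures full_shift" "finite F" "\<And>f. f \<in> F \<Longrightarrow> bounded_lipschitz f" "e > 0"
  from cyclic_measure_approx[OF this] show "\<exists>\<nu>\<in>{cyclic_measure P b | P b. P > 0}.
      \<forall>f\<in>F. \<bar>(\<integral>x. f x \<partial>\<nu>) - (\<integral>x. f x \<partial>\<mu>)\<bar> < e" by blast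
qed

lemma dense_fast_decay:
  "dense_in shift.W {\<nu> \<in> invariant_measures (full_shift :: 'a::{polish_space, perfect_space} biseq \<Rightarrow> _). fast_decay \<nu>}"
  by (rule shift.dense_in_weakI[OF _ fast_decay_approx]) auto

text \<open>Mixing any measure with a little of a fully supported one gives full support and moves
  finitely many integrals only slightly.\<close>

lemma dense_full_support:
  "dense_in shift.W {\<nu> \<in> invariant_measures (full_shift :: 'a::polish_space biseq \<Rightarrow> _). msupp \<nu> = UNIV}"
proof (rule shift.dense_in_weakI)
  fix \<mu> :: "'a biseq measure" and F :: "('a biseq \<Rightarrow> real) set" and e :: real
  assume \<mu>: "\<mu> \<in> invariant_measures full_shift" and F: "finite F" "\<And>f. f \<in> F \<Longrightarrow> bounded_lipschitz f" and "e > 0"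
  obtain \<nu>0 :: "'a biseq measure" where \<nu>0: "\<nu>0 \<in> invariant_measures full_shift"
      "\<And>U. open U \<Longrightarrow> U \<noteq> {} \<Longrightarrow> emeasure \<nu>0 U > 0"
    using exists_full_support by blast
  obtain C where C: "C > 0" "\<And>f x. f \<in> F \<Longrightarrow> \<bar>f x\<bar> \<le> C"
    using bounded_lipschitz_uniform[OF F] by metis
  \<comment> \<open>Each integral moves by at most 2 C t \<le> e / 2; the minimum with 1 makes
    \<open>t\<close> a probability.\<close>
  define t where "t = min 1 (e / (4 * C))"
  have t: "0 < t" "t \<le> 1" using C(1) \<open>e > 0\<close> by (auto simp: t_def)
  define K where "K b = (if b then \<nu>0 else \<mu>)" for b
  have K: "K b \<in> invariant_measures full_shift" for b using \<mu> \<nu>0 by (simp add: K_def)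
  note K' = invariant_measuresD(1,2)[OF K]
  define \<nu> where "\<nu> = mixture (bernoulli_pmf t) K"
  have "\<nu> \<in> invariant_measures full_shift"
    unfolding \<nu>_def by (rule mixture_invariant[OF K measurable_full_shift])
  moreover have "emeasure \<nu> U > 0" if "open U" "x \<in> U" for U x
  proof -
    have "emeasure \<nu> U = emeasure \<nu>0 U * ennreal t + emeasure \<mu> U * ennreal (1 - t)"
      unfolding \<nu>_def using that t by (subst emeasure_mixture[OF K']) (auto simp: K_def)
    moreover have "emeasure \<nu>0 U * ennreal t > 0"
      using \<nu>0(2)[of U] that t by (auto simp: ennreal_zero_less_mult_iff)
    ultimately show ?thesis by (simp add: add_pos_nonneg)
  qed
  then have "msupp \<nu> = UNIV" by (auto simp: msupp_def)
  moreover have "\<bar>(\<integral>x. f x \<partial>\<nu>) - (\<integral>x. f x \<partial>\<mu>)\<bar> < e" if f: "f \<in> F" for f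
  proof -
    have meas: "f \<in> borel_measurable borel" and bdd: "bounded (range f)"
      using F(2)[OF f] bounded_lipschitz_continuous by (auto simp: bounded_lipschitz_def intro: borel_measurable_continuous_onI)
    have abs_le: "\<bar>\<integral>x. f x \<partial>K b\<bar> \<le> C" for b
    proof -
      interpret Kb: prob_space "K b" by (rule K')
      have int: "integrable (K b) f" by (rule integrable_bounded_borel[OF K' meas bdd])
      have "- C \<le> f x" "f x \<le> C" for x using C(2)[OF f, of x] by linarith+
      then have "- C \<le> (\<integral>x. f x \<partial>K b)" "(\<integral>x. f x \<partial>K b) \<le> C"
        by (auto intro!: Kb.integral_ge_const Kb.integral_le_const int)
      then show ?thesis by linarith
    qed
    have "(\<integral>x. f x \<partial>\<nu>) = (\<integral>x. f x \<partial>K True) * t + (\<integral>x. f x \<partial>K False) * (1 - t)"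
      unfolding \<nu>_def using t by (subst integral_mixture[OF K' meas bdd]) simp
    then have "(\<integral>x. f x \<partial>\<nu>) - (\<integral>x. f x \<partial>\<mu>) = t * ((\<integral>x. f x \<partial>K True) - (\<integral>x. f x \<partial>K False))"
      by (simp add: K_def algebra_simps)
    then have "\<bar>(\<integral>x. f x \<partial>\<nu>) - (\<integral>x. f x \<partial>\<mu>)\<bar> = t * \<bar>(\<integral>x. f x \<partial>K True) - (\<integral>x. f x \<partial>K False)\<bar>"
      using t by (simp add: abs_mult)
    also have "\<dots> \<le> t * (2 * C)" using t abs_le[of True] abs_le[of False] by (intro mult_left_mono) linarith+
    also have "\<dots> \<le> e / (4 * C) * (2 * C)" using C(1) by (intro mult_right_mono) (auto simp: t_def)
    also have "\<dots> < e" using C(1) \<open>e > 0\<close> by simp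
    finally show ?thesis .
  qed
  ultimately show "\<exists>\<nu>\<in>{\<nu> \<in> invariant_measures full_shift. msupp \<nu> = UNIV}.
      \<forall>f\<in>F. \<bar>(\<integral>x. f x \<partial>\<nu>) - (\<integral>x. f x \<partial>\<mu>)\<bar> < e" by blast
qed auto

lemma dense_gdelta_of_cyclic:
  fixes Q :: "'a::polish_space biseq measure \<Rightarrow> bool"
  assumes "gdelta_in shift.W {\<mu> \<in> invariant_measures full_shift. Q \<mu>}"
    and "\<And>P b. P > 0 \<Longrightarrow> Q (cyclic_measure P b)"
  shows "dense_gdelta_in shift.W {\<mu> \<in> invariant_measures full_shift. Q \<mu>}"
  unfolding dense_gdelta_in_def
proof
  show "dense_in shift.W {\<mu> \<in> invariant_measures full_shift. Q \<mu>}"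
    by (rule dense_in_superset[OF dense_cyclic_measures])
      (use assms(2) cyclic_measure_invariant in \<open>auto simp: topspace_weak_topology\<close>)
qed fact

lemma dense_gdelta_of_fast_decay:
  fixes Q :: "'a::{polish_space, perfect_space} biseq measure \<Rightarrow> bool"
  assumes "gdelta_in shift.W {\<mu> \<in> invariant_measures full_shift. Q \<mu>}"
    and "\<And>\<mu>. \<mu> \<in> invariant_measures full_shift \<Longrightarrow> fast_decay \<mu> \<Longrightarrow> Q \<mu>"
  shows "dense_gdelta_in shift.W {\<mu> \<in> invariant_measures full_shift. Q \<mu>}"
  unfolding dense_gdelta_in_def
proof
  show "dense_in shift.W {\<mu> \<in> invariant_measures full_shift. Q \<mu>}"
    by (rule dense_in_superset[OF dense_fast_decay])
      (use assms(2) in \<open>auto simp: topspace_weak_topology\<close>)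
qed fact

lemma cyclic_measure_has_hausdorff_dim_0:
  fixes b :: "nat \<Rightarrow> 'a::polish_space"
  assumes "P > 0"
  shows "has_dim hausdorff_dim (cyclic_measure P b) 0"
proof (rule shift.has_hausdorff_dim_0I)
  show inv: "cyclic_measure P b \<in> invariant_measures full_shift" by (rule cyclic_measure_invariant[OF assms])
  let ?E = "cyclic_seq P b ` {..<P}"
  have E: "?E \<in> sets borel" by (intro borel_closed finite_imp_closed) auto
  have "AE x in cyclic_measure P b. x \<notin> - ?E" using AE_cyclic_measure[OF assms, of b] by simp
  moreover have "- ?E \<in> sets (cyclic_measure P b)"
    using E invariant_measuresD(2)[OF inv] by (simp add: borel_comp)
  ultimately have "emeasure (cyclic_measure P b) (- ?E) = 0"
    using AE_iff_null_sets[of "- ?E" "cyclic_measure P b"] by auto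
  then show "\<exists>E\<in>sets borel. emeasure (cyclic_measure P b) (- E) = 0 \<and> hausdorff_measure (1 / real (Suc n)) E = 0" for n
    using E by (intro bexI[of _ ?E] conjI hausdorff_measure_finite) auto
qed

lemma cyclic_measure_lower_rec_pair:
  fixes b :: "nat \<Rightarrow> 'a::polish_space"
  assumes "P > 0"
  shows "AE (x, y) in cyclic_measure P b \<Otimes>\<^sub>M cyclic_measure P b. lower_rec full_shift x y = 0"
proof -
  let ?\<mu> = "cyclic_measure P b" and ?E = "cyclic_seq P b ` {..<P}"
  note inv = invariant_measuresD(1,2)[OF cyclic_measure_invariant[OF assms, of b]]
  have "AE p in ?\<mu> \<Otimes>\<^sub>M ?\<mu>. p \<in> ?E \<times> ?E"
  proof (subst AE_pair_borel_iff[OF inv])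
    have "closed (?E \<times> ?E)" by (intro finite_imp_closed) auto
    then show "{p. p \<in> ?E \<times> ?E} \<in> sets borel" by simp
    have *: "AE x in ?\<mu>. x \<in> ?E" by (rule AE_cyclic_measure[OF assms])
    show "AE x in ?\<mu>. AE y in ?\<mu>. (x, y) \<in> ?E \<times> ?E"
      using * by (rule eventually_mono) (use * in auto)
  qed
  then show ?thesis
    by (rule eventually_mono) (auto simp: lower_rec_cyclic_seq)
qed

text \<open>\<open>G\<close> asks for small variance of some orbit average, for countably many bump
  functions and bounds. The integrands are continuous, so each set is open; it contains the periodic
  orbit measures, with \<open>n\<close> equal to the period; and all of them together imply
  ergodicity.\<close>

lemma residual_ergodic:
  "residual_in shift.W (ergodic_measures (full_shift :: 'a::polish_space biseq \<Rightarrow> _))"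
proof -
  let ?T = "full_shift :: 'a biseq \<Rightarrow> _"
  obtain B :: "'a biseq set set" where B: "countable B" "topological_basis B"
    using ex_countable_basis by blast
  define G where "G = (\<lambda>(V, k, m). {\<mu> \<in> invariant_measures ?T. \<exists>n\<ge>1.
      (\<integral>x. (orbit_average ?T n (inner_bump V k) x)\<^sup>2 \<partial>\<mu>) - (\<integral>x. inner_bump V k x \<partial>\<mu>)\<^sup>2 < 1 / real (Suc m)})"
  have sq: "continuous_on UNIV (\<lambda>x. (orbit_average ?T n (inner_bump V k) x)\<^sup>2)"
    "bounded (range (\<lambda>x. (orbit_average ?T n (inner_bump V k) x)\<^sup>2))" if "n \<ge> 1" for n V k
  proof -
    show "continuous_on UNIV (\<lambda>x. (orbit_average ?T n (inner_bump V k) x)\<^sup>2)"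
      by (intro continuous_intros continuous_on_orbit_average continuous_on_full_shift continuous_on_inner_bump)
    have "0 \<le> orbit_average ?T n (inner_bump V k) x" "orbit_average ?T n (inner_bump V k) x \<le> 1" for x
      by (rule orbit_average_bounds[OF that inner_bump_bounds(1,2)])+
    then show "bounded (range (\<lambda>x. (orbit_average ?T n (inner_bump V k) x)\<^sup>2))"
      by (intro boundedI[of _ 1]) (auto simp: power_le_one)
  qed
  show ?thesis
  proof (rule residual_inI[OF dense_cyclic_measures, where I="finite_unions B \<times> UNIV \<times> UNIV" and G=G])
    show "countable (finite_unions B \<times> (UNIV :: nat set) \<times> (UNIV :: nat set))"
      using countable_finite_unions[OF B(1)] by auto
    fix i assume "i \<in> finite_unions B \<times> (UNIV :: nat set) \<times> (UNIV :: nat set)"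
    then obtain V k m where i: "i = (V, k, m)" "V \<in> finite_unions B" by auto
    have "G i = (\<Union>n\<in>{1..}. {\<mu> \<in> invariant_measures ?T.
      (\<integral>x. (orbit_average ?T n (inner_bump V k) x)\<^sup>2 \<partial>\<mu>) - (\<integral>x. inner_bump V k x \<partial>\<mu>)\<^sup>2 < 1 / real (Suc m)})"
      by (auto simp: G_def i)
    also have "openin shift.W \<dots>"
      by (intro openin_Union ballI)
        (auto intro!: shift.openin_integral_diff_square_less sq continuous_on_inner_bump bounded_inner_bump)
    finally show "openin shift.W (G i)" .
    show "{cyclic_measure P b | P b. P > 0} \<subseteq> G i"
    proof safe
      fix P :: nat and b :: "nat \<Rightarrow> 'a" assume P: "P > 0"
      let ?f = "inner_bump V k"
      define c where "c = (\<Sum>l<P. ?f (cyclic_seq P b l)) / real P"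
      have "P \<ge> 1" using P by simp
      have "(\<integral>x. ?f x \<partial>cyclic_measure P b) = c"
        unfolding c_def using borel_measurable_continuous_onI[OF continuous_on_inner_bump] bounded_inner_bump
        by (intro integral_cyclic_measure P)
      moreover have "(\<integral>x. (orbit_average ?T P ?f x)\<^sup>2 \<partial>cyclic_measure P b) = c\<^sup>2"
        using borel_measurable_continuous_onI[OF sq(1)[OF \<open>P \<ge> 1\<close>]] sq(2)[OF \<open>P \<ge> 1\<close>] P
        by (subst integral_cyclic_measure) (auto simp: orbit_average_cyclic_seq c_def)
      ultimately show "cyclic_measure P b \<in> G i"
        unfolding G_def i using cyclic_measure_invariant[OF P, of b] \<open>P \<ge> 1\<close> by auto
    qed
  next
    show "topspace shift.W \<inter> (\<Inter>i\<in>finite_unions B \<times> UNIV \<times> UNIV. G i) \<subseteq> ergodic_measures ?T"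
    proof
      fix \<mu> assume \<mu>: "\<mu> \<in> topspace shift.W \<inter> (\<Inter>i\<in>finite_unions B \<times> UNIV \<times> UNIV. G i)"
      then have inv: "\<mu> \<in> invariant_measures ?T" by (simp add: topspace_weak_topology)
      show "\<mu> \<in> ergodic_measures ?T"
      proof (rule ergodicI[OF inv measurable_full_shift B])
        fix V k and \<delta> :: real assume V: "V \<in> finite_unions B" and "\<delta> > 0"
        obtain m where m: "1 / real (Suc m) < \<delta>"
          using reals_Archimedean[OF \<open>\<delta> > 0\<close>] by (auto simp: inverse_eq_divide)
        have "\<mu> \<in> G (V, k, m)" using \<mu> V by auto
        then obtain n where "n \<ge> 1"
          "(\<integral>x. (orbit_average ?T n (inner_bump V k) x)\<^sup>2 \<partial>\<mu>) - (\<integral>x. inner_bump V k x \<partial>\<mu>)\<^sup>2 < 1 / real (Suc m)"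
          by (auto simp: G_def)
        then show "\<exists>n\<ge>1. (\<integral>x. (orbit_average ?T n (inner_bump V k) x)\<^sup>2 \<partial>\<mu>) - (\<integral>x. inner_bump V k x \<partial>\<mu>)\<^sup>2 < \<delta>"
          using m by (meson less_trans)
      qed
    qed
    show "ergodic_measures ?T \<subseteq> topspace shift.W" by (auto simp: ergodic_measures_def topspace_weak_topology)
  qed
qed

theorem theorem1p1:
  fixes MT :: "('a::{polish_space, perfect_space}) biseq measure set"
    and W :: "'a biseq measure topology"
  defines "MT \<equiv> invariant_measures full_shift"
    and "W \<equiv> weak_topology MT"
  shows "residual_in W (ergodic_measures full_shift) \<and>
    dense_gdelta_in W {\<mu> \<in> MT. msupp \<mu> = UNIV} \<and>
    dense_gdelta_in W {\<mu> \<in> MT. has_dim hausdorff_dim \<mu> 0} \<and>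
    dense_gdelta_in W {\<mu> \<in> MT. has_dim packing_dim \<mu> \<infinity>} \<and>
    dense_gdelta_in W {\<mu> \<in> MT. AE x in \<mu>. lower_rec full_shift x x = 0} \<and>
    dense_gdelta_in W {\<mu> \<in> MT. AE x in \<mu>. upper_rec full_shift x x = \<infinity>} \<and>
    dense_gdelta_in W {\<mu> \<in> MT. AE (x, y) in \<mu> \<Otimes>\<^sub>M \<mu>. lower_rec full_shift x y = 0} \<and>
    residual_in W {\<mu> \<in> MT. AE (x, y) in \<mu> \<Otimes>\<^sub>M \<mu>. upper_rec full_shift x y = \<infinity>}"
  unfolding W_def MT_def
proof (intro conjI)
  show "residual_in shift.W (ergodic_measures (full_shift :: 'a biseq \<Rightarrow> _))" by (rule residual_ergodic)
  show "dense_gdelta_in shift.W {\<mu> \<in> invariant_measures (full_shift :: 'a biseq \<Rightarrow> _). msupp \<mu> = UNIV}"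
    unfolding dense_gdelta_in_def using dense_full_support shift.gdelta_in_full_support by blast
  show "dense_gdelta_in shift.W {\<mu> \<in> invariant_measures (full_shift :: 'a biseq \<Rightarrow> _). has_dim hausdorff_dim \<mu> 0}"
    by (rule dense_gdelta_of_cyclic[OF shift.gdelta_in_hausdorff_dim_0 cyclic_measure_has_hausdorff_dim_0])
  show "dense_gdelta_in shift.W {\<mu> \<in> invariant_measures (full_shift :: 'a biseq \<Rightarrow> _). has_dim packing_dim \<mu> \<infinity>}"
    by (rule dense_gdelta_of_fast_decay[OF shift.gdelta_in_packing_dim_infinity])
      (intro shift.thin_imp_has_packing_dim_infinity fast_decay_thin invariant_measuresD(1))
  show "dense_gdelta_in shift.W {\<mu> \<in> invariant_measures (full_shift :: 'a biseq \<Rightarrow> _). AE x in \<mu>. lower_rec full_shift x x = 0}"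
  proof (rule dense_gdelta_of_cyclic[OF shift.gdelta_in_lower_rec[OF continuous_on_full_shift]])
    fix P :: nat and b :: "nat \<Rightarrow> 'a" assume "P > 0"
    show "AE x in cyclic_measure P b. lower_rec full_shift x x = 0"
      using AE_cyclic_measure[OF \<open>P > 0\<close>, of b]
      by (rule eventually_mono) (auto simp: lower_rec_cyclic_seq)
  qed
  show "dense_gdelta_in shift.W {\<mu> \<in> invariant_measures (full_shift :: 'a biseq \<Rightarrow> _). AE x in \<mu>. upper_rec full_shift x x = \<infinity>}"
    by (rule dense_gdelta_of_fast_decay[OF shift.gdelta_in_upper_rec[OF continuous_on_full_shift]])
      (intro fast_decay_upper_rec invariant_measuresD)
  show "dense_gdelta_in shift.W {\<mu> \<in> invariant_measures (full_shift :: 'a biseq \<Rightarrow> _).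
      AE (x, y) in \<mu> \<Otimes>\<^sub>M \<mu>. lower_rec full_shift x y = 0}"
    by (rule dense_gdelta_of_cyclic[OF shift.gdelta_in_lower_rec_pair[OF continuous_on_full_shift]
          cyclic_measure_lower_rec_pair])
  \<comment> \<open>The set is shown to be a dense G_delta, from which residuality follows.\<close>
  show "residual_in shift.W {\<mu> \<in> invariant_measures (full_shift :: 'a biseq \<Rightarrow> _).
      AE (x, y) in \<mu> \<Otimes>\<^sub>M \<mu>. upper_rec full_shift x y = \<infinity>}"
    by (rule dense_gdelta_imp_residual, rule dense_gdelta_of_fast_decay[OF
          shift.gdelta_in_upper_rec_pair[OF continuous_on_full_shift]])
      (intro fast_decay_upper_rec_pair invariant_measuresD)
qed

end
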